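(* Consider the equation $$\ddot x+\gamma\dot x+g(x)=f(\boldsymbol{\omega}t),$$ with $f(\boldsymbol{\psi})=\sum_{\boldsymbol{\nu}\in\mathbb{Z}^d}e^{i\boldsymbol{\nu}\cdot\boldsymbol{\psi}}f_{\boldsymbol{\nu}}$ and $g$ both analytic in their arguments, and with $\boldsymbol{\omega}\in\mathbb{R}^d$ satisfying the Diophantine condition $|\boldsymbol{\omega}\cdot\boldsymbol{\nu}|\ge C_0|\boldsymbol{\nu}|^{-\tau}$ for all $\boldsymbol{\nu}\in\mathbb{Z}^d\setminus\{\boldsymbol 0\}$. Assume that there exists $c_0\in\mathbb{R}$ such that $g(c_0)=f_{\boldsymbol 0}$ and $g'(c_0)\ne 0$. There exists $\gamma_0>0$ such that for $\gamma>\gamma_0$ there is a unique quasi-periodic solution $x_0(t)$ which has the same frequency vector $\boldsymbol{\omega}$ as $f$, reduces to $c_0$ in the limit $\gamma\to\infty$, and extends to a function analytic (in $\varepsilon=1/\gamma$) in a disk with center on the positive real axis and boundary tangent to the vertical axis at the origin. Furthermore, there exists $\gamma_1\ge\gamma_0$ such that for $\gamma>\gamma_1$ there is a neighbourhood $\mathcal{B}$ of the point $(c_0,0)$, containing the orbit described by $x_0(t)$, with the property that all trajectories starting in $\mathcal{B}$ are attracted to the cycle described by $x_0(t)$ in the plane $(x,\dot x)$.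
   Context: $\gamma>0$ is a real parameter (dissipation coefficient). $f$ and $g$ are real-valued; analyticity of $f$ means that there are constants $F,\xi>0$ with $|f_{\boldsymbol{\nu}}|\le F e^{-\xi|\boldsymbol{\nu}|}$ for all $\boldsymbol{\nu}\in\mathbb{Z}^d$; $f_{\boldsymbol 0}$ is the average of $f$. Here $|\boldsymbol{\nu}|=|\nu_1|+\dots+|\nu_d|$, and $C_0>0$, $\tau>d-1$ are constants with $C_0$ small enough (for $d=1$ the condition is automatic). A quasi-periodic solution with frequency vector $\boldsymbol{\omega}$ is a solution of the form $X(\boldsymbol{\omega}t)$ with $X(\boldsymbol\psi)$ $2\pi$-periodic in each component of $\boldsymbol\psi\in\mathbb{R}^d$. A trajectory $(x(t),\dot x(t))$ is attracted to the cycle described by $x_0(t)$ if $(x(t)-x_0(t),\dot x(t)-\dot x_0(t))\to(0,0)$ as $t\to\infty$.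
   Formalization: The attraction of a neighbourhood of (c_0,0) is claimed only for g'(c_0)>0; for g'(c_0)<0 it fails (e.g. g(x)=-x, f=0, c_0=0 is a saddle for every γ). Existence, uniqueness and analyticity are kept for all g'(c_0)≠0. *)

theory Defs
  imports "HOL-Analysis.Analysis"
begin

definition real_analytic_on :: "(real \<Rightarrow> real) \<Rightarrow> real set \<Rightarrow> bool" where
  "real_analytic_on g S \<longleftrightarrow>
     (\<forall>x\<in>S. \<exists>r>0. \<exists>a. \<forall>y. \<bar>y - x\<bar> < r \<longrightarrow> (\<lambda>n. a n * (y - x) ^ n) sums g y)"

definition norm1 :: "int ^ 'd \<Rightarrow> real" where
  "norm1 \<nu> = (\<Sum>i\<in>UNIV. \<bar>real_of_int (\<nu> $ i)\<bar>)"

definition idot :: "real ^ 'd \<Rightarrow> int ^ 'd \<Rightarrow> real" where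
  "idot w \<nu> = (\<Sum>i\<in>UNIV. w $ i * real_of_int (\<nu> $ i))"

definition analytic_fourier :: "(int ^ 'd \<Rightarrow> complex) \<Rightarrow> (real ^ 'd \<Rightarrow> real) \<Rightarrow> bool" where
  "analytic_fourier fhat f \<longleftrightarrow>
     (\<exists>F>0. \<exists>\<xi>>0. \<forall>\<nu>. norm (fhat \<nu>) \<le> F * exp (- \<xi> * norm1 \<nu>)) \<and>
     (\<forall>\<psi>. ((\<lambda>\<nu>. exp (\<i> * of_real (idot \<psi> \<nu>)) * fhat \<nu>) has_sum complex_of_real (f \<psi>)) UNIV)"

definition diophantine :: "real \<Rightarrow> real \<Rightarrow> real ^ 'd \<Rightarrow> bool" where
  "diophantine C0 \<tau> \<omega> \<longleftrightarrow> (\<forall>\<nu>. \<nu> \<noteq> 0 \<longrightarrow> \<bar>idot \<omega> \<nu>\<bar> \<ge> C0 * norm1 \<nu> powr (- \<tau>))"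

text \<open>The phase-space curve \<open>(x, v)\<close>, with \<open>v\<close> the velocity of \<open>x\<close>, solves
  \<open>x'' + \<gamma> x' + g(x) = h(t)\<close> on the time set \<open>S\<close>; derivatives are one-sided at an endpoint of \<open>S\<close>.\<close>

definition trajectory_on ::
  "real set \<Rightarrow> real \<Rightarrow> (real \<Rightarrow> real) \<Rightarrow> (real \<Rightarrow> real) \<Rightarrow> (real \<Rightarrow> real) \<Rightarrow> (real \<Rightarrow> real) \<Rightarrow> bool" where
  "trajectory_on S \<gamma> g h x v \<longleftrightarrow>
     (\<forall>t\<in>S. (x has_real_derivative v t) (at t within S) \<and>
             (v has_real_derivative (h t - \<gamma> * v t - g (x t))) (at t within S))"

text \<open>Continuity of the hull function \<open>X\<close> is essential: for two or more rationally independent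
  frequencies the line \<open>t \<omega>\<close> is injective modulo the periods, so that every function of \<open>t\<close> would
  be quasi-periodic if \<open>X\<close> were allowed to be arbitrary.\<close>

definition quasiperiodic :: "real ^ 'd \<Rightarrow> (real \<Rightarrow> real) \<Rightarrow> bool" where
  "quasiperiodic \<omega> x \<longleftrightarrow>
     (\<exists>X. continuous_on UNIV X \<and> (\<forall>\<psi> i. X (\<psi> + axis i (2 * pi)) = X \<psi>) \<and>
          (\<forall>t. x t = X (t *\<^sub>R \<omega>)))"

text \<open>The open disk \<open>ball R R\<close> in the complex plane is tangent to the imaginary axis at \<open>0\<close>.
  The bound \<open>1 / \<gamma>0 \<le> 2 * R\<close> says that it contains all \<open>\<epsilon> = 1 / \<gamma>\<close> with \<open>\<gamma> > \<gamma>0\<close>.\<close>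

definition extends_to_tangent_disk :: "real \<Rightarrow> (real \<Rightarrow> real \<Rightarrow> real) \<Rightarrow> bool" where
  "extends_to_tangent_disk \<gamma>0 x \<longleftrightarrow>
     (\<exists>R xc. 0 < R \<and> 1 / \<gamma>0 \<le> 2 * R \<and>
        (\<forall>t. (\<lambda>\<epsilon>. xc \<epsilon> t) analytic_on ball (complex_of_real R) R) \<and>
        (\<forall>\<gamma>>\<gamma>0. \<forall>t. xc (complex_of_real (1 / \<gamma>)) t = complex_of_real (x \<gamma> t)))"

definition response_family ::
  "real \<Rightarrow> (real \<Rightarrow> real) \<Rightarrow> (real ^ 'd \<Rightarrow> real) \<Rightarrow> real ^ 'd \<Rightarrow> real \<Rightarrow> (real \<Rightarrow> real \<Rightarrow> real) \<Rightarrow> bool" where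
  "response_family \<gamma>0 g f \<omega> c0 x \<longleftrightarrow>
     (\<forall>\<gamma>>\<gamma>0. quasiperiodic \<omega> (x \<gamma>) \<and>
               (\<exists>v. trajectory_on UNIV \<gamma> g (\<lambda>t. f (t *\<^sub>R \<omega>)) (x \<gamma>) v)) \<and>
     uniform_limit UNIV x (\<lambda>t. c0) at_top \<and>
     extends_to_tangent_disk \<gamma>0 x"

definition attracted_to ::
  "(real \<Rightarrow> real) \<Rightarrow> (real \<Rightarrow> real) \<Rightarrow> (real \<Rightarrow> real) \<Rightarrow> (real \<Rightarrow> real) \<Rightarrow> bool" where
  "attracted_to x v x0 v0 \<longleftrightarrow> ((\<lambda>t. (x t - x0 t, v t - v0 t)) \<longlongrightarrow> (0, 0)) at_top"

text \<open>The trajectories starting in \<open>B\<close>, at an arbitrary initial time, exist for all later times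
  (no blow-up), and all of them are attracted to the curve \<open>(x0, v0)\<close>.\<close>

definition attracts_all_from ::
  "real \<Rightarrow> (real \<Rightarrow> real) \<Rightarrow> (real \<Rightarrow> real) \<Rightarrow> (real \<Rightarrow> real) \<Rightarrow> (real \<Rightarrow> real) \<Rightarrow> (real \<times> real) set \<Rightarrow> bool" where
  "attracts_all_from \<gamma> g h x0 v0 B \<longleftrightarrow>
     (\<forall>s. \<forall>p\<in>B.
        (\<exists>x v. trajectory_on {s..} \<gamma> g h x v \<and> (x s, v s) = p) \<and>
        (\<forall>x v. trajectory_on {s..} \<gamma> g h x v \<and> (x s, v s) = p \<longrightarrow> attracted_to x v x0 v0))"

text \<open>If \<open>g'(c0) < 0\<close> the equilibrium is a saddle, and no neighbourhood of it is attracted to a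
  single curve, however large the damping. Hence attraction can be claimed only for \<open>g'(c0) > 0\<close>.
  The simplest instance is \<open>g(x) = - x\<close>, \<open>f = 0\<close>, \<open>c0 = 0\<close>.\<close>

lemma saddle_attracts_no_neighbourhood:
  assumes "open B" "(0, 0) \<in> B"
  shows "\<not> attracts_all_from \<gamma> (\<lambda>x. - x) (\<lambda>t. 0) x0 v0 B"
proof
  assume att: "attracts_all_from \<gamma> (\<lambda>x. - x) (\<lambda>t. 0) x0 v0 B"
  define l where "l = (sqrt (\<gamma>\<^sup>2 + 4) - \<gamma>) / 2"
  have "\<bar>\<gamma>\<bar> < sqrt (\<gamma>\<^sup>2 + 4)"
    by (rule real_less_rsqrt) simp
  hence lpos: "l > 0" by (simp add: l_def)
  have lroot: "l * l = 1 - \<gamma> * l"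
    by (simp add: l_def field_simps power2_eq_square flip: real_sqrt_mult)
  have sol: "trajectory_on {0..} \<gamma> (\<lambda>x. - x) (\<lambda>t. 0) (\<lambda>t. d * exp (l * t)) (\<lambda>t. d * l * exp (l * t))" for d
  proof -
    have eq: "exp (l * t) * l * (d * l) = d * exp (l * t) - \<gamma> * (d * l * exp (l * t))" for t
    proof -
      have "exp (l * t) * l * (d * l) = d * (l * l) * exp (l * t)" by (simp add: ac_simps)
      thus ?thesis unfolding lroot by (simp add: algebra_simps)
    qed
    show ?thesis
      unfolding trajectory_on_def by (auto intro!: derivative_eq_intros eq)
  qed
  have "((\<lambda>d. (d, d * l)) \<longlongrightarrow> (0, 0 * l)) (at_right (0::real))"
    by (intro tendsto_intros)
  hence "\<forall>\<^sub>F d in at_right (0::real). (d, d * l) \<in> B"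
    using assms by (auto elim: topological_tendstoD)
  hence "\<forall>\<^sub>F d in at_right (0::real). (d, d * l) \<in> B \<and> d > 0"
    by (rule eventually_conj) (simp add: eventually_at_right_less)
  then obtain d where d: "(d, d * l) \<in> B" "d > 0"
    using eventually_happens trivial_limit_at_right_real by blast
  have fst0: "((\<lambda>t. e * exp (l * t) - x0 t) \<longlongrightarrow> 0) at_top" if "(e, e * l) \<in> B" for e
  proof -
    have "attracted_to (\<lambda>t. e * exp (l * t)) (\<lambda>t. e * l * exp (l * t)) x0 v0"
      using att that sol[of e] unfolding attracts_all_from_def by fastforce
    thus ?thesis unfolding attracted_to_def by (auto dest: tendsto_fst)
  qed
  have "((\<lambda>t. d * exp (l * t)) \<longlongrightarrow> 0) at_top"
    using tendsto_diff[OF fst0[of d] fst0[of 0]] d assms by simp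
  hence "\<forall>\<^sub>F t in at_top. d * exp (l * t) < d"
    using d(2) by (rule order_tendstoD(2))
  hence "\<forall>\<^sub>F t in at_top. d * exp (l * t) < d \<and> t > 0"
    by (rule eventually_conj) (rule eventually_gt_at_top)
  then obtain t where "d * exp (l * t) < d" "t > 0"
    using eventually_happens trivial_limit_at_top_linorder by blast
  moreover have "exp (l * t) > 1" using lpos \<open>t > 0\<close> by simp
  ultimately show False using d(2) by simp
qed

end

theory Submission
  imports Defs "HOL-Complex_Analysis.Complex_Analysis"
begin

text \<open>Put \<open>\<epsilon> = 1 / \<gamma>\<close>, \<open>a = g'(c0)\<close>, and write \<open>\<partial>\<close> for the derivative along \<open>\<omega>\<close> of a hull function, so
  that quasi-periodic solutions are bounded continuous solutions on the torus of an equation in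
  \<open>\<partial>\<close>. Near \<open>c0\<close> one has \<open>g (c0 + y) = g c0 + a y + y\<^sup>2 k(y)\<close> with \<open>k\<close> holomorphic.

  \<^emph>\<open>Existence.\<close> The mean-free forcing \<open>f - f\<^sub>0\<close> has two successive primitives \<open>F1\<close>, \<open>F2\<close> along the flow
  (\<open>forcing_primitives\<close>); this is where the Diophantine condition and the exponential decay of the
  coefficients are used, and it is the only encounter with small divisors. The leading part of the
  response is \<open>c0 + \<epsilon> F1\<close>. Substituting \<open>x = c0 + \<epsilon> v\<close>, \<open>v = F1 + w\<close>, turns the equation into
  \<open>(\<partial> + a \<epsilon>) (\<partial> + 1/\<epsilon>) w = - \<epsilon> v\<^sup>2 k(\<epsilon> v) - \<partial> S\<close> with \<open>S = a F2 + (f - f\<^sub>0) - a \<epsilon> w\<close>.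
  Both factors on the left are inverted by explicit Laplace integrals, with norms \<open>1 / (\<bar>a\<bar> Re \<epsilon>)\<close> and
  \<open>1 / Re (1/\<epsilon>)\<close>. In the disk \<open>\<bar>\<epsilon> - R\<bar> < R\<close>, where \<open>\<bar>\<epsilon>\<bar>\<^sup>2 < 2 R Re \<epsilon>\<close>, partial fractions show that
  the inverse of the product is \<open>O(R / \<bar>\<epsilon>\<bar>)\<close>, and \<open>O(R)\<close> when it is applied to a derivative
  (\<open>damped_inverse_bound\<close>). The factor \<open>\<epsilon>\<close> in front of the nonlinear term and the \<open>\<partial>\<close> in front of \<open>S\<close>
  make up for the difference, so for small \<open>R\<close> the equation for \<open>w\<close> is a contraction, uniformly up to the
  boundary point \<open>0\<close> of the disk (\<open>step_contraction\<close>). The iteration runs in a class of functions that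
  are continuous and periodic in the angles, holomorphic in \<open>\<epsilon>\<close>, and real for real \<open>\<epsilon>\<close>; uniform limits stay
  in the class, so the solution has all the properties that are asked for (\<open>real_response\<close>).

  \<^emph>\<open>Uniqueness.\<close> For large \<open>\<gamma>\<close> two solutions that stay close to \<open>c0\<close> for all times coincide, since
  the linearised equation has no bounded solution besides \<open>0\<close>
  (\<open>bounded_trajectories_coincide\<close>). Two response families therefore agree for large \<open>\<gamma>\<close>, and by
  the identity theorem on the common part of their disks they agree for all \<open>\<gamma> > \<gamma>0\<close>
  (\<open>tangent_disk_identity\<close>).

  \<^emph>\<open>Attraction.\<close> Let \<open>a > 0\<close>. For the difference \<open>z\<close> of two solutions near \<open>c0\<close>, the quantity
  \<open>(z + z'/\<gamma>)\<^sup>2 + (z'/\<gamma>)\<^sup>2\<close> decays exponentially (\<open>weighted_gap_dissipates\<close>). This confines solutions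
  that start near \<open>(c0, 0)\<close>, hence gives their global existence, and attracts them to the response
  solution (\<open>attracting_neighbourhood\<close>).\<close>

section \<open>Trigonometric series with exponentially decaying coefficients\<close>

definition exp_decay :: "(int ^ 'd \<Rightarrow> complex) \<Rightarrow> bool" where
  "exp_decay c \<longleftrightarrow> (\<exists>F>0. \<exists>\<xi>>0. \<forall>\<nu>. norm (c \<nu>) \<le> F * exp (- \<xi> * norm1 \<nu>))"

definition trig_series :: "(int ^ 'd \<Rightarrow> complex) \<Rightarrow> real ^ 'd \<Rightarrow> complex" where
  "trig_series c \<psi> = (\<Sum>\<^sub>\<infinity>\<nu>. exp (\<i> * of_real (idot \<psi> \<nu>)) * c \<nu>)"

lemma norm1_nonneg: "norm1 \<nu> \<ge> 0"
  unfolding norm1_def by (intro sum_nonneg) auto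

lemma norm1_ge_1:
  assumes "\<nu> \<noteq> 0" shows "norm1 \<nu> \<ge> 1"
proof -
  obtain i where i: "\<nu> $ i \<noteq> 0" using assms by (auto simp: vec_eq_iff)
  have "1 \<le> \<bar>real_of_int (\<nu> $ i)\<bar>" using i by linarith
  also have "\<dots> \<le> norm1 \<nu>" unfolding norm1_def by (rule member_le_sum) auto
  finally show ?thesis .
qed

lemma idot_add_scaleR: "idot (\<psi> + t *\<^sub>R w) \<nu> = idot \<psi> \<nu> + t * idot w \<nu>"
  by (simp add: idot_def algebra_simps sum.distrib sum_distrib_left)

lemma abs_idot_le: "\<bar>idot w \<nu>\<bar> \<le> norm w * norm1 \<nu>"
proof -
  have "\<bar>idot w \<nu>\<bar> \<le> (\<Sum>i\<in>UNIV. \<bar>w $ i * real_of_int (\<nu> $ i)\<bar>)"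
    unfolding idot_def by (rule sum_abs)
  also have "\<dots> \<le> (\<Sum>i\<in>UNIV. norm w * \<bar>real_of_int (\<nu> $ i)\<bar>)"
    by (intro sum_mono) (auto simp: abs_mult intro!: mult_right_mono component_le_norm_cart)
  finally show ?thesis by (simp add: norm1_def sum_distrib_left)
qed

lemma idot_axis: "idot (axis i c) \<nu> = c * real_of_int (\<nu> $ i)"
  unfolding idot_def axis_def
  by (simp add: if_distrib if_distribR cong: if_cong)

lemma summable_exp_abs_int:
  assumes "\<xi> > 0"
  shows "(\<lambda>k::int. exp (- \<xi> * \<bar>real_of_int k\<bar>)) summable_on UNIV"
proof -
  have nat: "(\<lambda>n::nat. exp (- \<xi> * real n)) summable_on UNIV"
  proof -
    have "summable (\<lambda>n::nat. exp (- \<xi>) ^ n)"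
      using assms by (intro summable_geometric) auto
    hence "summable (\<lambda>n::nat. exp (- \<xi> * real n))"
      by (simp add: exp_of_nat_mult[symmetric] mult.commute)
    thus ?thesis by (intro summable_nonneg_imp_summable_on) auto
  qed
  have "(\<lambda>k::int. exp (- \<xi> * \<bar>real_of_int k\<bar>)) summable_on range int"
    by (subst summable_on_reindex) (use nat in \<open>auto simp: o_def\<close>)
  moreover have "(\<lambda>k::int. exp (- \<xi> * \<bar>real_of_int k\<bar>)) summable_on range (\<lambda>n. - int n)"
    by (subst summable_on_reindex) (use nat in \<open>auto simp: o_def inj_on_def\<close>)
  moreover have "range int \<union> range (\<lambda>n. - int n) = UNIV"
  proof -
    have "k \<in> range int \<union> range (\<lambda>n. - int n)" for k
      by (cases k rule: int_cases2) auto
    thus ?thesis by blast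
  qed
  ultimately show ?thesis using summable_on_union by metis
qed

text \<open>The summand is a product over the coordinates. A finite set of indices lies in a box, and the sum
  over a box factors into one-dimensional sums, each bounded by the full sum over the integers.\<close>

lemma summable_exp_norm1:
  assumes "\<xi> > 0"
  shows "(\<lambda>\<nu>::int ^ 'd. exp (- \<xi> * norm1 \<nu>)) summable_on UNIV"
proof (rule nonneg_bdd_above_summable_on)
  define K where "K = (\<Sum>\<^sub>\<infinity>k::int. exp (- \<xi> * \<bar>real_of_int k\<bar>))"
  show "bdd_above (sum (\<lambda>\<nu>::int ^ 'd. exp (- \<xi> * norm1 \<nu>)) ` {F. F \<subseteq> UNIV \<and> finite F})"
  proof (rule bdd_aboveI2)
    fix F :: "(int ^ 'd) set" assume "F \<in> {F. F \<subseteq> UNIV \<and> finite F}"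
    hence F: "finite F" by simp
    define B where "B i = (\<lambda>\<nu>. \<nu> $ i) ` F" for i
    have finB: "finite (B i)" for i using F by (simp add: B_def)
    have e: "exp (- \<xi> * norm1 \<nu>) = (\<Prod>i\<in>UNIV. exp (- \<xi> * \<bar>real_of_int (\<nu> $ i)\<bar>))" for \<nu> :: "int ^ 'd"
      unfolding norm1_def by (simp add: exp_sum sum_distrib_left flip: sum_negf)
    have "(\<Sum>\<nu>\<in>F. exp (- \<xi> * norm1 \<nu>))
        = (\<Sum>p\<in>(\<lambda>\<nu>. ($) \<nu>) ` F. \<Prod>i\<in>UNIV. exp (- \<xi> * \<bar>real_of_int (p i)\<bar>))"
      by (subst sum.reindex) (auto simp: e[simplified] inj_on_def vec_nth_inject)
    also have "\<dots> \<le> (\<Sum>p\<in>PiE UNIV B. \<Prod>i\<in>UNIV. exp (- \<xi> * \<bar>real_of_int (p i)\<bar>))"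
      by (intro sum_mono2) (auto simp: B_def F intro!: finite_PiE finB prod_nonneg)
    also have "\<dots> = (\<Prod>i\<in>UNIV. \<Sum>k\<in>B i. exp (- \<xi> * \<bar>real_of_int k\<bar>))"
      by (rule prod_sum_PiE[symmetric]) (auto simp: finB)
    also have "\<dots> \<le> (\<Prod>i\<in>(UNIV::'d set). K)"
      unfolding K_def
      by (intro prod_mono conjI sum_nonneg finite_sum_le_infsum summable_exp_abs_int assms finB) auto
    finally show "(\<Sum>\<nu>\<in>F. exp (- \<xi> * norm1 \<nu>)) \<le> K ^ CARD('d)" by simp
  qed
qed auto

lemma exp_decay_summable_norm:
  fixes c :: "int ^ 'd \<Rightarrow> complex"
  assumes "exp_decay c"
  shows "(\<lambda>\<nu>. norm (c \<nu>)) summable_on UNIV"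
proof -
  obtain F \<xi> where F: "F > 0" "\<xi> > 0" "\<And>\<nu>. norm (c \<nu>) \<le> F * exp (- \<xi> * norm1 \<nu>)"
    using assms unfolding exp_decay_def by blast
  have "(\<lambda>\<nu>::int ^ 'd. F * exp (- \<xi> * norm1 \<nu>)) summable_on UNIV"
    by (intro summable_on_cmult_right summable_exp_norm1 F)
  thus ?thesis by (rule Infinite_Sum.abs_summable_on_comparison_test') (use F(3) in auto)
qed

text \<open>Half of the exponential rate absorbs any power of \<open>norm1 \<nu>\<close>. This serves both for derivatives, which
  multiply by \<open>idot w \<nu>\<close>, and for primitives, which divide by it.\<close>

lemma exp_decay_mult_poly:
  assumes "exp_decay c" "p \<ge> 0" "K > 0" "\<And>\<nu>. \<nu> \<noteq> 0 \<Longrightarrow> norm (b \<nu>) \<le> K * norm1 \<nu> powr p * norm (c \<nu>)"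
    "norm (b 0) \<le> K * norm (c 0)"
  shows "exp_decay b"
proof -
  obtain F \<xi> where F: "F > 0" "\<xi> > 0" "\<And>\<nu>. norm (c \<nu>) \<le> F * exp (- \<xi> * norm1 \<nu>)"
    using assms unfolding exp_decay_def by blast
  define q where "q = p + 1"
  have q: "q > 0" using assms(2) by (simp add: q_def)
  define L where "L = (q / (\<xi> / 2)) powr q + 1"
  have Lpos: "L \<ge> 1" by (simp add: L_def)
  \<comment> \<open>from \<open>y \<le> exp y\<close> at \<open>y = \<xi> x / (2 q)\<close>, raised to the power \<open>q\<close>; \<open>q\<close> replaces \<open>p\<close> to be positive\<close>
  have growth: "x powr p \<le> L * exp (\<xi> / 2 * x)" if "x \<ge> 1" for x
  proof -
    have "x powr p \<le> x powr q" using that by (intro powr_mono) (auto simp: q_def)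
    also have "x \<le> (q / (\<xi> / 2)) * exp ((\<xi> / 2) * x / q)"
    proof -
      have "(\<xi> / 2) * x / q \<le> exp ((\<xi> / 2) * x / q)"
        using exp_ge_add_one_self[of "(\<xi> / 2) * x / q"] by linarith
      thus ?thesis using q F by (simp add: field_simps)
    qed
    hence "x powr q \<le> ((q / (\<xi> / 2)) * exp ((\<xi> / 2) * x / q)) powr q"
      using that q by (intro powr_mono2) auto
    also have "\<dots> = (q / (\<xi> / 2)) powr q * exp (\<xi> / 2 * x)"
      using q F by (subst powr_mult) (auto simp: powr_def)
    also have "\<dots> \<le> L * exp (\<xi> / 2 * x)" by (intro mult_right_mono) (auto simp: L_def)
    finally show ?thesis by simp
  qed
  have "norm (b \<nu>) \<le> (K * L * F) * exp (- (\<xi> / 2) * norm1 \<nu>)" for \<nu>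
  proof (cases "\<nu> = 0")
    case True
    have "norm (b 0) \<le> K * (F * 1)"
      using order_trans[OF assms(5) mult_left_mono[OF F(3)[of 0]]] assms(3) by (simp add: norm1_def)
    also have "\<dots> \<le> K * L * F" using Lpos assms(3) F(1) by (simp add: mult_right_mono)
    finally show ?thesis using True by (simp add: norm1_def)
  next
    case False
    have "norm (b \<nu>) \<le> K * norm1 \<nu> powr p * norm (c \<nu>)" by (rule assms(4)[OF False])
    also have "\<dots> \<le> K * (L * exp (\<xi> / 2 * norm1 \<nu>)) * (F * exp (- \<xi> * norm1 \<nu>))"
      using growth[OF norm1_ge_1[OF False]] F assms(3) Lpos
      by (intro mult_mono mult_nonneg_nonneg) auto
    also have "\<dots> = (K * L * F) * (exp (\<xi> / 2 * norm1 \<nu>) * exp (- \<xi> * norm1 \<nu>))" by simp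
    also have "exp (\<xi> / 2 * norm1 \<nu>) * exp (- \<xi> * norm1 \<nu>) = exp (- (\<xi> / 2) * norm1 \<nu>)"
      by (simp add: exp_add[symmetric])
    finally show ?thesis .
  qed
  moreover have "K * L * F > 0" "\<xi> / 2 > 0" using assms(3) Lpos F by auto
  ultimately show ?thesis unfolding exp_decay_def by blast
qed

text \<open>The Diophantine bound makes the small divisors at worst polynomial. The mean value must vanish because
  the divisor at \<open>\<nu> = 0\<close> is \<open>0\<close>; the default value \<open>0 / 0 = 0\<close> then gives the primitive mean value \<open>0\<close>.\<close>

lemma exp_decay_divide_small_divisor:
  fixes c :: "int ^ 'd \<Rightarrow> complex"
  assumes "exp_decay c" "c 0 = 0" "diophantine C0 \<tau> \<omega>" "C0 > 0" "\<tau> \<ge> 0"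
  shows "exp_decay (\<lambda>\<nu>. c \<nu> / (\<i> * of_real (idot \<omega> \<nu>)))"
proof (rule exp_decay_mult_poly[OF assms(1,5), of "1 / C0"])
  fix \<nu> :: "int ^ 'd" assume nu: "\<nu> \<noteq> 0"
  have n: "norm1 \<nu> > 0" using norm1_ge_1[OF nu] by simp
  have "C0 * norm1 \<nu> powr (- \<tau>) \<le> \<bar>idot \<omega> \<nu>\<bar>"
    using assms(3) nu unfolding diophantine_def by blast
  moreover have "C0 * norm1 \<nu> powr (- \<tau>) > 0" using n assms(4) by simp
  moreover from calculation have "\<bar>idot \<omega> \<nu>\<bar> * (C0 * norm1 \<nu> powr (- \<tau>)) > 0"
    by (metis mult_pos_pos order_less_le_trans)
  ultimately have "norm (c \<nu>) / \<bar>idot \<omega> \<nu>\<bar> \<le> norm (c \<nu>) / (C0 * norm1 \<nu> powr (- \<tau>))"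
    by (intro divide_left_mono) auto
  also have "\<dots> = 1 / C0 * norm1 \<nu> powr \<tau> * norm (c \<nu>)"
    by (simp add: powr_minus field_simps)
  finally show "norm (c \<nu> / (\<i> * of_real (idot \<omega> \<nu>))) \<le> 1 / C0 * norm1 \<nu> powr \<tau> * norm (c \<nu>)"
    by (simp add: norm_divide norm_mult)
qed (use assms in auto)

lemma trig_summable:
  assumes "exp_decay c"
  shows "(\<lambda>\<nu>. exp (\<i> * of_real (idot \<psi> \<nu>)) * c \<nu>) summable_on UNIV"
  by (rule abs_summable_summable) (simp add: norm_mult exp_decay_summable_norm[OF assms])

lemma trig_has_sum:
  assumes "exp_decay c"
  shows "((\<lambda>\<nu>. exp (\<i> * of_real (idot \<psi> \<nu>)) * c \<nu>) has_sum trig_series c \<psi>) UNIV"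
  unfolding trig_series_def by (rule has_sum_infsum[OF trig_summable[OF assms]])

lemma trig_bounded:
  assumes "exp_decay c"
  shows "\<exists>M. \<forall>\<psi>. norm (trig_series c \<psi>) \<le> M"
proof (intro exI allI)
  fix \<psi>
  show "norm (trig_series c \<psi>) \<le> (\<Sum>\<^sub>\<infinity>\<nu>. norm (c \<nu>))"
    by (rule norm_infsum_le[OF trig_has_sum[OF assms] has_sum_infsum[OF exp_decay_summable_norm[OF assms]]])
      (simp add: norm_mult)
qed

lemma trig_periodic: "trig_series c (\<psi> + axis i (2 * pi)) = trig_series c \<psi>"
proof -
  have "exp (\<i> * of_real (idot (\<psi> + axis i (2 * pi)) \<nu>)) = exp (\<i> * of_real (idot \<psi> \<nu>))" for \<nu>
  proof -
    have "idot (\<psi> + axis i (2 * pi)) \<nu> = idot \<psi> \<nu> + 2 * pi * real_of_int (\<nu> $ i)"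
      using idot_add_scaleR[of \<psi> 1 "axis i (2 * pi)" \<nu>] by (simp add: idot_axis)
    hence "exp (\<i> * of_real (idot (\<psi> + axis i (2 * pi)) \<nu>))
        = exp (\<i> * of_real (idot \<psi> \<nu>)) * exp (2 * of_int (\<nu> $ i) * pi * \<i>)"
      by (simp add: exp_add[symmetric] algebra_simps)
    also have "exp (2 * of_int (\<nu> $ i) * pi * \<i>) = 1"
      by (rule exp_integer_2pi) auto
    finally show ?thesis by simp
  qed
  thus ?thesis by (simp add: trig_series_def)
qed

lemma norm_exp_i_diff_le: "norm (exp (\<i> * of_real x) - exp (\<i> * of_real y)) \<le> \<bar>x - y\<bar>"
proof -
  have "norm (exp (\<i> * of_real x) - exp (\<i> * of_real y)) = norm (exp (\<i> * of_real (x - y)) - 1)"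
  proof -
    have "exp (\<i> * of_real x) - exp (\<i> * of_real y) = exp (\<i> * of_real y) * (exp (\<i> * of_real (x - y)) - 1)"
      by (simp add: algebra_simps exp_add[symmetric])
    thus ?thesis by (simp add: norm_mult)
  qed
  also have "\<dots> \<le> \<bar>x - y\<bar>"
    using Taylor_exp[of "\<i> * of_real (x - y)" 0] by (simp add: norm_mult flip: of_real_diff)
  finally show ?thesis .
qed

lemma exp_decay_times_idot:
  fixes c :: "int ^ 'd \<Rightarrow> complex"
  assumes "exp_decay c"
  shows "exp_decay (\<lambda>\<nu>. \<i> * of_real (idot w \<nu>) * c \<nu>)"
proof (rule exp_decay_mult_poly[OF assms, of 1 "norm w + 1"])
  fix \<nu> :: "int ^ 'd" assume "\<nu> \<noteq> 0"
  hence "norm1 \<nu> \<ge> 1" by (rule norm1_ge_1)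
  have "norm (\<i> * of_real (idot w \<nu>) * c \<nu>) = \<bar>idot w \<nu>\<bar> * norm (c \<nu>)" by (simp add: norm_mult)
  also have "\<dots> \<le> ((norm w + 1) * norm1 \<nu>) * norm (c \<nu>)"
    using abs_idot_le[of w \<nu>] norm1_nonneg[of \<nu>] by (intro mult_right_mono) (auto simp: algebra_simps)
  finally show "norm (\<i> * of_real (idot w \<nu>) * c \<nu>) \<le> (norm w + 1) * norm1 \<nu> powr 1 * norm (c \<nu>)"
    using \<open>norm1 \<nu> \<ge> 1\<close> by simp
qed (auto simp: idot_def add_nonneg_pos)

lemma trig_continuous:
  fixes c :: "int ^ 'd \<Rightarrow> complex"
  assumes "exp_decay c"
  shows "continuous_on UNIV (trig_series c)"
proof -
  have "exp_decay (\<lambda>\<nu>. of_real (norm1 \<nu>) * c \<nu>)"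
    by (rule exp_decay_mult_poly[OF assms, of 1 1]) (auto simp: norm_mult norm1_nonneg, simp add: norm1_def)
  hence s: "(\<lambda>\<nu>. norm1 \<nu> * norm (c \<nu>)) summable_on UNIV"
    using exp_decay_summable_norm[of "\<lambda>\<nu>. of_real (norm1 \<nu>) * c \<nu>"] by (simp add: norm_mult norm1_nonneg)
  define L where "L = (\<Sum>\<^sub>\<infinity>\<nu>. norm1 \<nu> * norm (c \<nu>))"
  have L0: "L \<ge> 0" unfolding L_def by (intro infsum_nonneg mult_nonneg_nonneg norm1_nonneg) auto
  have lip: "dist (trig_series c \<psi>) (trig_series c \<phi>) \<le> L * dist \<psi> \<phi>" for \<psi> \<phi>
  proof -
    have "norm (trig_series c \<psi> - trig_series c \<phi>) \<le> dist \<psi> \<phi> * L"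
    proof (rule norm_infsum_le)
      show "((\<lambda>\<nu>. exp (\<i> * of_real (idot \<psi> \<nu>)) * c \<nu> - exp (\<i> * of_real (idot \<phi> \<nu>)) * c \<nu>) has_sum
         (trig_series c \<psi> - trig_series c \<phi>)) UNIV"
        using has_sum_add[OF trig_has_sum[OF assms, of \<psi>] has_sum_uminusI[OF trig_has_sum[OF assms, of \<phi>]]] by simp
      show "((\<lambda>\<nu>. dist \<psi> \<phi> * (norm1 \<nu> * norm (c \<nu>))) has_sum (dist \<psi> \<phi> * L)) UNIV"
        unfolding L_def by (intro has_sum_cmult_right has_sum_infsum s)
      fix \<nu>
      have "norm (exp (\<i> * of_real (idot \<psi> \<nu>)) * c \<nu> - exp (\<i> * of_real (idot \<phi> \<nu>)) * c \<nu>)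
          = norm (exp (\<i> * of_real (idot \<psi> \<nu>)) - exp (\<i> * of_real (idot \<phi> \<nu>))) * norm (c \<nu>)"
        by (simp add: norm_mult[symmetric] algebra_simps)
      also have "\<dots> \<le> \<bar>idot \<psi> \<nu> - idot \<phi> \<nu>\<bar> * norm (c \<nu>)"
        by (intro mult_right_mono norm_exp_i_diff_le) auto
      also have "idot \<psi> \<nu> - idot \<phi> \<nu> = idot (\<psi> - \<phi>) \<nu>"
        using idot_add_scaleR[of \<phi> 1 "\<psi> - \<phi>" \<nu>] by simp
      also have "\<bar>idot (\<psi> - \<phi>) \<nu>\<bar> * norm (c \<nu>) \<le> (dist \<psi> \<phi> * norm1 \<nu>) * norm (c \<nu>)"
        unfolding dist_norm by (intro mult_right_mono abs_idot_le) auto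
      finally show "norm (exp (\<i> * of_real (idot \<psi> \<nu>)) * c \<nu> - exp (\<i> * of_real (idot \<phi> \<nu>)) * c \<nu>)
        \<le> dist \<psi> \<phi> * (norm1 \<nu> * norm (c \<nu>))" by (simp add: mult.assoc)
    qed
    thus ?thesis by (simp add: dist_norm mult.commute)
  qed
  have "L-lipschitz_on UNIV (trig_series c)"
    using lip L0 by (auto intro!: lipschitz_onI)
  thus ?thesis by (rule lipschitz_on_continuous_on)
qed

lemma has_vector_derivative_quadratic_remainder:
  fixes D :: "real \<Rightarrow> 'a::real_normed_vector"
  assumes "\<And>y. norm (D y - D t - (y - t) *\<^sub>R D') \<le> K * (y - t)\<^sup>2"
  shows "(D has_vector_derivative D') (at t)"
  proof -
  have "((\<lambda>y. (1 / norm (y - t)) *\<^sub>R (D y - (D t + (y - t) *\<^sub>R D'))) \<longlongrightarrow> 0) (at t)"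
  proof (rule Lim_null_comparison)
    show "\<forall>\<^sub>F y in at t. norm ((1 / norm (y - t)) *\<^sub>R (D y - (D t + (y - t) *\<^sub>R D'))) \<le> K * \<bar>y - t\<bar>"
      unfolding eventually_at_filter
    proof (intro always_eventually allI impI)
      fix y assume "y \<noteq> t"
      hence "\<bar>y - t\<bar> > 0" by simp
      moreover have "norm (D y - (D t + (y - t) *\<^sub>R D')) \<le> K * \<bar>y - t\<bar> * \<bar>y - t\<bar>"
        using assms[of y] by (simp add: power2_eq_square algebra_simps flip: abs_mult)
      ultimately show "norm ((1 / norm (y - t)) *\<^sub>R (D y - (D t + (y - t) *\<^sub>R D'))) \<le> K * \<bar>y - t\<bar>"
        by (simp add: pos_divide_le_eq)
    qed
    have "((\<lambda>y. K * \<bar>y - t\<bar>) \<longlongrightarrow> K * \<bar>t - t\<bar>) (at t)" by (intro tendsto_intros)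
    thus "((\<lambda>y. K * \<bar>y - t\<bar>) \<longlongrightarrow> 0) (at t)" by simp
  qed
  thus ?thesis
    unfolding has_vector_derivative_def has_derivative_at_within
    by (simp add: bounded_linear_scaleR_left diff_diff_eq divide_inverse)
qed

text \<open>Termwise differentiation: the Taylor remainder \<open>\<bar>exp (i x) - 1 - i x\<bar> \<le> x\<^sup>2\<close> of each mode sums to a
  quadratic remainder for the series, because the coefficients of the second derivative are still
  summable.\<close>

lemma trig_derivative_along:
  fixes c :: "int ^ 'd \<Rightarrow> complex"
  assumes "exp_decay c"
  shows "((\<lambda>t. trig_series c (\<psi> + t *\<^sub>R w)) has_vector_derivative
      trig_series (\<lambda>\<nu>. \<i> * of_real (idot w \<nu>) * c \<nu>) (\<psi> + t *\<^sub>R w)) (at t)"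
proof (rule has_vector_derivative_quadratic_remainder)
  fix y
  let ?c1 = "\<lambda>\<nu>. \<i> * of_real (idot w \<nu>) * c \<nu>"
  let ?c2 = "\<lambda>\<nu>. \<i> * of_real (idot w \<nu>) * ?c1 \<nu>"
  have d1: "exp_decay ?c1" and d2: "exp_decay ?c2"
    by (intro exp_decay_times_idot assms)+
  have s2: "(\<lambda>\<nu>. (idot w \<nu>)\<^sup>2 * norm (c \<nu>)) summable_on UNIV"
  proof -
    have "norm (\<i> * of_real (idot w \<nu>) * ?c1 \<nu>) = (idot w \<nu>)\<^sup>2 * norm (c \<nu>)" for \<nu>
      by (simp add: norm_mult power2_eq_square)
    thus ?thesis using exp_decay_summable_norm[OF d2] by simp
  qed
  define K where "K = (\<Sum>\<^sub>\<infinity>\<nu>. (idot w \<nu>)\<^sup>2 * norm (c \<nu>))"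
  define h where "h = y - t"
  let ?e = "\<lambda>t \<nu>. exp (\<i> * of_real (idot (\<psi> + t *\<^sub>R w) \<nu>))"
  have "norm (trig_series c (\<psi> + y *\<^sub>R w) - trig_series c (\<psi> + t *\<^sub>R w)
        - of_real h * trig_series ?c1 (\<psi> + t *\<^sub>R w)) \<le> h\<^sup>2 * K"
  proof (rule norm_infsum_le)
    show "((\<lambda>\<nu>. ?e y \<nu> * c \<nu> - ?e t \<nu> * c \<nu> - of_real h * (?e t \<nu> * ?c1 \<nu>)) has_sum
       (trig_series c (\<psi> + y *\<^sub>R w) - trig_series c (\<psi> + t *\<^sub>R w)
        - of_real h * trig_series ?c1 (\<psi> + t *\<^sub>R w))) UNIV"
      using has_sum_add[OF has_sum_add[OF trig_has_sum[OF assms, of "\<psi> + y *\<^sub>R w"]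
            has_sum_uminusI[OF trig_has_sum[OF assms, of "\<psi> + t *\<^sub>R w"]]]
            has_sum_uminusI[OF has_sum_cmult_right[OF trig_has_sum[OF d1, of "\<psi> + t *\<^sub>R w"], of "of_real h"]]] by simp
    show "((\<lambda>\<nu>. h\<^sup>2 * ((idot w \<nu>)\<^sup>2 * norm (c \<nu>))) has_sum h\<^sup>2 * K) UNIV"
      unfolding K_def by (intro has_sum_cmult_right has_sum_infsum s2)
    fix \<nu>
    define s where "s = idot w \<nu>"
    have "?e y \<nu> = ?e t \<nu> * exp (\<i> * of_real (h * s))"
      by (simp add: exp_add[symmetric] idot_add_scaleR s_def h_def algebra_simps)
    hence "?e y \<nu> * c \<nu> - ?e t \<nu> * c \<nu> - of_real h * (?e t \<nu> * ?c1 \<nu>)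
        = ?e t \<nu> * c \<nu> * (exp (\<i> * of_real (h * s)) - 1 - \<i> * of_real (h * s))"
      by (simp add: algebra_simps s_def)
    moreover have "norm (exp (\<i> * of_real (h * s)) - 1 - \<i> * of_real (h * s)) \<le> (h * s)\<^sup>2"
      using Taylor_exp[of "\<i> * of_real (h * s)" 1] by (simp add: norm_mult power2_eq_square diff_diff_eq)
    ultimately have "norm (?e y \<nu> * c \<nu> - ?e t \<nu> * c \<nu> - of_real h * (?e t \<nu> * ?c1 \<nu>)) \<le> norm (c \<nu>) * (h * s)\<^sup>2"
      by (simp add: norm_mult mult_left_mono)
    thus "norm (?e y \<nu> * c \<nu> - ?e t \<nu> * c \<nu> - of_real h * (?e t \<nu> * ?c1 \<nu>)) \<le> h\<^sup>2 * ((idot w \<nu>)\<^sup>2 * norm (c \<nu>))"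
      by (simp add: power_mult_distrib s_def mult_ac)
  qed
  thus "norm (trig_series c (\<psi> + y *\<^sub>R w) - trig_series c (\<psi> + t *\<^sub>R w)
      - (y - t) *\<^sub>R trig_series ?c1 (\<psi> + t *\<^sub>R w)) \<le> K * (y - t)\<^sup>2"
    by (simp add: h_def scaleR_conv_of_real mult.commute)
qed

text \<open>Functions on the torus are represented by periodic functions of the angles. Their boundedness, a
  consequence of compactness, is made part of the definition.\<close>

definition torus_fun :: "(real ^ 'd \<Rightarrow> real) \<Rightarrow> bool" where
  "torus_fun X \<longleftrightarrow> continuous_on UNIV X \<and> (\<exists>M. \<forall>\<psi>. \<bar>X \<psi>\<bar> \<le> M) \<and> (\<forall>\<psi> i. X (\<psi> + axis i (2 * pi)) = X \<psi>)"

lemma torus_fun_Re_trig: "exp_decay c \<Longrightarrow> torus_fun (\<lambda>\<psi>. Re (trig_series c \<psi>))"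
  unfolding torus_fun_def
  by (auto intro!: continuous_intros trig_continuous simp: trig_periodic)
     (metis trig_bounded abs_Re_le_cmod order_trans)

text \<open>Taking the real part of the primitive keeps it real, without appeal to the symmetry of the
  coefficients of a real function: the derivative of the real part is the real part of the derivative.\<close>

lemma Re_trig_primitive:
  fixes c :: "int ^ 'd \<Rightarrow> complex"
  assumes "exp_decay c" "c 0 = 0" "diophantine C0 \<tau> \<omega>" "C0 > 0" "\<tau> \<ge> 0"
  defines "d \<equiv> (\<lambda>\<nu>. c \<nu> / (\<i> * of_real (idot \<omega> \<nu>)))"
  shows "((\<lambda>t. Re (trig_series d (\<psi> + t *\<^sub>R \<omega>))) has_real_derivative Re (trig_series c (\<psi> + t *\<^sub>R \<omega>))) (at t)"
proof -
  have dd: "exp_decay d" unfolding d_def by (rule exp_decay_divide_small_divisor[OF assms(1-5)])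
  have "\<i> * of_real (idot \<omega> \<nu>) * d \<nu> = c \<nu>" for \<nu>
  proof (cases "\<nu> = 0")
    case False
    have "norm1 \<nu> powr (- \<tau>) > 0" using norm1_ge_1[OF False] by simp
    hence "\<bar>idot \<omega> \<nu>\<bar> > 0"
      using assms(3,4) False unfolding diophantine_def
      by (metis mult_pos_pos order_less_le_trans)
    thus ?thesis by (simp add: d_def)
  qed (use assms in auto)
  hence "((\<lambda>t. trig_series d (\<psi> + t *\<^sub>R \<omega>)) has_vector_derivative trig_series c (\<psi> + t *\<^sub>R \<omega>)) (at t)"
    using trig_derivative_along[OF dd, of \<psi> \<omega> t] by simp
  from bounded_linear.has_vector_derivative[OF bounded_linear_Re this]
  show ?thesis by (simp add: has_real_derivative_iff_has_vector_derivative)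
qed

text \<open>\<open>F1\<close> is the leading part of the response. Inserting it leaves the source \<open>a F1\<close>, which is not small;
  the second primitive \<open>F2\<close> presents this source as a derivative along the flow, on which the inverse of
  the damped operator is small.\<close>

lemma forcing_primitives:
  fixes f :: "real ^ 'd \<Rightarrow> real"
  assumes "analytic_fourier fhat f" "C0 > 0" "\<tau> \<ge> 0" "diophantine C0 \<tau> \<omega>" "complex_of_real m = fhat 0"
  obtains F1 F2 where "torus_fun f" "torus_fun F1" "torus_fun F2"
    "\<And>\<psi> t. ((\<lambda>t. F1 (\<psi> + t *\<^sub>R \<omega>)) has_real_derivative f (\<psi> + t *\<^sub>R \<omega>) - m) (at t)"
    "\<And>\<psi> t. ((\<lambda>t. F2 (\<psi> + t *\<^sub>R \<omega>)) has_real_derivative F1 (\<psi> + t *\<^sub>R \<omega>)) (at t)"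
proof -
  have fd: "exp_decay fhat" using assms(1) unfolding analytic_fourier_def exp_decay_def by blast
  have fs: "trig_series fhat \<psi> = of_real (f \<psi>)" for \<psi>
    using has_sum_unique[OF trig_has_sum[OF fd, of \<psi>]] assms(1) unfolding analytic_fourier_def by blast
  have hf: "torus_fun f" using torus_fun_Re_trig[OF fd] by (simp add: fs)
  define c where "c = (\<lambda>\<nu>. if \<nu> = 0 then 0 else fhat \<nu>)"
  have cd: "exp_decay c"
    by (rule exp_decay_mult_poly[OF fd, of 0 1]) (auto simp: c_def, use norm1_ge_1 in fastforce)
  have cs: "Re (trig_series c \<psi>) = f \<psi> - m" for \<psi>
  proof -
    have "((\<lambda>\<nu>. if \<nu> = 0 then fhat 0 else 0) has_sum fhat 0) UNIV"
      by (rule has_sum_finite_neutralI[of "{0}"]) auto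
    from has_sum_add[OF trig_has_sum[OF fd, of \<psi>] has_sum_uminusI[OF this]]
    have "((\<lambda>\<nu>. exp (\<i> * of_real (idot \<psi> \<nu>)) * c \<nu>) has_sum (trig_series fhat \<psi> - fhat 0)) UNIV"
      by (simp add: c_def idot_def if_distrib cong: has_sum_cong)
         (auto simp: idot_def elim!: has_sum_cong[THEN iffD1, rotated])
    hence "trig_series c \<psi> = trig_series fhat \<psi> - fhat 0"
      using trig_has_sum[OF cd] has_sum_unique by blast
    thus ?thesis by (simp add: fs flip: assms(5))
  qed
  define d where "d = (\<lambda>\<nu>. c \<nu> / (\<i> * of_real (idot \<omega> \<nu>)))"
  define e where "e = (\<lambda>\<nu>. d \<nu> / (\<i> * of_real (idot \<omega> \<nu>)))"
  have dd: "exp_decay d" unfolding d_def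
    by (rule exp_decay_divide_small_divisor[OF cd _ assms(4,2,3)]) (simp add: c_def)
  have d0: "d 0 = 0" by (simp add: d_def c_def)
  have ed: "exp_decay e" unfolding e_def
    by (rule exp_decay_divide_small_divisor[OF dd d0 assms(4,2,3)])
  show thesis
  proof (rule that[of "\<lambda>\<psi>. Re (trig_series d \<psi>)" "\<lambda>\<psi>. Re (trig_series e \<psi>)"])
    show "torus_fun f" by fact
    show "torus_fun (\<lambda>\<psi>. Re (trig_series d \<psi>))" "torus_fun (\<lambda>\<psi>. Re (trig_series e \<psi>))"
      using torus_fun_Re_trig dd ed by blast+
    fix \<psi> t
    show "((\<lambda>t. Re (trig_series d (\<psi> + t *\<^sub>R \<omega>))) has_real_derivative f (\<psi> + t *\<^sub>R \<omega>) - m) (at t)"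
      using Re_trig_primitive[OF cd _ assms(4,2,3), of \<psi> t] by (simp add: c_def d_def[symmetric] cs[unfolded c_def])
        (simp add: d_def c_def)
    show "((\<lambda>t. Re (trig_series e (\<psi> + t *\<^sub>R \<omega>))) has_real_derivative Re (trig_series d (\<psi> + t *\<^sub>R \<omega>))) (at t)"
      using Re_trig_primitive[OF dd d0 assms(4,2,3), of \<psi> t] by (simp add: e_def[symmetric])
  qed
qed

section \<open>The resolvent of the derivative along the flow\<close>

text \<open>Cauchy's estimate turns a dominating function for the integrand into a Lipschitz bound in the
  parameter. This bound dominates the difference quotients, so that dominated convergence yields the
  complex derivative of the integral.\<close>

lemma holomorphic_parametric_integral:
  fixes f :: "complex \<Rightarrow> real \<Rightarrow> complex"
  assumes D: "open D"
    and int: "\<And>z. z \<in> D \<Longrightarrow> f z integrable_on S"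
    and hol: "\<And>u. u \<in> S \<Longrightarrow> (\<lambda>z. f z u) holomorphic_on D"
    and dom: "\<And>z. z \<in> D \<Longrightarrow> \<exists>r>0. ball z r \<subseteq> D \<and> (\<exists>h. h integrable_on S \<and> (\<forall>y\<in>ball z r. \<forall>u\<in>S. norm (f y u) \<le> h u))"
  shows "(\<lambda>z. integral S (f z)) holomorphic_on D"
proof -
  have "(\<lambda>z. integral S (f z)) field_differentiable (at z)" if zD: "z \<in> D" for z
  proof -
    obtain r h where r: "r > 0" "ball z r \<subseteq> D" and h: "h integrable_on S"
      and fh: "\<And>y u. y \<in> ball z r \<Longrightarrow> u \<in> S \<Longrightarrow> norm (f y u) \<le> h u"
      using dom[OF zD] by metis
    define f' where "f' u = deriv (\<lambda>z. f z u) z" for u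
    have der: "((\<lambda>z. f z u) has_field_derivative deriv (\<lambda>z. f z u) y) (at y)" if "y \<in> D" "u \<in> S" for y u
      using hol[OF that(2)] D that(1) by (simp add: holomorphic_derivI)
    have lip: "norm (f y u - f z u) \<le> (4 / r * h u) * norm (y - z)" if y: "y \<in> ball z (r / 2)" and u: "u \<in> S" for y u
    proof (rule field_differentiable_bound[of "ball z (r / 2)" "\<lambda>z. f z u" "deriv (\<lambda>z. f z u)"])
      fix w assume w: "w \<in> ball z (r / 2)"
      have sub: "cball w (r / 4) \<subseteq> ball z r"
      proof
        fix x assume "x \<in> cball w (r / 4)"
        thus "x \<in> ball z r" using w r dist_triangle[of z x w] by auto
      qed
      have "w \<in> cball w (r / 4)" using r by simp
      hence "w \<in> D" using sub r by blast
      thus "((\<lambda>z. f z u) has_field_derivative deriv (\<lambda>z. f z u) w) (at w within ball z (r / 2))"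
        using der u has_field_derivative_at_within by blast
      have hsub: "(\<lambda>z. f z u) holomorphic_on cball w (r / 4)"
        using hol[OF u] sub r holomorphic_on_subset by blast
      have "norm ((deriv ^^ 1) (\<lambda>z. f z u) w) \<le> fact 1 * h u / (r / 4) ^ 1"
      proof (rule Cauchy_inequality)
        show "(\<lambda>z. f z u) holomorphic_on ball w (r / 4)"
          using hsub ball_subset_cball holomorphic_on_subset by blast
        show "continuous_on (cball w (r / 4)) (\<lambda>z. f z u)"
          using hsub by (rule holomorphic_on_imp_continuous_on)
        fix x assume "norm (w - x) = r / 4"
        hence "x \<in> cball w (r / 4)" by (simp add: dist_norm)
        thus "norm (f x u) \<le> h u" using sub fh u by blast
      qed (use r in auto)
      thus "norm (deriv (\<lambda>z. f z u) w) \<le> 4 / r * h u" by (simp add: mult.commute)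
    qed (use y r in auto)
    have "((\<lambda>y. (integral S (f y) - integral S (f z)) / (y - z)) \<longlongrightarrow> integral S f') (at z within ball z (r / 2))"
      unfolding tendsto_at_iff_sequentially
    proof (intro allI impI)
      fix X assume X: "\<forall>i. X i \<in> ball z (r / 2) - {z}" and lim: "X \<longlonglongrightarrow> z"
      define q where "q n u = (f (X n) u - f z u) / (X n - z)" for n u
      have XD: "X n \<in> D" for n using X r by (metis Diff_iff ball_divide_subset_numeral subsetD)
      have iq: "q n integrable_on S" for n
        unfolding q_def divide_inverse
        by (intro integrable_on_mult_left integrable_diff int XD zD)
      have "(\<lambda>n. integral S (q n)) \<longlonglongrightarrow> integral S f'"
      proof (rule dominated_convergence(2)[where h = "\<lambda>u. 4 / r * h u"])
        show "q n integrable_on S" for n by (rule iq)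
        show "(\<lambda>u. 4 / r * h u) integrable_on S" using h by (rule integrable_on_mult_right)
        show "norm (q n u) \<le> 4 / r * h u" if "u \<in> S" for n u
        proof -
          have "X n \<noteq> z" "X n \<in> ball z (r / 2)" using X by auto
          thus ?thesis using lip[OF _ that, of "X n"]
            by (simp add: q_def norm_divide pos_divide_le_eq)
        qed
        show "(\<lambda>n. q n u) \<longlonglongrightarrow> f' u" if "u \<in> S" for u
        proof -
          have "((\<lambda>y. (f y u - f z u) / (y - z)) \<longlongrightarrow> f' u) (at z)"
            using der[OF zD that] unfolding f'_def has_field_derivative_iff .
          hence "((\<lambda>y. (f y u - f z u) / (y - z)) \<circ> X) \<longlonglongrightarrow> f' u"
            unfolding tendsto_at_iff_sequentially using X lim by auto
          thus ?thesis by (simp add: q_def o_def)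
        qed
      qed
      moreover have "integral S (q n) = (integral S (f (X n)) - integral S (f z)) / (X n - z)" for n
        unfolding q_def divide_inverse
        by (subst integral_mult_left) (simp add: integral_diff[OF int[OF XD] int[OF zD]])
      ultimately show "((\<lambda>y. (integral S (f y) - integral S (f z)) / (y - z)) \<circ> X) \<longlonglongrightarrow> integral S f'"
        by (simp add: o_def)
    qed
    hence "((\<lambda>y. (integral S (f y) - integral S (f z)) / (y - z)) \<longlongrightarrow> integral S f') (at z)"
      using r by (subst (asm) at_within_open) auto
    thus ?thesis unfolding field_differentiable_def has_field_derivative_iff by blast
  qed
  thus ?thesis using D by (simp add: holomorphic_on_open field_differentiable_def)
qed

text \<open>For \<open>Re \<mu> > 0\<close> this is the bounded inverse of \<open>\<partial> + \<mu>\<close>, where \<open>\<partial>\<close> is the derivative along \<open>w\<close>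
  (see \<open>resolvent_derivative\<close>).\<close>

definition resolvent :: "complex \<Rightarrow> 'a::real_normed_vector \<Rightarrow> ('a \<Rightarrow> complex) \<Rightarrow> 'a \<Rightarrow> complex" where
  "resolvent \<mu> w X \<psi> = integral {0..} (\<lambda>u. exp (- \<mu> * of_real u) * X (\<psi> - u *\<^sub>R w))"

lemma exp_weight_integrable:
  fixes \<phi> :: "real \<Rightarrow> complex"
  assumes "continuous_on {0..} \<phi>" "\<And>u. u \<ge> 0 \<Longrightarrow> norm (\<phi> u) \<le> M" "Re \<mu> > 0"
  shows "(\<lambda>u. exp (- \<mu> * of_real u) * \<phi> u) absolutely_integrable_on {0..}"
    and "norm (integral {0..} (\<lambda>u. exp (- \<mu> * of_real u) * \<phi> u)) \<le> M / Re \<mu>"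
proof -
  have hi: "((\<lambda>u. M * exp (- Re \<mu> * u)) has_integral (M / Re \<mu>)) {0..}"
    using has_integral_mult_right[OF has_integral_exp_minus_to_infinity[OF assms(3), of 0], of M] by simp
  have le: "norm (exp (- \<mu> * of_real u) * \<phi> u) \<le> M * exp (- Re \<mu> * u)" if "u \<in> {0..}" for u
    using assms(2)[of u] that by (simp add: norm_mult mult.commute mult_right_mono)
  show ai: "(\<lambda>u. exp (- \<mu> * of_real u) * \<phi> u) absolutely_integrable_on {0..}"
  proof (rule measurable_bounded_by_integrable_imp_absolutely_integrable)
    show "(\<lambda>u. exp (- \<mu> * of_real u) * \<phi> u) \<in> borel_measurable (lebesgue_on {0..})"
      by (intro continuous_imp_measurable_on_sets_lebesgue continuous_intros assms) auto
    show "(\<lambda>u. M * exp (- Re \<mu> * u)) integrable_on {0..}" using hi by blast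
  qed (use le in auto)
  have "norm (integral {0..} (\<lambda>u. exp (- \<mu> * of_real u) * \<phi> u)) \<le> integral {0..} (\<lambda>u. M * exp (- Re \<mu> * u))"
    using ai hi le by (intro Henstock_Kurzweil_Integration.integral_norm_bound_integral)
      (auto simp: set_lebesgue_integral_eq_integral)
  thus "norm (integral {0..} (\<lambda>u. exp (- \<mu> * of_real u) * \<phi> u)) \<le> M / Re \<mu>"
    unfolding integral_unique[OF hi] .
qed

text \<open>The substitution \<open>s = t - u\<close> turns the integral into \<open>exp (- \<mu> t)\<close> times the integral of
  \<open>exp (\<mu> s) \<phi> s\<close> over \<open>s \<le> t\<close>, to which the product rule and the fundamental theorem of calculus apply.\<close>

lemma exp_weight_derivative:
  fixes \<phi> :: "real \<Rightarrow> complex"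
  assumes cont: "continuous_on UNIV \<phi>" and bd: "\<And>u. norm (\<phi> u) \<le> M" and mu: "Re \<mu> > 0"
  defines "Y \<equiv> (\<lambda>t. integral {0..} (\<lambda>u. exp (- \<mu> * of_real u) * \<phi> (t - u)))"
  shows "(Y has_vector_derivative \<phi> t - \<mu> * Y t) (at t)"
proof -
  let ?g = "\<lambda>s. exp (\<mu> * of_real s) * \<phi> s"
  have ai: "(\<lambda>u. exp (- \<mu> * of_real u) * \<phi> (t - u)) absolutely_integrable_on {0..}" for t
    by (rule exp_weight_integrable(1)[OF _ _ mu, of _ M])
       (auto intro!: continuous_on_compose2[OF cont] continuous_intros bd)
  have sub: "?g absolutely_integrable_on {..t} \<and> Y t = exp (- \<mu> * of_real t) * integral {..t} ?g" for t
  proof -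
    let ?F = "\<lambda>u. indicat_real {0..} u *\<^sub>R (exp (- \<mu> * of_real u) * \<phi> (t - u))"
    let ?G = "\<lambda>s. indicat_real {..t} s *\<^sub>R ?g s"
    have eq: "?F (t + (-1) * s) = exp (- \<mu> * of_real t) * ?G s" for s
      by (auto simp: indicator_def algebra_simps exp_diff exp_minus field_simps exp_add)
    have F: "integrable lebesgue ?F" using ai[of t] by (simp add: set_integrable_def)
    hence "integrable lebesgue (\<lambda>s. ?F (t + (-1) * s))"
      by (subst lebesgue_integrable_real_affine_iff) auto
    hence "integrable lebesgue (\<lambda>s. exp (- \<mu> * of_real t) * ?G s)" unfolding eq .
    hence G: "integrable lebesgue ?G"
    proof -
      have "integrable lebesgue (\<lambda>s. exp (\<mu> * of_real t) * (exp (- \<mu> * of_real t) * ?G s))"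
        by (rule integrable_mult_right) (rule \<open>integrable lebesgue (\<lambda>s. exp (- \<mu> * of_real t) * ?G s)\<close>)
      thus ?thesis by (simp add: mult.assoc[symmetric] exp_add[symmetric])
    qed
    hence g: "?g absolutely_integrable_on {..t}" by (simp add: set_integrable_def)
    have "Y t = (\<integral>u. ?F u \<partial>lebesgue)"
      unfolding Y_def set_lebesgue_integral_eq_integral(2)[OF ai, symmetric] set_lebesgue_integral_def ..
    also have "\<dots> = (\<integral>s. ?F (t + (-1) * s) \<partial>lebesgue)"
      by (subst lebesgue_integral_real_affine[where c = "-1" and t = t]) auto
    also have "\<dots> = exp (- \<mu> * of_real t) * (\<integral>s. ?G s \<partial>lebesgue)"
      unfolding eq by (rule integral_mult_right_zero)
    also have "(\<integral>s. ?G s \<partial>lebesgue) = integral {..t} ?g"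
      unfolding set_lebesgue_integral_eq_integral(2)[OF g, symmetric] set_lebesgue_integral_def ..
    finally show ?thesis using g by blast
  qed
  \<comment> \<open>splitting off a fixed half-line leaves an integral over a compact interval around \<open>t\<close>\<close>
  define b where "b = t - 1"
  have gcont: "continuous_on {b..t + 1} ?g"
    by (intro continuous_intros continuous_on_subset[OF cont]) auto
  have split: "integral {..s} ?g = integral {..b} ?g + integral {b..s} ?g" if "s \<in> {b..t + 1}" for s
  proof -
    have "(?g has_integral (integral {..b} ?g + integral {b..s} ?g)) ({..b} \<union> {b..s})"
    proof (rule has_integral_Un)
      show "(?g has_integral integral {..b} ?g) {..b}"
        using sub[of b] set_lebesgue_integral_eq_integral(1) integrable_integral by blast
      show "(?g has_integral integral {b..s} ?g) {b..s}"
        by (intro integrable_integral integrable_continuous_real continuous_on_subset[OF gcont])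
           (use that in auto)
      have "{..b} \<inter> {b..s} = {b}" using that by auto
      thus "negligible ({..b} \<inter> {b..s})" by simp
    qed
    moreover have "{..b} \<union> {b..s} = {..s}" using that by auto
    ultimately show ?thesis by (simp add: integral_unique)
  qed
  have t: "t \<in> {b..t + 1}" by (simp add: b_def)
  have "((\<lambda>s. integral {b..s} ?g) has_vector_derivative ?g t) (at t within {b..t + 1})"
    using gcont t by (rule integral_has_vector_derivative)
  hence I: "((\<lambda>s. integral {b..s} ?g) has_vector_derivative ?g t) (at t)"
    by (subst (asm) at_within_interior) (auto simp: b_def)
  have e: "((\<lambda>s. exp (- \<mu> * of_real s)) has_vector_derivative (- \<mu> * exp (- \<mu> * of_real t))) (at t)"
    by (rule has_vector_derivative_real_field) (auto intro!: derivative_eq_intros)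
  have "((\<lambda>s. exp (- \<mu> * of_real s) * (integral {..b} ?g + integral {b..s} ?g)) has_vector_derivative
      (exp (- \<mu> * of_real t) * ?g t + (- \<mu> * exp (- \<mu> * of_real t)) * (integral {..b} ?g + integral {b..t} ?g))) (at t)"
    by (rule derivative_eq_intros refl e I | simp)+
  hence "(Y has_vector_derivative
      (exp (- \<mu> * of_real t) * ?g t + (- \<mu> * exp (- \<mu> * of_real t)) * (integral {..b} ?g + integral {b..t} ?g))) (at t)"
  proof (rule has_vector_derivative_transform_within_open[of _ _ _ "{b<..<t + 1}"])
    fix s assume "s \<in> {b<..<t + 1}"
    hence "s \<in> {b..t+1}" by auto
    thus "exp (- \<mu> * of_real s) * (integral {..b} ?g + integral {b..s} ?g) = Y s"
      using sub[of s] split[of s] by simp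
  qed (auto simp: b_def)
  also have "exp (- \<mu> * of_real t) * ?g t = \<phi> t"
    by (simp add: mult.assoc[symmetric] exp_add[symmetric])
  also have "(- \<mu> * exp (- \<mu> * of_real t)) * (integral {..b} ?g + integral {b..t} ?g) = - \<mu> * Y t"
    using sub[of t] split[OF t] by simp
  finally show ?thesis by simp
qed

text \<open>The families of complex hull functions in which the equation is solved. Continuity in the angles
  and holomorphy in the parameter are asked for separately; both survive uniform limits, and the
  reality condition makes the solution real for real parameters.\<close>

definition param_hull :: "complex set \<Rightarrow> (complex \<Rightarrow> real ^ 'd \<Rightarrow> complex) \<Rightarrow> bool" where
  "param_hull D U \<longleftrightarrow>
     (\<forall>\<epsilon>\<in>D. continuous_on UNIV (U \<epsilon>) \<and> (\<forall>\<psi> i. U \<epsilon> (\<psi> + axis i (2 * pi)) = U \<epsilon> \<psi>)) \<and>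
     (\<forall>\<psi>. (\<lambda>\<epsilon>. U \<epsilon> \<psi>) holomorphic_on D) \<and>
     (\<forall>\<epsilon>\<in>D \<inter> \<real>. \<forall>\<psi>. U \<epsilon> \<psi> \<in> \<real>)"

lemma continuous_along_line:
  fixes X :: "'a::real_normed_vector \<Rightarrow> complex"
  assumes "continuous_on UNIV X" shows "continuous_on S (\<lambda>u. X (\<psi> - u *\<^sub>R w))"
  by (intro continuous_on_compose2[OF assms] continuous_intros) auto

lemma resolvent_bound:
  assumes "continuous_on UNIV X" "\<And>\<psi>. norm (X \<psi>) \<le> M" "Re \<mu> > 0"
  shows "norm (resolvent \<mu> w X \<psi>) \<le> M / Re \<mu>"
  unfolding resolvent_def
  by (rule exp_weight_integrable(2)[OF continuous_along_line[OF assms(1)] _ assms(3)]) (rule assms(2))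

lemma resolvent_integrable:
  fixes X :: "'a::real_normed_vector \<Rightarrow> complex"
  assumes "continuous_on UNIV X" "\<And>\<psi>. norm (X \<psi>) \<le> M" "Re \<mu> > 0"
  shows "(\<lambda>u. exp (- \<mu> * of_real u) * X (\<psi> - u *\<^sub>R w)) integrable_on {0..}"
  by (rule set_lebesgue_integral_eq_integral(1),
      rule exp_weight_integrable(1)[OF continuous_along_line[OF assms(1)] _ assms(3)], rule assms(2))

lemma resolvent_diff:
  assumes "continuous_on UNIV X" "\<And>\<psi>. norm (X \<psi>) \<le> M" "continuous_on UNIV X'" "\<And>\<psi>. norm (X' \<psi>) \<le> M'" "Re \<mu> > 0"
  shows "resolvent \<mu> w X \<psi> - resolvent \<mu> w X' \<psi> = resolvent \<mu> w (\<lambda>\<psi>. X \<psi> - X' \<psi>) \<psi>"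
  unfolding resolvent_def
  by (subst integral_diff[symmetric, OF resolvent_integrable[OF assms(1,2,5)] resolvent_integrable[OF assms(3,4,5)]])
     (simp add: right_diff_distrib)

lemma resolvent_derivative:
  assumes "continuous_on UNIV X" "\<And>\<psi>. norm (X \<psi>) \<le> M" "Re \<mu> > 0"
  shows "((\<lambda>t. resolvent \<mu> w X (\<psi> + t *\<^sub>R w)) has_vector_derivative
      X (\<psi> + t *\<^sub>R w) - \<mu> * resolvent \<mu> w X (\<psi> + t *\<^sub>R w)) (at t)"
proof -
  have c: "continuous_on UNIV (\<lambda>t. X (\<psi> + t *\<^sub>R w))"
    using continuous_along_line[OF assms(1), of UNIV \<psi> "- w"] by simp
  show ?thesis
    using exp_weight_derivative[OF c _ assms(3), of M t] assms(2)
    by (simp add: resolvent_def algebra_simps)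
qed

lemma resolvent_continuous:
  fixes X :: "'a::real_normed_vector \<Rightarrow> complex"
  assumes "continuous_on UNIV X" "\<And>\<psi>. norm (X \<psi>) \<le> M" "Re \<mu> > 0"
  shows "continuous_on UNIV (resolvent \<mu> w X)"
  unfolding continuous_on_sequentially
proof (intro ballI allI impI, elim conjE)
  fix \<psi> and p :: "nat \<Rightarrow> 'a" assume p: "p \<longlonglongrightarrow> \<psi>"
  have "(\<lambda>n. resolvent \<mu> w X (p n)) \<longlonglongrightarrow> resolvent \<mu> w X \<psi>"
    unfolding resolvent_def
  proof (rule dominated_convergence(2)[where h = "\<lambda>u. M * exp (- Re \<mu> * u)"])
    show "(\<lambda>u. M * exp (- Re \<mu> * u)) integrable_on {0..}"
      by (intro integrable_on_mult_right integrable_on_exp_minus_to_infinity assms)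
    show "norm (exp (- \<mu> * of_real u) * X (p n - u *\<^sub>R w)) \<le> M * exp (- Re \<mu> * u)" for n u
      using assms(2) by (simp add: norm_mult mult.commute mult_right_mono)
    show "(\<lambda>n. exp (- \<mu> * of_real u) * X (p n - u *\<^sub>R w)) \<longlonglongrightarrow> exp (- \<mu> * of_real u) * X (\<psi> - u *\<^sub>R w)" for u
      by (intro tendsto_intros continuous_on_tendsto_compose[OF assms(1)] p) auto
  qed (rule resolvent_integrable[OF assms])
  thus "(resolvent \<mu> w X \<circ> p) \<longlonglongrightarrow> resolvent \<mu> w X \<psi>" by (simp add: o_def)
qed

lemma param_hull_resolvent:
  assumes D: "open D" and mu: "\<mu> holomorphic_on D" "\<And>\<epsilon>. \<epsilon> \<in> D \<Longrightarrow> Re (\<mu> \<epsilon>) > 0"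
    "\<And>\<epsilon>. \<epsilon> \<in> D \<inter> \<real> \<Longrightarrow> \<mu> \<epsilon> \<in> \<real>"
    and U: "param_hull D U" "\<And>\<epsilon> \<psi>. \<epsilon> \<in> D \<Longrightarrow> norm (U \<epsilon> \<psi>) \<le> M"
  shows "param_hull D (\<lambda>\<epsilon>. resolvent (\<mu> \<epsilon>) w (U \<epsilon>))"
  unfolding param_hull_def
proof (intro conjI ballI allI)
  fix \<epsilon> assume e: "\<epsilon> \<in> D"
  hence Uc: "continuous_on UNIV (U \<epsilon>)" using U(1) unfolding param_hull_def by blast
  show "continuous_on UNIV (resolvent (\<mu> \<epsilon>) w (U \<epsilon>))"
    by (rule resolvent_continuous[OF Uc U(2) mu(2)]) (use e in auto)
  fix \<psi> i
  have "U \<epsilon> (\<psi> + axis i (2 * pi) - u *\<^sub>R w) = U \<epsilon> (\<psi> - u *\<^sub>R w)" for u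
    using U(1) e unfolding param_hull_def by (metis add_diff_eq diff_add_eq)
  thus "resolvent (\<mu> \<epsilon>) w (U \<epsilon>) (\<psi> + axis i (2 * pi)) = resolvent (\<mu> \<epsilon>) w (U \<epsilon>) \<psi>"
    by (simp add: resolvent_def)
next
  fix \<psi>
  show "(\<lambda>\<epsilon>. resolvent (\<mu> \<epsilon>) w (U \<epsilon>) \<psi>) holomorphic_on D"
    unfolding resolvent_def
  proof (rule holomorphic_parametric_integral[OF D])
    fix z assume z: "z \<in> D"
    show "(\<lambda>u. exp (- \<mu> z * of_real u) * U z (\<psi> - u *\<^sub>R w)) integrable_on {0..}"
      by (rule resolvent_integrable[where M = M]) (use U z mu in \<open>auto simp: param_hull_def\<close>)
    define c where "c = Re (\<mu> z) / 2"
    have c: "c > 0" "c < Re (\<mu> z)" using mu(2)[OF z] by (auto simp: c_def)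
    have "isCont \<mu> z" using mu(1) D z holomorphic_on_imp_continuous_on continuous_on_eq_continuous_at by blast
    hence "((\<lambda>y. Re (\<mu> y)) \<longlongrightarrow> Re (\<mu> z)) (at z)" by (auto intro!: tendsto_Re simp: isCont_def)
    hence "\<forall>\<^sub>F y in at z. Re (\<mu> y) > c" using c(2) by (rule order_tendstoD(1))
    then obtain r1 where r1: "r1 > 0" "\<And>y. dist y z < r1 \<Longrightarrow> Re (\<mu> y) > c"
      unfolding eventually_at using c(2) by (metis UNIV_I)
    obtain r2 where r2: "r2 > 0" "ball z r2 \<subseteq> D" using D z openE by blast
    have "ball z (min r1 r2) \<subseteq> D" using r2 by auto
    moreover have "norm (exp (- \<mu> y * of_real u) * U y (\<psi> - u *\<^sub>R w)) \<le> M * exp (- c * u)"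
      if y: "y \<in> ball z (min r1 r2)" and u: "u \<in> {0..}" for y u
    proof -
      have "Re (\<mu> y) > c" "y \<in> D" using y r1 r2 by (auto simp: dist_commute subset_iff)
      have "norm (exp (- \<mu> y * of_real u)) \<le> exp (- c * u)"
        using \<open>Re (\<mu> y) > c\<close> u by (simp add: mult_right_mono)
      moreover have "norm (U y (\<psi> - u *\<^sub>R w)) \<le> M" by (rule U(2)[OF \<open>y \<in> D\<close>])
      ultimately show ?thesis
        by (subst mult.commute, unfold norm_mult) (intro mult_mono, auto intro: order_trans[OF norm_ge_zero])
    qed
    moreover have "(\<lambda>u. M * exp (- c * u)) integrable_on {0..}"
      by (intro integrable_on_mult_right integrable_on_exp_minus_to_infinity c)
    ultimately show "\<exists>r>0. ball z r \<subseteq> D \<and> (\<exists>h. h integrable_on {0..} \<and>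
        (\<forall>y\<in>ball z r. \<forall>u\<in>{0..}. norm (exp (- \<mu> y * of_real u) * U y (\<psi> - u *\<^sub>R w)) \<le> h u))"
      using r1(1) r2(1) by (intro exI[of _ "min r1 r2"] conjI exI[of _ "\<lambda>u. M * exp (- c * u)"] ballI) auto
  next
    fix u :: real
    show "(\<lambda>z. exp (- \<mu> z * of_real u) * U z (\<psi> - u *\<^sub>R w)) holomorphic_on D"
      using U(1) unfolding param_hull_def by (intro holomorphic_intros mu(1)) blast
  qed
next
  fix \<epsilon> \<psi> assume e: "\<epsilon> \<in> D \<inter> \<real>"
  let ?f = "\<lambda>u. exp (- \<mu> \<epsilon> * of_real u) * U \<epsilon> (\<psi> - u *\<^sub>R w)"
  have "?f u \<in> \<real>" for u
  proof -
    have "exp (- \<mu> \<epsilon> * of_real u) \<in> \<real>" using mu(3)[OF e] by (intro exp_in_Reals) auto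
    thus ?thesis using U(1) e unfolding param_hull_def by (intro Reals_mult) auto
  qed
  hence 0: "(\<lambda>u. Im (?f u)) = (\<lambda>u. 0)" by (auto simp: complex_is_Real_iff)
  have "?f integrable_on {0..}"
    by (rule resolvent_integrable[where M = M]) (use U e mu in \<open>auto simp: param_hull_def\<close>)
  from integral_linear[OF this bounded_linear_Im]
  have "Im (integral {0..} ?f) = 0" unfolding o_def 0 by simp
  thus "resolvent (\<mu> \<epsilon>) w (U \<epsilon>) \<psi> \<in> \<real>" by (simp add: resolvent_def complex_is_Real_iff)
qed

section \<open>Inverting the damped linear operator on the tangent disk\<close>

text \<open>The contraction principle for the supremum distance on \<open>A\<close>, in a class \<open>S\<close> of functions that is closed
  under uniform convergence. It yields the corrector below and also solves initial value problems on a
  half-line.\<close>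

lemma uniform_contraction_fixpoint:
  fixes T :: "('a \<Rightarrow> 'b::banach) \<Rightarrow> 'a \<Rightarrow> 'b"
  assumes w0: "w0 \<in> S" and maps: "\<And>w. w \<in> S \<Longrightarrow> T w \<in> S"
    and contr: "\<And>v w C x. v \<in> S \<Longrightarrow> w \<in> S \<Longrightarrow> C \<ge> 0 \<Longrightarrow> (\<And>y. y \<in> A \<Longrightarrow> norm (v y - w y) \<le> C)
        \<Longrightarrow> x \<in> A \<Longrightarrow> norm (T v x - T w x) \<le> C / 2"
    and first: "\<And>x. x \<in> A \<Longrightarrow> norm (T w0 x - w0 x) \<le> K"
    and closed: "\<And>u l. (\<And>n. u n \<in> S) \<Longrightarrow> uniform_limit A u l sequentially \<Longrightarrow> l \<in> S"
  shows "\<exists>w\<in>S. \<forall>x\<in>A. T w x = w x"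
proof -
  define u where "u n = (T ^^ n) w0" for n
  have u0: "u 0 = w0" and uS: "u (Suc n) = T (u n)" for n by (simp_all add: u_def)
  have inS: "u n \<in> S" for n by (induction n) (auto simp: u0 uS w0 maps)
  define K' where "K' = max K 0"
  have step: "norm (u (Suc n) x - u n x) \<le> K' * (1 / 2) ^ n" if "x \<in> A" for n x
    using that
  proof (induction n arbitrary: x)
    case 0
    thus ?case using first[of x] by (simp add: u0 uS K'_def)
  next
    case (Suc n)
    have "norm (T (u (Suc n)) x - T (u n) x) \<le> (K' * (1 / 2) ^ n) / 2"
      by (rule contr[OF inS inS _ Suc.IH Suc.prems]) (simp_all add: K'_def)
    thus ?case by (simp add: uS)
  qed
  define l where "l x = w0 x + (\<Sum>n. u (Suc n) x - u n x)" for x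
  have "uniform_limit A (\<lambda>n x. \<Sum>i<n. u (Suc i) x - u i x) (\<lambda>x. \<Sum>n. u (Suc n) x - u n x) sequentially"
    by (rule Weierstrass_m_test[of A _ "\<lambda>n. K' * (1 / 2) ^ n"])
       (use step in blast, intro summable_mult summable_geometric, simp)
  hence "uniform_limit A (\<lambda>n x. w0 x + (\<Sum>i<n. u (Suc i) x - u i x)) l sequentially"
    unfolding l_def by (intro uniform_limit_add uniform_limit_const)
  hence lim: "uniform_limit A u l sequentially"
  proof -
    have "w0 x + (\<Sum>i<n. u (Suc i) x - u i x) = u n x" for n x
      using sum_lessThan_telescope[of "\<lambda>i. u i x" n] by (simp add: u0)
    thus ?thesis using \<open>uniform_limit A (\<lambda>n x. w0 x + (\<Sum>i<n. u (Suc i) x - u i x)) l sequentially\<close> by simp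
  qed
  have lS: "l \<in> S" by (rule closed[OF inS lim])
  have "norm (T l x - l x) \<le> e" if x: "x \<in> A" and e: "e > 0" for x e
  proof -
    have "\<forall>\<^sub>F n in sequentially. \<forall>x\<in>A. dist (u n x) (l x) < e / 2"
      using lim e unfolding uniform_limit_iff by (meson half_gt_zero)
    then obtain N where N: "\<And>n y. n \<ge> N \<Longrightarrow> y \<in> A \<Longrightarrow> norm (u n y - l y) < e / 2"
      unfolding eventually_sequentially dist_norm by metis
    have "norm (T (u N) x - T l x) \<le> (e / 2) / 2"
      proof (rule contr[OF inS lS _ _ x])
      show "e / 2 \<ge> 0" using e by simp
      show "norm (u N y - l y) \<le> e / 2" if "y \<in> A" for y
        using N[OF order_refl that] by (rule less_imp_le)
    qed
    moreover have "norm (T (u N) x - l x) < e / 2" using N[of "Suc N" x] x by (simp add: uS)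
    ultimately show ?thesis using e norm_triangle_ineq4[of "T (u N) x - l x" "T (u N) x - T l x"] by simp
  qed
  hence "norm (T l x - l x) \<le> 0" if "x \<in> A" for x
    by (metis that field_le_epsilon add_0)
  hence "\<forall>x\<in>A. T l x = l x" by simp
  with lS show ?thesis by blast
qed

text \<open>With \<open>R1\<close> the bounded inverse of \<open>\<partial> + a \<epsilon>\<close> and \<open>R2\<close> that of \<open>\<partial> + 1/\<epsilon>\<close>, this is
  \<open>(\<epsilon>\<^sup>2 R1 X + R2 Y) / (1 - a \<epsilon>\<^sup>2)\<close>, the partial fraction form of the inverse of their product:
  \<open>X = Z / \<epsilon>\<close> and \<open>Y = - \<epsilon> Z\<close> solve the equation with right-hand side \<open>Z\<close>. For \<open>a < 0\<close> the bounded
  solution for the slow factor is determined by the future, so \<open>R1\<close> integrates against the flow; the two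
  signs \<open>sgn a\<close> express this.\<close>

definition damped_inverse ::
  "real \<Rightarrow> 'a::real_normed_vector \<Rightarrow> complex \<Rightarrow> ('a \<Rightarrow> complex) \<Rightarrow> ('a \<Rightarrow> complex) \<Rightarrow> 'a \<Rightarrow> complex" where
  "damped_inverse a w \<epsilon> X Y \<psi> =
     (\<epsilon>\<^sup>2 * (of_real (sgn a) * resolvent (of_real \<bar>a\<bar> * \<epsilon>) (sgn a *\<^sub>R w) X \<psi>) + resolvent (1 / \<epsilon>) w Y \<psi>)
       / (1 - of_real a * \<epsilon>\<^sup>2)"

text \<open>In terms of \<open>\<gamma> = 1/\<epsilon>\<close> the disk is the half-plane \<open>Re \<gamma> > 1 / (2 R)\<close>. The slow resolvent has norm
  \<open>1 / (\<bar>a\<bar> Re \<epsilon>)\<close>, unbounded near the boundary of the disk even after multiplication by \<open>\<bar>\<epsilon>\<bar>\<close>; the third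
  inequality says that multiplication by \<open>\<epsilon>\<^sup>2\<close> is enough.\<close>

lemma tangent_disk:
  assumes "\<epsilon> \<in> ball (complex_of_real R) R"
  shows "norm \<epsilon> < 2 * R" "Re \<epsilon> > 0" "(norm \<epsilon>)\<^sup>2 < 2 * R * Re \<epsilon>" "Re (1 / \<epsilon>) > 1 / (2 * R)" "\<epsilon> \<noteq> 0" "R > 0"
proof -
  have d: "norm (\<epsilon> - of_real R) < R" using assms by (simp add: dist_norm norm_minus_commute)
  show R: "R > 0" using d norm_ge_zero[of "\<epsilon> - of_real R"] by linarith
  have "(norm (\<epsilon> - of_real R))\<^sup>2 < R\<^sup>2" using d by (intro power_strict_mono) auto
  hence "(Re \<epsilon> - R)\<^sup>2 + (Im \<epsilon>)\<^sup>2 < R\<^sup>2" by (simp add: cmod_power2)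
  thus s: "(norm \<epsilon>)\<^sup>2 < 2 * R * Re \<epsilon>" by (simp only: cmod_power2) (simp add: power2_eq_square algebra_simps)
  hence "0 < 2 * R * Re \<epsilon>" by (rule le_less_trans[OF zero_le_power2])
  thus re: "Re \<epsilon> > 0" using R by (simp add: zero_less_mult_iff)
  thus nz: "\<epsilon> \<noteq> 0" by auto
  have "(norm \<epsilon>)\<^sup>2 < 2 * R * norm \<epsilon>"
    using s R complex_Re_le_cmod[of \<epsilon>] by (smt (verit, best) mult_left_mono)
  thus "norm \<epsilon> < 2 * R" using nz by (simp add: power2_eq_square)
  have "Re (1 / \<epsilon>) = Re \<epsilon> / (norm \<epsilon>)\<^sup>2" by (simp add: Re_divide cmod_power2)
  also have "\<dots> > 1 / (2 * R)" using s R nz by (simp add: field_simps)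
  finally show "Re (1 / \<epsilon>) > 1 / (2 * R)" .
qed

lemma tangent_disk_denominator:
  assumes e: "\<epsilon> \<in> ball (complex_of_real R) R" and a: "8 * R\<^sup>2 * \<bar>a\<bar> \<le> 1"
  shows "norm (of_real a * \<epsilon>\<^sup>2) \<le> 1 / 2" and "1 - of_real a * \<epsilon>\<^sup>2 \<noteq> 0"
proof -
  have "\<bar>a\<bar> * (norm \<epsilon>)\<^sup>2 \<le> \<bar>a\<bar> * (2 * R)\<^sup>2"
    by (intro mult_left_mono power_mono less_imp_le[OF tangent_disk(1)[OF e]]) auto
  also have "\<dots> \<le> 1 / 2" using a by (simp add: power2_eq_square algebra_simps)
  finally show le: "norm (of_real a * \<epsilon>\<^sup>2) \<le> 1 / 2" by (simp add: norm_mult norm_power)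
  show "1 - of_real a * \<epsilon>\<^sup>2 \<noteq> 0"
  proof
    assume "1 - of_real a * \<epsilon>\<^sup>2 = 0"
    hence "norm (of_real a * \<epsilon>\<^sup>2) = 1" by (metis eq_iff_diff_eq_0 norm_one)
    with le show False by simp
  qed
qed

text \<open>The estimate on which everything rests: on the whole tangent disk, where \<open>\<epsilon>\<close> may approach \<open>0\<close> almost along the
  imaginary axis, the operator norm is of the order of the radius \<open>R\<close>.\<close>

lemma damped_inverse_bound:
  assumes X: "continuous_on UNIV X" "\<And>\<psi>. norm (X \<psi>) \<le> C" and Y: "continuous_on UNIV Y" "\<And>\<psi>. norm (Y \<psi>) \<le> C"
    and e: "\<epsilon> \<in> ball (complex_of_real R) R" and a: "a \<noteq> 0" "8 * R\<^sup>2 * \<bar>a\<bar> \<le> 1"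
  shows "norm (damped_inverse a w \<epsilon> X Y \<psi>) \<le> 4 * R * (1 / \<bar>a\<bar> + 1) * C"
proof -
  note d = tangent_disk[OF e]
  have re2: "Re (1 / \<epsilon>) > 0" using d(6) by (intro order_less_trans[OF _ d(4)]) simp
  have C: "C \<ge> 0" using X(2)[of \<psi>] norm_ge_zero order_trans by blast
  have den: "norm (1 - of_real a * \<epsilon>\<^sup>2) \<ge> 1 / 2"
    using tangent_disk_denominator(1)[OF e a(2)] norm_triangle_ineq2[of 1 "of_real a * \<epsilon>\<^sup>2"] by simp
  have "norm (resolvent (of_real \<bar>a\<bar> * \<epsilon>) (sgn a *\<^sub>R w) X \<psi>) \<le> C / Re (of_real \<bar>a\<bar> * \<epsilon>)"
    by (rule resolvent_bound[OF X]) (use a d(2) in auto)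
  also have "\<dots> = C / (\<bar>a\<bar> * Re \<epsilon>)" by simp
  finally have "norm (\<epsilon>\<^sup>2 * (of_real (sgn a) * resolvent (of_real \<bar>a\<bar> * \<epsilon>) (sgn a *\<^sub>R w) X \<psi>)) \<le> (norm \<epsilon>)\<^sup>2 * (C / (\<bar>a\<bar> * Re \<epsilon>))"
    using a by (simp only: norm_mult norm_power norm_of_real abs_sgn_eq if_False mult_1 mult_left_mono zero_le_power2)
  also have "\<dots> \<le> (2 * R * Re \<epsilon>) * (C / (\<bar>a\<bar> * Re \<epsilon>))"
    by (intro mult_right_mono less_imp_le[OF d(3)] divide_nonneg_nonneg mult_nonneg_nonneg C) (use d(2) in auto)
  also have "\<dots> = 2 * R * C / \<bar>a\<bar>" using d a by simp
  finally have 1: "norm (\<epsilon>\<^sup>2 * (of_real (sgn a) * resolvent (of_real \<bar>a\<bar> * \<epsilon>) (sgn a *\<^sub>R w) X \<psi>)) \<le> 2 * R * C / \<bar>a\<bar>" .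
  have "norm (resolvent (1 / \<epsilon>) w Y \<psi>) \<le> C / Re (1 / \<epsilon>)"
    by (rule resolvent_bound[OF Y re2])
  also have "\<dots> \<le> C / (1 / (2 * R))" 
    by (intro divide_left_mono mult_pos_pos C re2 less_imp_le[OF d(4)]) (use d(6) in simp)
  finally have 2: "norm (resolvent (1 / \<epsilon>) w Y \<psi>) \<le> 2 * R * C" by (simp add: mult_ac)
  let ?n = "\<epsilon>\<^sup>2 * (of_real (sgn a) * resolvent (of_real \<bar>a\<bar> * \<epsilon>) (sgn a *\<^sub>R w) X \<psi>) + resolvent (1 / \<epsilon>) w Y \<psi>"
  have "norm ?n \<le> 2 * R * C / \<bar>a\<bar> + 2 * R * C" using 1 2 norm_triangle_mono by blast
  hence "norm ?n / norm (1 - of_real a * \<epsilon>\<^sup>2) \<le> (2 * R * C / \<bar>a\<bar> + 2 * R * C) / (1 / 2)"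
    using \<open>norm ?n \<le> _\<close> by (intro frac_le den norm_ge_zero order_trans[OF norm_ge_zero]) auto
  hence "norm (damped_inverse a w \<epsilon> X Y \<psi>) \<le> (2 * R * C / \<bar>a\<bar> + 2 * R * C) / (1 / 2)"
    unfolding damped_inverse_def norm_divide .
  also have "\<dots> = 4 * R * (1 / \<bar>a\<bar> + 1) * C" by (simp add: distrib_left distrib_right)
  finally show ?thesis .
qed

lemma damped_inverse_diff:
  assumes X: "continuous_on UNIV X" "\<And>\<psi>. norm (X \<psi>) \<le> M1" and Y: "continuous_on UNIV Y" "\<And>\<psi>. norm (Y \<psi>) \<le> M2"
    and X': "continuous_on UNIV X'" "\<And>\<psi>. norm (X' \<psi>) \<le> M3" and Y': "continuous_on UNIV Y'" "\<And>\<psi>. norm (Y' \<psi>) \<le> M4"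
    and e: "\<epsilon> \<in> ball (complex_of_real R) R" and a: "a \<noteq> 0"
  shows "damped_inverse a w \<epsilon> X Y \<psi> - damped_inverse a w \<epsilon> X' Y' \<psi>
       = damped_inverse a w \<epsilon> (\<lambda>\<psi>. X \<psi> - X' \<psi>) (\<lambda>\<psi>. Y \<psi> - Y' \<psi>) \<psi>"
proof -
  note d = tangent_disk[OF e]
  have 1: "Re (of_real \<bar>a\<bar> * \<epsilon>) > 0" using d(2) a by simp
  have 2: "Re (1 / \<epsilon>) > 0" using d(6) by (intro order_less_trans[OF _ d(4)]) simp
  show ?thesis
    unfolding damped_inverse_def resolvent_diff[OF X X' 1, symmetric] resolvent_diff[OF Y Y' 2, symmetric]
      diff_divide_distrib[symmetric]
    by (simp only: right_diff_distrib add_diff_add)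
qed

lemma param_hull_indep: "torus_fun F \<Longrightarrow> param_hull D (\<lambda>\<epsilon> \<psi>. of_real (F \<psi>))"
  unfolding param_hull_def torus_fun_def by (auto intro!: continuous_intros)

lemma param_hull_param:
  "h holomorphic_on D \<Longrightarrow> (\<And>\<epsilon>. \<epsilon> \<in> D \<inter> \<real> \<Longrightarrow> h \<epsilon> \<in> \<real>) \<Longrightarrow> param_hull D (\<lambda>\<epsilon> \<psi>. h \<epsilon>)"
  unfolding param_hull_def by (auto intro!: continuous_intros)

lemma param_hull_add: "param_hull D U \<Longrightarrow> param_hull D V \<Longrightarrow> param_hull D (\<lambda>\<epsilon> \<psi>. U \<epsilon> \<psi> + V \<epsilon> \<psi>)"
  unfolding param_hull_def by (auto intro!: continuous_intros holomorphic_intros)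

lemma param_hull_diff: "param_hull D U \<Longrightarrow> param_hull D V \<Longrightarrow> param_hull D (\<lambda>\<epsilon> \<psi>. U \<epsilon> \<psi> - V \<epsilon> \<psi>)"
  unfolding param_hull_def by (auto intro!: continuous_intros holomorphic_intros)

lemma param_hull_mult: "param_hull D U \<Longrightarrow> param_hull D V \<Longrightarrow> param_hull D (\<lambda>\<epsilon> \<psi>. U \<epsilon> \<psi> * V \<epsilon> \<psi>)"
  unfolding param_hull_def by (auto intro!: continuous_intros holomorphic_intros)

lemma param_hull_compose:
  assumes U: "param_hull D U" "\<And>\<epsilon> \<psi>. \<epsilon> \<in> D \<Longrightarrow> U \<epsilon> \<psi> \<in> T"
    and k: "k holomorphic_on T" "\<And>z. z \<in> T \<inter> \<real> \<Longrightarrow> k z \<in> \<real>"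
  shows "param_hull D (\<lambda>\<epsilon> \<psi>. k (U \<epsilon> \<psi>))"
  unfolding param_hull_def
proof (intro conjI ballI allI)
  fix \<epsilon> assume e: "\<epsilon> \<in> D"
  show "continuous_on UNIV (\<lambda>\<psi>. k (U \<epsilon> \<psi>))"
    by (rule continuous_on_compose2[OF holomorphic_on_imp_continuous_on[OF k(1)]])
       (use U e in \<open>auto simp: param_hull_def\<close>)
  show "k (U \<epsilon> (\<psi> + axis i (2 * pi))) = k (U \<epsilon> \<psi>)" for \<psi> i
    using U(1) e by (simp add: param_hull_def)
next
  fix \<psi>
  have "(k \<circ> (\<lambda>\<epsilon>. U \<epsilon> \<psi>)) holomorphic_on D"
    by (rule holomorphic_on_compose_gen[OF _ k(1)]) (use U in \<open>auto simp: param_hull_def\<close>)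
  thus "(\<lambda>\<epsilon>. k (U \<epsilon> \<psi>)) holomorphic_on D" by (simp add: o_def)
next
  fix \<epsilon> \<psi> assume "\<epsilon> \<in> D \<inter> \<real>"
  thus "k (U \<epsilon> \<psi>) \<in> \<real>" using U k(2) by (auto simp: param_hull_def)
qed

lemma param_hull_uniform_limit:
  assumes D: "open D" and U: "\<And>n. param_hull D (U n)"
    and lim: "uniform_limit (D \<times> UNIV) (\<lambda>n (\<epsilon>, \<psi>). U n \<epsilon> \<psi>) (\<lambda>(\<epsilon>, \<psi>). l \<epsilon> \<psi>) sequentially"
  shows "param_hull D l"
  unfolding param_hull_def
proof (intro conjI ballI allI)
  have pt: "(\<lambda>n. U n \<epsilon> \<psi>) \<longlonglongrightarrow> l \<epsilon> \<psi>" if "\<epsilon> \<in> D" for \<epsilon> \<psi>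
    using tendsto_uniform_limitI[OF lim, of "(\<epsilon>, \<psi>)"] that by simp
  { fix \<epsilon> assume e: "\<epsilon> \<in> D"
    have "uniform_limit UNIV (\<lambda>n \<psi>. U n \<epsilon> \<psi>) (l \<epsilon>) sequentially"
      using lim e unfolding uniform_limit_iff by (fastforce elim: eventually_mono)
    thus "continuous_on UNIV (l \<epsilon>)"
      by (rule uniform_limit_theorem[rotated]) (use U e in \<open>auto simp: param_hull_def\<close>)
    fix \<psi> i
    have "(\<lambda>n. U n \<epsilon> (\<psi> + axis i (2 * pi))) = (\<lambda>n. U n \<epsilon> \<psi>)"
      using U e by (simp add: param_hull_def)
    thus "l \<epsilon> (\<psi> + axis i (2 * pi)) = l \<epsilon> \<psi>"
      using pt[OF e, of "\<psi> + axis i (2 * pi)"] pt[OF e, of \<psi>] LIMSEQ_unique by simp }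
  { fix \<psi>
    show "(\<lambda>\<epsilon>. l \<epsilon> \<psi>) holomorphic_on D"
    proof (rule holomorphic_uniform_sequence[OF D])
      show "(\<lambda>\<epsilon>. U n \<epsilon> \<psi>) holomorphic_on D" for n using U by (simp add: param_hull_def)
      fix z assume "z \<in> D"
      then obtain d where d: "d > 0" "cball z d \<subseteq> D" using D open_contains_cball by blast
      have "uniform_limit (cball z d) (\<lambda>n \<epsilon>. U n \<epsilon> \<psi>) (\<lambda>\<epsilon>. l \<epsilon> \<psi>) sequentially"
        unfolding uniform_limit_iff
      proof (intro allI impI)
        fix e :: real assume "e > 0"
        with lim have "\<forall>\<^sub>F n in sequentially. \<forall>x\<in>D \<times> UNIV. dist ((\<lambda>(\<epsilon>, \<psi>). U n \<epsilon> \<psi>) x) ((\<lambda>(\<epsilon>, \<psi>). l \<epsilon> \<psi>) x) < e"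
          unfolding uniform_limit_iff by blast
        thus "\<forall>\<^sub>F n in sequentially. \<forall>x\<in>cball z d. dist (U n x \<psi>) (l x \<psi>) < e"
          by (rule eventually_mono) (use d in auto)
      qed
      with d show "\<exists>d>0. cball z d \<subseteq> D \<and> uniform_limit (cball z d) (\<lambda>n \<epsilon>. U n \<epsilon> \<psi>) (\<lambda>\<epsilon>. l \<epsilon> \<psi>) sequentially"
        by blast
    qed }
  fix \<epsilon> \<psi> assume e: "\<epsilon> \<in> D \<inter> \<real>"
  show "l \<epsilon> \<psi> \<in> \<real>"
    by (rule closed_sequentially[OF closed_complex_Reals _ pt]) (use U e in \<open>auto simp: param_hull_def\<close>)
qed

lemma param_hull_damped_inverse:
  assumes a: "a \<noteq> 0" "8 * R\<^sup>2 * \<bar>a\<bar> \<le> 1" and D: "D = ball (complex_of_real R) R"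
    and X: "param_hull D X" "\<And>\<epsilon> \<psi>. \<epsilon> \<in> D \<Longrightarrow> norm (X \<epsilon> \<psi>) \<le> M"
    and Y: "param_hull D Y" "\<And>\<epsilon> \<psi>. \<epsilon> \<in> D \<Longrightarrow> norm (Y \<epsilon> \<psi>) \<le> M"
  shows "param_hull D (\<lambda>\<epsilon>. damped_inverse a w \<epsilon> (X \<epsilon>) (Y \<epsilon>))"
proof -
  have oD: "open D" by (simp add: D)
  note d = tangent_disk[of _ R, folded D]
  have den: "of_real a * \<epsilon>\<^sup>2 \<noteq> 1" if "\<epsilon> \<in> D" for \<epsilon> :: complex
    using tangent_disk_denominator(2)[OF that[unfolded D] a(2)] by simp
  have re2: "Re (1 / \<epsilon>) > 0" if "\<epsilon> \<in> D" for \<epsilon>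
    using d(6)[OF that] by (intro order_less_trans[OF _ d(4)[OF that]]) simp
  have R1: "param_hull D (\<lambda>\<epsilon>. resolvent (of_real \<bar>a\<bar> * \<epsilon>) (sgn a *\<^sub>R w) (X \<epsilon>))"
    by (rule param_hull_resolvent[OF oD _ _ _ X]) (use a d(2) in \<open>auto intro!: holomorphic_intros\<close>)
  have R2: "param_hull D (\<lambda>\<epsilon>. resolvent (1 / \<epsilon>) w (Y \<epsilon>))"
    by (rule param_hull_resolvent[OF oD _ re2 _ Y]) (use d(5) in \<open>auto intro!: holomorphic_intros\<close>)
  have p: "param_hull D (\<lambda>\<epsilon> \<psi>. \<epsilon>\<^sup>2)" "param_hull D (\<lambda>\<epsilon> \<psi>. of_real (sgn a))"
    "param_hull D (\<lambda>\<epsilon> \<psi>. inverse (1 - of_real a * \<epsilon>\<^sup>2))"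
    by (rule param_hull_param; (auto intro!: holomorphic_intros simp: den))+
  show ?thesis
    unfolding damped_inverse_def divide_inverse
    using param_hull_mult[OF param_hull_add[OF param_hull_mult[OF p(1) param_hull_mult[OF p(2) R1]] R2] p(3)]
    by (simp add: divide_inverse)
qed

section \<open>The fixed point equation for the corrector\<close>

text \<open>The data of the problem after expansion at \<open>c0\<close>: \<open>a\<close> is the slope of \<open>g\<close> and \<open>y\<^sup>2 k(y)\<close> its
  nonlinear remainder, \<open>ft\<close> is the mean-free forcing, and \<open>F1\<close>, \<open>F2\<close> stand for its first and second
  primitive along \<open>\<omega>\<close>, a property that is added as a premise where the fixed point is translated back
  into a solution.\<close>

locale strong_damping =
  fixes a r B Kk Lk :: real and F1 F2 ft :: "real ^ 'd \<Rightarrow> real" and k :: "complex \<Rightarrow> complex" and \<omega> :: "real ^ 'd"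
  assumes a: "a \<noteq> 0" and r: "r > 0" and B: "B \<ge> 1"
    and F1: "torus_fun F1" "\<And>\<psi>. \<bar>F1 \<psi>\<bar> \<le> B"
    and F2: "torus_fun F2" "\<And>\<psi>. \<bar>F2 \<psi>\<bar> \<le> B"
    and ft: "torus_fun ft" "\<And>\<psi>. \<bar>ft \<psi>\<bar> \<le> B"
    and khol: "k holomorphic_on ball 0 r" and kreal: "\<And>z. z \<in> ball 0 r \<inter> \<real> \<Longrightarrow> k z \<in> \<real>"
    and kbound: "\<And>z. norm z \<le> r / 2 \<Longrightarrow> norm (k z) \<le> Kk"
    and klip: "\<And>z z'. norm z \<le> r / 2 \<Longrightarrow> norm z' \<le> r / 2 \<Longrightarrow> norm (k z - k z') \<le> Lk * norm (z - z')"
    and K0: "Kk \<ge> 0" and L0: "Lk \<ge> 0"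
begin

text \<open>Bounds for \<open>F1 + w\<close> (\<open>V\<close>), for \<open>src\<close> (\<open>MS\<close>), for the two sources of the fixed point equation (\<open>M\<close>), and a
  Lipschitz constant of these sources in \<open>w\<close> (\<open>\<Lambda>\<close>), all for \<open>\<bar>w\<bar> \<le> 1\<close>. Each summand in the denominator
  of the radius \<open>R\<close> secures one of the smallness conditions in the lemma \<open>R\<close> below.\<close>

definition V :: real where "V = B + 1"
definition MS :: real where "MS = \<bar>a\<bar> * B + B + \<bar>a\<bar>"
definition M :: real where "M = V\<^sup>2 * Kk + (1 + \<bar>a\<bar>) * MS"
definition \<Lambda> :: real where "\<Lambda> = 2 * V * Kk + V\<^sup>2 * Lk + (1 + \<bar>a\<bar>) * \<bar>a\<bar>"
definition R :: real where "R = 1 / (2 + 4 * V / r + 8 * \<bar>a\<bar> + 8 * (1 / \<bar>a\<bar> + 1) * M + 8 * (1 / \<bar>a\<bar> + 1) * \<Lambda>)"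
definition D :: "complex set" where "D = ball (complex_of_real R) R"

text \<open>The equation for the corrector is \<open>(\<partial> + a \<epsilon>) (\<partial> + 1/\<epsilon>) w = - \<epsilon> nonlin - \<partial> src\<close>. Solving it by partial
  fractions, with \<open>\<partial> R1 = 1 - a \<epsilon> R1\<close> and \<open>\<partial> R2 = 1 - R2 / \<epsilon>\<close> for the two resolvents, and
  collecting what each resolvent is applied to gives \<open>slow_src\<close> and \<open>fast_src\<close> as the two arguments of
  \<open>damped_inverse\<close>.\<close>

definition nonlin :: "complex \<Rightarrow> real ^ 'd \<Rightarrow> complex \<Rightarrow> complex" where
  "nonlin \<epsilon> \<psi> w = (of_real (F1 \<psi>) + w) * (of_real (F1 \<psi>) + w) * k (\<epsilon> * (of_real (F1 \<psi>) + w))"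
definition src :: "complex \<Rightarrow> real ^ 'd \<Rightarrow> complex \<Rightarrow> complex" where
  "src \<epsilon> \<psi> w = of_real a * of_real (F2 \<psi>) + of_real (ft \<psi>) - of_real a * \<epsilon> * w"
definition slow_src :: "complex \<Rightarrow> real ^ 'd \<Rightarrow> complex \<Rightarrow> complex" where
  "slow_src \<epsilon> \<psi> w = of_real a * src \<epsilon> \<psi> w - nonlin \<epsilon> \<psi> w"
definition fast_src :: "complex \<Rightarrow> real ^ 'd \<Rightarrow> complex \<Rightarrow> complex" where
  "fast_src \<epsilon> \<psi> w = \<epsilon>\<^sup>2 * nonlin \<epsilon> \<psi> w - src \<epsilon> \<psi> w"

lemma const_bounds: "V \<ge> 2" "MS \<ge> 0" "M \<ge> 0" "\<Lambda> \<ge> 0"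
proof -
  show V: "V \<ge> 2" using B by (simp add: V_def)
  show MS: "MS \<ge> 0" using B by (simp add: MS_def)
  show "M \<ge> 0" using V MS K0 by (simp add: M_def)
  show "\<Lambda> \<ge> 0" using V K0 L0 by (simp add: \<Lambda>_def)
qed

lemma R: "R > 0" "2 * R \<le> 1" "4 * R * V \<le> r" "8 * R\<^sup>2 * \<bar>a\<bar> \<le> 1"
    "4 * R * (1 / \<bar>a\<bar> + 1) * M \<le> 1" "4 * R * (1 / \<bar>a\<bar> + 1) * \<Lambda> \<le> 1 / 2"
proof -
  let ?m = "8 * (1 / \<bar>a\<bar> + 1) * M" and ?l = "8 * (1 / \<bar>a\<bar> + 1) * \<Lambda>" and ?v = "4 * V / r"
  have nn: "?m \<ge> 0" "?l \<ge> 0" "?v \<ge> 0" "8 * \<bar>a\<bar> \<ge> 0" using const_bounds r by simp_all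
  define S where "S = 2 + ?v + 8 * \<bar>a\<bar> + ?m + ?l"
  have S: "S > 0" using nn by (simp add: S_def)
  have RS: "R = 1 / S" by (simp add: R_def S_def)
  show R0: "R > 0" using S RS by simp
  have le: "R * y \<le> 1" if "y \<le> S" for y using that S by (simp add: RS)
  show R2: "2 * R \<le> 1" using le[of 2] nn by (simp add: S_def)
  have "R * ?v \<le> 1" using nn by (intro le) (simp add: S_def)
  thus "4 * R * V \<le> r" using r by (simp add: field_simps)
  have "R * (8 * \<bar>a\<bar>) \<le> 1" using nn by (intro le) (simp add: S_def)
  hence "R * (R * (8 * \<bar>a\<bar>)) \<le> 1 * 1" using R0 R2 by (intro mult_mono) auto
  thus "8 * R\<^sup>2 * \<bar>a\<bar> \<le> 1" by (simp add: power2_eq_square mult_ac)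
  have "R * ?m \<le> 1" using nn by (intro le) (simp add: S_def)
  hence "2 * (4 * R * (1 / \<bar>a\<bar> + 1) * M) \<le> 1" by (simp add: algebra_simps)
  moreover have "0 \<le> 4 * R * (1 / \<bar>a\<bar> + 1) * M" using R0 const_bounds by simp
  moreover have "x \<le> 1" if "2 * x \<le> 1" "0 \<le> x" for x :: real using that by linarith
  ultimately show "4 * R * (1 / \<bar>a\<bar> + 1) * M \<le> 1" by blast
  have "R * ?l \<le> 1" using nn by (intro le) (simp add: S_def)
  thus "4 * R * (1 / \<bar>a\<bar> + 1) * \<Lambda> \<le> 1 / 2" by (simp add: algebra_simps)
qed

lemma D_norm: "\<epsilon> \<in> D \<Longrightarrow> norm \<epsilon> \<le> 1" "\<epsilon> \<in> D \<Longrightarrow> norm \<epsilon> * V \<le> r / 2"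
proof -
  assume e: "\<epsilon> \<in> D"
  have n: "norm \<epsilon> \<le> 2 * R" using tangent_disk(1)[of \<epsilon> R] e by (simp add: D_def)
  thus "norm \<epsilon> \<le> 1" using R(2) by linarith
  have "norm \<epsilon> * V \<le> 2 * R * V" using n const_bounds by (intro mult_right_mono) auto
  thus "norm \<epsilon> * V \<le> r / 2" using R(3) by linarith
qed

lemma v_bound: "norm (w :: complex) \<le> 1 \<Longrightarrow> norm (of_real (F1 \<psi>) + w) \<le> V"
  using norm_triangle_ineq[of "complex_of_real (F1 \<psi>)" w] F1(2)[of \<psi>] by (simp add: V_def)

lemma ev_bound: "\<epsilon> \<in> D \<Longrightarrow> norm w \<le> 1 \<Longrightarrow> norm (\<epsilon> * (of_real (F1 \<psi>) + w)) \<le> r / 2"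
proof -
  assume e: "\<epsilon> \<in> D" and w: "norm w \<le> 1"
  have "norm (\<epsilon> * (of_real (F1 \<psi>) + w)) \<le> norm \<epsilon> * V"
    unfolding norm_mult by (intro mult_left_mono v_bound w) auto
  thus ?thesis using D_norm(2)[OF e] by linarith
qed

lemma nonlin_bound:
  assumes "\<epsilon> \<in> D" "norm w \<le> 1" shows "norm (nonlin \<epsilon> \<psi> w) \<le> V\<^sup>2 * Kk"
  unfolding nonlin_def norm_mult power2_eq_square
  using v_bound[OF assms(2)] kbound[OF ev_bound[OF assms]] const_bounds K0
  by (intro mult_mono) auto

lemma nonlin_lip:
  assumes e: "\<epsilon> \<in> D" and w: "norm w \<le> 1" "norm w' \<le> 1"
  shows "norm (nonlin \<epsilon> \<psi> w - nonlin \<epsilon> \<psi> w') \<le> (2 * V * Kk + V\<^sup>2 * Lk) * norm (w - w')"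
proof -
  define v v' where "v = of_real (F1 \<psi>) + w" and "v' = of_real (F1 \<psi>) + w'"
  have vv: "v - v' = w - w'" by (simp add: v_def v'_def)
  have b: "norm v \<le> V" "norm v' \<le> V" using v_bound w by (auto simp: v_def v'_def)
  have ev: "norm (\<epsilon> * v) \<le> r / 2" "norm (\<epsilon> * v') \<le> r / 2" using ev_bound e w by (auto simp: v_def v'_def)
  have "nonlin \<epsilon> \<psi> w - nonlin \<epsilon> \<psi> w' = (v + v') * (v - v') * k (\<epsilon> * v) + v' * v' * (k (\<epsilon> * v) - k (\<epsilon> * v'))"
    by (simp add: nonlin_def v_def v'_def algebra_simps)
  hence "norm (nonlin \<epsilon> \<psi> w - nonlin \<epsilon> \<psi> w') \<le>
      norm (v + v') * norm (v - v') * norm (k (\<epsilon> * v)) + norm v' * norm v' * norm (k (\<epsilon> * v) - k (\<epsilon> * v'))"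
    by (metis norm_triangle_ineq norm_mult)
  also have "norm (v + v') * norm (v - v') * norm (k (\<epsilon> * v)) \<le> (2 * V) * norm (v - v') * Kk"
    using b kbound[OF ev(1)] const_bounds K0 norm_triangle_mono[OF b] by (intro mult_mono) auto
  also have "norm v' * norm v' * norm (k (\<epsilon> * v) - k (\<epsilon> * v')) \<le> V * V * (Lk * norm (v - v'))"
  proof -
    have "norm (k (\<epsilon> * v) - k (\<epsilon> * v')) \<le> Lk * norm (\<epsilon> * v - \<epsilon> * v')" by (rule klip[OF ev])
    also have "norm (\<epsilon> * v - \<epsilon> * v') \<le> 1 * norm (v - v')"
      unfolding right_diff_distrib[symmetric] norm_mult by (intro mult_right_mono D_norm(1) e) auto
    finally have "norm (k (\<epsilon> * v) - k (\<epsilon> * v')) \<le> Lk * norm (v - v')" using L0 by (simp add: mult_left_mono)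
    thus ?thesis using b const_bounds L0 by (intro mult_mono) auto
  qed
  finally show ?thesis by (simp add: vv power2_eq_square algebra_simps)
qed

lemma src_bound:
  assumes "\<epsilon> \<in> D" "norm w \<le> 1" shows "norm (src \<epsilon> \<psi> w) \<le> MS"
proof -
  have "norm (src \<epsilon> \<psi> w) \<le> norm (complex_of_real a * of_real (F2 \<psi>)) + norm (complex_of_real (ft \<psi>)) + norm (of_real a * \<epsilon> * w)"
    unfolding src_def by (meson norm_triangle_ineq4 norm_triangle_ineq order_trans add_right_mono)
  also have "norm (complex_of_real a * of_real (F2 \<psi>)) \<le> \<bar>a\<bar> * B"
    using F2(2)[of \<psi>] by (simp add: norm_mult mult_left_mono)
  also have "norm (complex_of_real (ft \<psi>)) \<le> B" using ft(2)[of \<psi>] by simp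
  also have "norm (of_real a * \<epsilon> * w) \<le> \<bar>a\<bar> * 1 * 1"
    unfolding norm_mult using D_norm(1)[OF assms(1)] assms(2) by (intro mult_mono) auto
  finally show ?thesis by (simp add: MS_def)
qed

lemma src_lip:
  assumes "\<epsilon> \<in> D" shows "norm (src \<epsilon> \<psi> w - src \<epsilon> \<psi> w') \<le> \<bar>a\<bar> * norm (w - w')"
proof -
  have "src \<epsilon> \<psi> w - src \<epsilon> \<psi> w' = of_real a * \<epsilon> * (w' - w)" by (simp add: src_def algebra_simps)
  hence "norm (src \<epsilon> \<psi> w - src \<epsilon> \<psi> w') = \<bar>a\<bar> * norm \<epsilon> * norm (w - w')"
    by (simp add: norm_mult norm_minus_commute)
  also have "\<dots> \<le> \<bar>a\<bar> * 1 * norm (w - w')"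
    using D_norm(1)[OF assms] by (intro mult_mono) auto
  finally show ?thesis by simp
qed

lemma slow_fast_bound:
  assumes "\<epsilon> \<in> D" "norm w \<le> 1"
  shows "norm (slow_src \<epsilon> \<psi> w) \<le> M" "norm (fast_src \<epsilon> \<psi> w) \<le> M"
proof -
  have n: "norm (nonlin \<epsilon> \<psi> w) \<le> V\<^sup>2 * Kk" and s: "norm (src \<epsilon> \<psi> w) \<le> MS"
    using nonlin_bound src_bound assms by auto
  have as: "\<bar>a\<bar> * norm (src \<epsilon> \<psi> w) \<le> \<bar>a\<bar> * MS" using s by (intro mult_left_mono) auto
  have en: "norm (\<epsilon>\<^sup>2) * norm (nonlin \<epsilon> \<psi> w) \<le> 1 * (V\<^sup>2 * Kk)"
    using n D_norm(1)[OF assms(1)] by (intro mult_mono) (auto simp: norm_power power_le_one)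
  have "norm (slow_src \<epsilon> \<psi> w) \<le> \<bar>a\<bar> * norm (src \<epsilon> \<psi> w) + norm (nonlin \<epsilon> \<psi> w)"
    unfolding slow_src_def by (rule order_trans[OF norm_triangle_ineq4]) (simp add: norm_mult)
  thus "norm (slow_src \<epsilon> \<psi> w) \<le> M" using n as const_bounds by (simp add: M_def algebra_simps)
  have "norm (fast_src \<epsilon> \<psi> w) \<le> norm (\<epsilon>\<^sup>2) * norm (nonlin \<epsilon> \<psi> w) + norm (src \<epsilon> \<psi> w)"
    unfolding fast_src_def by (rule order_trans[OF norm_triangle_ineq4]) (simp add: norm_mult)
  moreover have "MS \<le> (1 + \<bar>a\<bar>) * MS" using const_bounds by (simp add: distrib_right)
  ultimately show "norm (fast_src \<epsilon> \<psi> w) \<le> M" using en s by (simp add: M_def)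
qed

lemma slow_fast_lip:
  assumes "\<epsilon> \<in> D" "norm w \<le> 1" "norm w' \<le> 1"
  shows "norm (slow_src \<epsilon> \<psi> w - slow_src \<epsilon> \<psi> w') \<le> \<Lambda> * norm (w - w')"
    "norm (fast_src \<epsilon> \<psi> w - fast_src \<epsilon> \<psi> w') \<le> \<Lambda> * norm (w - w')"
proof -
  define N s where "N = nonlin \<epsilon> \<psi> w - nonlin \<epsilon> \<psi> w'" and "s = src \<epsilon> \<psi> w - src \<epsilon> \<psi> w'"
  have n: "norm N \<le> (2 * V * Kk + V\<^sup>2 * Lk) * norm (w - w')" and s: "norm s \<le> \<bar>a\<bar> * norm (w - w')"
    using nonlin_lip src_lip assms by (auto simp: N_def s_def)
  have as: "\<bar>a\<bar> * norm s \<le> \<bar>a\<bar> * (\<bar>a\<bar> * norm (w - w'))" using s by (intro mult_left_mono) auto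
  have en: "norm (\<epsilon>\<^sup>2) * norm N \<le> 1 * ((2 * V * Kk + V\<^sup>2 * Lk) * norm (w - w'))"
    using n D_norm(1)[OF assms(1)] by (intro mult_mono) (auto simp: norm_power power_le_one)
  have L: "\<Lambda> * norm (w - w') = (2 * V * Kk + V\<^sup>2 * Lk) * norm (w - w') + \<bar>a\<bar> * norm (w - w') + \<bar>a\<bar> * (\<bar>a\<bar> * norm (w - w'))"
    by (simp add: \<Lambda>_def algebra_simps)
  have "slow_src \<epsilon> \<psi> w - slow_src \<epsilon> \<psi> w' = of_real a * s - N" by (simp add: slow_src_def N_def s_def algebra_simps)
  hence "norm (slow_src \<epsilon> \<psi> w - slow_src \<epsilon> \<psi> w') \<le> \<bar>a\<bar> * norm s + norm N"
    using norm_triangle_ineq4[of "of_real a * s" N] by (simp add: norm_mult)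
  moreover have "0 \<le> \<bar>a\<bar> * norm (w - w')" by simp
  ultimately show "norm (slow_src \<epsilon> \<psi> w - slow_src \<epsilon> \<psi> w') \<le> \<Lambda> * norm (w - w')" using n as unfolding L by linarith
  have "fast_src \<epsilon> \<psi> w - fast_src \<epsilon> \<psi> w' = \<epsilon>\<^sup>2 * N - s" by (simp add: fast_src_def N_def s_def algebra_simps)
  hence "norm (fast_src \<epsilon> \<psi> w - fast_src \<epsilon> \<psi> w') \<le> norm (\<epsilon>\<^sup>2) * norm N + norm s"
    using norm_triangle_ineq4[of "\<epsilon>\<^sup>2 * N" s] by (simp add: norm_mult)
  moreover have "0 \<le> \<bar>a\<bar> * (\<bar>a\<bar> * norm (w - w'))" by simp
  ultimately show "norm (fast_src \<epsilon> \<psi> w - fast_src \<epsilon> \<psi> w') \<le> \<Lambda> * norm (w - w')" using en s unfolding L by linarith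
qed

definition admissible :: "(complex \<Rightarrow> real ^ 'd \<Rightarrow> complex) \<Rightarrow> bool" where
  "admissible W \<longleftrightarrow> param_hull D W \<and> (\<forall>\<epsilon>\<in>D. \<forall>\<psi>. norm (W \<epsilon> \<psi>) \<le> 1)"

lemma param_hull_sources:
  assumes "admissible W"
  shows "param_hull D (\<lambda>\<epsilon> \<psi>. slow_src \<epsilon> \<psi> (W \<epsilon> \<psi>))" "param_hull D (\<lambda>\<epsilon> \<psi>. fast_src \<epsilon> \<psi> (W \<epsilon> \<psi>))"
proof -
  have W: "param_hull D W" "\<And>\<epsilon> \<psi>. \<epsilon> \<in> D \<Longrightarrow> norm (W \<epsilon> \<psi>) \<le> 1" using assms by (auto simp: admissible_def)
  have e: "param_hull D (\<lambda>\<epsilon> \<psi>. \<epsilon>)" "param_hull D (\<lambda>\<epsilon> \<psi>. \<epsilon>\<^sup>2)" "param_hull D (\<lambda>\<epsilon> \<psi>. complex_of_real a)"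
    by (rule param_hull_param; (auto intro!: holomorphic_intros))+
  note c = param_hull_indep[OF F1(1)] param_hull_indep[OF F2(1)] param_hull_indep[OF ft(1)]
  have v: "param_hull D (\<lambda>\<epsilon> \<psi>. of_real (F1 \<psi>) + W \<epsilon> \<psi>)" by (intro param_hull_add c W)
  have "param_hull D (\<lambda>\<epsilon> \<psi>. k (\<epsilon> * (of_real (F1 \<psi>) + W \<epsilon> \<psi>)))"
  proof (rule param_hull_compose[OF param_hull_mult[OF e(1) v] _ khol kreal])
    fix \<epsilon> \<psi> assume "\<epsilon> \<in> D"
    thus "\<epsilon> * (of_real (F1 \<psi>) + W \<epsilon> \<psi>) \<in> ball 0 r"
      using ev_bound[OF _ W(2), of \<epsilon> \<epsilon> \<psi> \<psi>] r by simp
  qed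
  hence n: "param_hull D (\<lambda>\<epsilon> \<psi>. nonlin \<epsilon> \<psi> (W \<epsilon> \<psi>))"
    unfolding nonlin_def by (intro param_hull_mult v)
  have s: "param_hull D (\<lambda>\<epsilon> \<psi>. src \<epsilon> \<psi> (W \<epsilon> \<psi>))"
    unfolding src_def by (intro param_hull_mult param_hull_add param_hull_diff c e W)
  show "param_hull D (\<lambda>\<epsilon> \<psi>. slow_src \<epsilon> \<psi> (W \<epsilon> \<psi>))" "param_hull D (\<lambda>\<epsilon> \<psi>. fast_src \<epsilon> \<psi> (W \<epsilon> \<psi>))"
    unfolding slow_src_def fast_src_def by (intro param_hull_mult param_hull_diff n s e)+
qed

definition step :: "(complex \<Rightarrow> real ^ 'd \<Rightarrow> complex) \<Rightarrow> complex \<Rightarrow> real ^ 'd \<Rightarrow> complex" where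
  "step W \<epsilon> = damped_inverse a \<omega> \<epsilon> (\<lambda>\<psi>. slow_src \<epsilon> \<psi> (W \<epsilon> \<psi>)) (\<lambda>\<psi>. fast_src \<epsilon> \<psi> (W \<epsilon> \<psi>))"

lemma admissible_sources:
  assumes "admissible W" "\<epsilon> \<in> D"
  shows "continuous_on UNIV (\<lambda>\<psi>. slow_src \<epsilon> \<psi> (W \<epsilon> \<psi>))" "norm (slow_src \<epsilon> \<psi> (W \<epsilon> \<psi>)) \<le> M"
    "continuous_on UNIV (\<lambda>\<psi>. fast_src \<epsilon> \<psi> (W \<epsilon> \<psi>))" "norm (fast_src \<epsilon> \<psi> (W \<epsilon> \<psi>)) \<le> M"
  using param_hull_sources[OF assms(1)] slow_fast_bound assms unfolding param_hull_def admissible_def by auto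

lemma admissible_step:
  assumes "admissible W" shows "admissible (step W)"
  unfolding admissible_def
proof (intro conjI ballI allI)
  note s = admissible_sources[OF assms]
  show "param_hull D (step W)"
    unfolding step_def
    by (rule param_hull_damped_inverse[OF a R(4) D_def param_hull_sources(1)[OF assms] s(2) param_hull_sources(2)[OF assms] s(4)])
  fix \<epsilon> \<psi> assume e: "\<epsilon> \<in> D"
  have "norm (step W \<epsilon> \<psi>) \<le> 4 * R * (1 / \<bar>a\<bar> + 1) * M"
    unfolding step_def by (rule damped_inverse_bound[OF s[OF e] e[unfolded D_def] a R(4)])
  thus "norm (step W \<epsilon> \<psi>) \<le> 1" using R(5) by linarith
qed

lemma step_contraction:
  assumes W: "admissible W" "admissible W'" and C: "\<And>\<epsilon> \<psi>. \<epsilon> \<in> D \<Longrightarrow> norm (W \<epsilon> \<psi> - W' \<epsilon> \<psi>) \<le> C"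
    and e: "\<epsilon> \<in> D" and "C \<ge> 0"
  shows "norm (step W \<epsilon> \<psi> - step W' \<epsilon> \<psi>) \<le> C / 2"
proof -
  note s = admissible_sources[OF W(1) e] and s' = admissible_sources[OF W(2) e]
  have n: "norm (W \<epsilon> \<psi>) \<le> 1" "norm (W' \<epsilon> \<psi>) \<le> 1" for \<psi> using W e by (auto simp: admissible_def)
  have le: "\<Lambda> * norm (W \<epsilon> \<psi> - W' \<epsilon> \<psi>) \<le> \<Lambda> * C" for \<psi> using C[OF e] const_bounds by (intro mult_left_mono) auto
  have "norm (step W \<epsilon> \<psi> - step W' \<epsilon> \<psi>) \<le> 4 * R * (1 / \<bar>a\<bar> + 1) * (\<Lambda> * C)"
    unfolding step_def damped_inverse_diff[OF s s' e[unfolded D_def] a]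
  proof (rule damped_inverse_bound[OF _ _ _ _ e[unfolded D_def] a R(4)])
    show "norm (slow_src \<epsilon> \<psi> (W \<epsilon> \<psi>) - slow_src \<epsilon> \<psi> (W' \<epsilon> \<psi>)) \<le> \<Lambda> * C"
      "norm (fast_src \<epsilon> \<psi> (W \<epsilon> \<psi>) - fast_src \<epsilon> \<psi> (W' \<epsilon> \<psi>)) \<le> \<Lambda> * C" for \<psi>
      using slow_fast_lip[OF e n(1) n(2)] le order_trans by blast+
  qed (intro continuous_intros s s')+
  also have "\<dots> = (4 * R * (1 / \<bar>a\<bar> + 1) * \<Lambda>) * C" by simp
  also have "\<dots> \<le> 1 / 2 * C" using R(6) assms(5) by (intro mult_right_mono) auto
  finally show ?thesis by simp
qed

lemma corrector_exists: "\<exists>W. admissible W \<and> (\<forall>\<epsilon>\<in>D. \<forall>\<psi>. step W \<epsilon> \<psi> = W \<epsilon> \<psi>)"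
proof -
  let ?T = "\<lambda>w (\<epsilon>, \<psi>). step (\<lambda>\<epsilon> \<psi>. w (\<epsilon>, \<psi>)) \<epsilon> \<psi>"
  let ?S = "{w. admissible (\<lambda>\<epsilon> \<psi>. w (\<epsilon>, \<psi>))}"
  have "\<exists>w\<in>?S. \<forall>x\<in>D \<times> UNIV. ?T w x = w x"
  proof (rule uniform_contraction_fixpoint[where T = ?T and K = 1])
    have "param_hull D (\<lambda>\<epsilon> \<psi>. 0)" by (intro param_hull_param) auto
    thus zero: "(\<lambda>_. 0) \<in> ?S" by (simp add: admissible_def)
    show "?T w \<in> ?S" if "w \<in> ?S" for w using admissible_step that by simp
    show "norm (?T v x - ?T w x) \<le> C / 2"
      if "v \<in> ?S" "w \<in> ?S" "C \<ge> 0" "\<And>y. y \<in> D \<times> UNIV \<Longrightarrow> norm (v y - w y) \<le> C" "x \<in> D \<times> UNIV" for v w C x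
      using step_contraction[of "\<lambda>\<epsilon> \<psi>. v (\<epsilon>, \<psi>)" "\<lambda>\<epsilon> \<psi>. w (\<epsilon>, \<psi>)" C "fst x" "snd x"] that by (auto split: prod.splits)
    show "norm (?T (\<lambda>_. 0) x - 0) \<le> 1" if "x \<in> D \<times> UNIV" for x
      using admissible_step[of "\<lambda>\<epsilon> \<psi>. 0"] zero that by (auto simp: admissible_def split: prod.splits)
    fix u l assume u: "\<And>n. u n \<in> ?S" and lim: "uniform_limit (D \<times> UNIV) u l sequentially"
    have "param_hull D (\<lambda>\<epsilon> \<psi>. l (\<epsilon>, \<psi>))"
      by (rule param_hull_uniform_limit[of D "\<lambda>n \<epsilon> \<psi>. u n (\<epsilon>, \<psi>)"])
         (use u lim in \<open>auto simp: D_def admissible_def\<close>)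
    moreover have "norm (l (\<epsilon>, \<psi>)) \<le> 1" if "\<epsilon> \<in> D" for \<epsilon> \<psi>
    proof (rule tendsto_upperbound[OF tendsto_norm])
      show "(\<lambda>n. u n (\<epsilon>, \<psi>)) \<longlonglongrightarrow> l (\<epsilon>, \<psi>)"
        using tendsto_uniform_limitI[OF lim] that by simp
    qed (use u that in \<open>auto simp: admissible_def\<close>)
    ultimately show "l \<in> ?S" by (simp add: admissible_def)
  qed
  then obtain w where "w \<in> ?S" "\<forall>x\<in>D \<times> UNIV. ?T w x = w x" by blast
  thus ?thesis by (intro exI[of _ "\<lambda>\<epsilon> \<psi>. w (\<epsilon>, \<psi>)"]) auto
qed

end

section \<open>From the corrector to the response solution\<close>

lemma signed_resolvent_derivative:
  fixes w :: "'a::real_normed_vector" and X :: "'a::real_normed_vector \<Rightarrow> complex"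
  assumes X: "continuous_on UNIV X" "\<And>\<psi>. norm (X \<psi>) \<le> M" and a: "a \<noteq> 0" and e: "Re \<epsilon> > 0"
  defines "p \<equiv> (\<lambda>\<psi>. of_real (sgn a) * resolvent (of_real \<bar>a\<bar> * \<epsilon>) (sgn a *\<^sub>R w) X \<psi>)"
  shows "((\<lambda>t. p (\<psi> + t *\<^sub>R w)) has_vector_derivative X (\<psi> + t *\<^sub>R w) - of_real a * \<epsilon> * p (\<psi> + t *\<^sub>R w)) (at t)"
proof -
  define s where "s = sgn a"
  have ss: "s * s = 1" and as: "a = \<bar>a\<bar> * s"
    using a by (auto simp: s_def sgn_if abs_if)
  let ?r = "resolvent (of_real \<bar>a\<bar> * \<epsilon>) (s *\<^sub>R w) X"
  have mu: "Re (of_real \<bar>a\<bar> * \<epsilon>) > 0" using a e by simp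
  have pos: "\<psi> + (s * t) *\<^sub>R (s *\<^sub>R w) = \<psi> + t *\<^sub>R w" for t
  proof -
    have "(s * t) *\<^sub>R (s *\<^sub>R w) = (t * (s * s)) *\<^sub>R w" by (simp add: mult_ac)
    thus ?thesis by (simp add: ss)
  qed
  have d: "((\<lambda>t. s * t) has_real_derivative s) (at t)" by (auto intro!: derivative_eq_intros)
  have "((\<lambda>t. ?r (\<psi> + t *\<^sub>R (s *\<^sub>R w))) has_vector_derivative
      X (\<psi> + (s * t) *\<^sub>R (s *\<^sub>R w)) - of_real \<bar>a\<bar> * \<epsilon> * ?r (\<psi> + (s * t) *\<^sub>R (s *\<^sub>R w))) (at (s * t))"
    by (rule resolvent_derivative[OF X mu])
  from vector_diff_chain_at[OF d[unfolded has_real_derivative_iff_has_vector_derivative] this]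
  have "((\<lambda>t. ?r (\<psi> + t *\<^sub>R w)) has_vector_derivative
      s *\<^sub>R (X (\<psi> + t *\<^sub>R w) - of_real \<bar>a\<bar> * \<epsilon> * ?r (\<psi> + t *\<^sub>R w))) (at t)"
    unfolding o_def pos .
  from bounded_linear.has_vector_derivative[OF bounded_linear_mult_right this, of "of_real s"]
  have "((\<lambda>t. p (\<psi> + t *\<^sub>R w)) has_vector_derivative
      of_real s * (s *\<^sub>R (X (\<psi> + t *\<^sub>R w) - of_real \<bar>a\<bar> * \<epsilon> * ?r (\<psi> + t *\<^sub>R w)))) (at t)"
    by (simp add: p_def s_def)
  also have "of_real s * (s *\<^sub>R (X (\<psi> + t *\<^sub>R w) - of_real \<bar>a\<bar> * \<epsilon> * ?r (\<psi> + t *\<^sub>R w)))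
      = of_real (s * s) * (X (\<psi> + t *\<^sub>R w) - of_real \<bar>a\<bar> * \<epsilon> * ?r (\<psi> + t *\<^sub>R w))"
    by (simp add: scaleR_conv_of_real)
  also have "\<dots> = X (\<psi> + t *\<^sub>R w) - of_real \<bar>a\<bar> * \<epsilon> * ?r (\<psi> + t *\<^sub>R w)" by (simp add: ss)
  also have "\<dots> = X (\<psi> + t *\<^sub>R w) - of_real a * \<epsilon> * p (\<psi> + t *\<^sub>R w)"
  proof -
    have "of_real a * \<epsilon> * p (\<psi> + t *\<^sub>R w) = of_real (a * s) * \<epsilon> * ?r (\<psi> + t *\<^sub>R w)"
      by (simp add: p_def s_def mult_ac)
    also have "a * s = \<bar>a\<bar>" using ss as by (metis mult.assoc mult.right_neutral)
    finally have "of_real a * \<epsilon> * p (\<psi> + t *\<^sub>R w) = of_real \<bar>a\<bar> * \<epsilon> * ?r (\<psi> + t *\<^sub>R w)" .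
    thus ?thesis by (simp only:)
  qed
  finally show ?thesis .
qed

lemma has_vector_derivative_of_real:
  assumes "(F has_real_derivative D) (at t)"
  shows "((\<lambda>t. complex_of_real (F t)) has_vector_derivative of_real D) (at t)"
  using bounded_linear.has_vector_derivative[OF bounded_linear_of_real] assms
  by (simp add: has_real_derivative_iff_has_vector_derivative)

context strong_damping
begin

text \<open>Differentiating the fixed point equation with \<open>\<partial> p = P - a \<epsilon> p\<close> and \<open>\<partial> q = Q - q / \<epsilon>\<close> for the two
  resolvent terms. In the first derivative of \<open>y\<close> the forcing cancels and only \<open>- a \<epsilon> F2 - q\<close> remains;
  hence \<open>y\<close> can be differentiated a second time without differentiating the forcing.\<close>

lemma complex_response:
  assumes dF1: "\<And>t. ((\<lambda>t. F1 (t *\<^sub>R \<omega>)) has_real_derivative ft (t *\<^sub>R \<omega>)) (at t)"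
    and dF2: "\<And>t. ((\<lambda>t. F2 (t *\<^sub>R \<omega>)) has_real_derivative F1 (t *\<^sub>R \<omega>)) (at t)"
    and W: "admissible W" "\<And>\<epsilon> \<psi>. \<epsilon> \<in> D \<Longrightarrow> step W \<epsilon> \<psi> = W \<epsilon> \<psi>" and e: "\<epsilon> \<in> D"
  defines "q \<equiv> resolvent (1 / \<epsilon>) \<omega> (\<lambda>\<psi>. fast_src \<epsilon> \<psi> (W \<epsilon> \<psi>))"
  defines "y \<equiv> (\<lambda>\<psi>. \<epsilon> * (of_real (F1 \<psi>) + W \<epsilon> \<psi>))"
    and "v \<equiv> (\<lambda>\<psi>. - (of_real a * \<epsilon> * of_real (F2 \<psi>)) - q \<psi>)"
  shows "((\<lambda>t. y (t *\<^sub>R \<omega>)) has_vector_derivative v (t *\<^sub>R \<omega>)) (at t)"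
    and "((\<lambda>t. v (t *\<^sub>R \<omega>)) has_vector_derivative
      of_real (ft (t *\<^sub>R \<omega>)) - v (t *\<^sub>R \<omega>) / \<epsilon> - (of_real a * y (t *\<^sub>R \<omega>) + y (t *\<^sub>R \<omega>) * y (t *\<^sub>R \<omega>) * k (y (t *\<^sub>R \<omega>)))) (at t)"
    and "norm (q \<psi>) \<le> M / Re (1 / \<epsilon>)"
proof -
  note s = admissible_sources[OF W(1) e] and d = tangent_disk[OF e[unfolded D_def]]
  have re2: "Re (1 / \<epsilon>) > 0" using d(6) by (intro order_less_trans[OF _ d(4)]) simp
  show "norm (q \<psi>) \<le> M / Re (1 / \<epsilon>)" unfolding q_def by (rule resolvent_bound[OF s(3,4) re2])
  define p where "p = (\<lambda>\<psi>. of_real (sgn a) * resolvent (of_real \<bar>a\<bar> * \<epsilon>) (sgn a *\<^sub>R \<omega>) (\<lambda>\<psi>. slow_src \<epsilon> \<psi> (W \<epsilon> \<psi>)) \<psi>)"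
  let ?z = "t *\<^sub>R \<omega>"
  define P Q S H where "P = slow_src \<epsilon> ?z (W \<epsilon> ?z)" and "Q = fast_src \<epsilon> ?z (W \<epsilon> ?z)"
    and "S = src \<epsilon> ?z (W \<epsilon> ?z)" and "H = nonlin \<epsilon> ?z (W \<epsilon> ?z)"
  have dp: "((\<lambda>t. p (t *\<^sub>R \<omega>)) has_vector_derivative P - of_real a * \<epsilon> * p ?z) (at t)"
    using signed_resolvent_derivative[OF s(1,2) a d(2), where \<psi> = 0 and w = \<omega> and t = t] by (simp add: p_def P_def)
  have dq: "((\<lambda>t. q (t *\<^sub>R \<omega>)) has_vector_derivative Q - 1 / \<epsilon> * q ?z) (at t)"
    using resolvent_derivative[OF s(3,4) re2, where \<psi> = 0 and w = \<omega> and t = t] by (simp add: q_def Q_def)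
  have Weq: "W \<epsilon> \<psi> = (\<epsilon>\<^sup>2 * p \<psi> + q \<psi>) * inverse (1 - of_real a * \<epsilon>\<^sup>2)" for \<psi>
    using W(2)[OF e, of \<psi>] unfolding step_def damped_inverse_def p_def q_def by (simp add: divide_inverse)
  have den: "1 - of_real a * \<epsilon>\<^sup>2 \<noteq> 0" by (rule tangent_disk_denominator(2)[OF e[unfolded D_def] R(4)])
  let ?dW = "(\<epsilon>\<^sup>2 * (P - of_real a * \<epsilon> * p ?z) + (Q - 1 / \<epsilon> * q ?z)) * inverse (1 - of_real a * \<epsilon>\<^sup>2)"
  have dW: "((\<lambda>t. W \<epsilon> (t *\<^sub>R \<omega>)) has_vector_derivative
      ?dW) (at t)"
    unfolding Weq
    by (intro bounded_linear.has_vector_derivative[OF bounded_linear_mult_left] has_vector_derivative_add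
      bounded_linear.has_vector_derivative[OF bounded_linear_mult_right] dp dq)
  have dy: "((\<lambda>t. y (t *\<^sub>R \<omega>)) has_vector_derivative \<epsilon> * (of_real (ft ?z) +
      ?dW)) (at t)"
    unfolding y_def
    by (intro has_vector_derivative_add bounded_linear.has_vector_derivative[OF bounded_linear_mult_right]
      has_vector_derivative_of_real dF1 dW)
  have dv: "((\<lambda>t. v (t *\<^sub>R \<omega>)) has_vector_derivative - (of_real a * \<epsilon> * of_real (F1 ?z)) - (Q - 1 / \<epsilon> * q ?z)) (at t)"
    unfolding v_def
    by (intro has_vector_derivative_diff has_vector_derivative_minus bounded_linear.has_vector_derivative[OF bounded_linear_mult_right]
      has_vector_derivative_of_real dF2 dq)
  \<comment> \<open>the nonlinear terms cancel in \<open>\<epsilon>\<^sup>2 P + Q = - (1 - a \<epsilon>\<^sup>2) S\<close>\<close>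
  have PQ: "P = of_real a * S - H" "Q = \<epsilon>\<^sup>2 * H - S" by (simp_all add: P_def Q_def S_def H_def slow_src_def fast_src_def)
  have S: "S = of_real a * of_real (F2 ?z) + of_real (ft ?z) - of_real a * \<epsilon> * W \<epsilon> ?z" by (simp add: S_def src_def)
  have Wd: "W \<epsilon> ?z * (1 - of_real a * \<epsilon>\<^sup>2) = \<epsilon>\<^sup>2 * p ?z + q ?z" using den by (simp add: Weq)
  have "(\<epsilon> * (of_real (ft ?z) + ?dW))
      * (1 - of_real a * \<epsilon>\<^sup>2) = v ?z * (1 - of_real a * \<epsilon>\<^sup>2)"
  proof -
    have "(\<epsilon> * (of_real (ft ?z) + ?dW))
      * (1 - of_real a * \<epsilon>\<^sup>2)
      = \<epsilon> * (of_real (ft ?z) * (1 - of_real a * \<epsilon>\<^sup>2) + (\<epsilon>\<^sup>2 * (P - of_real a * \<epsilon> * p ?z) + (Q - 1 / \<epsilon> * q ?z)))"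
      using den by (simp add: distrib_right mult.assoc)
    also have "\<dots> = \<epsilon> * (of_real (ft ?z) * (1 - of_real a * \<epsilon>\<^sup>2) + (- (1 - of_real a * \<epsilon>\<^sup>2) * (of_real a * of_real (F2 ?z) + of_real (ft ?z)) + of_real a * \<epsilon> * (W \<epsilon> ?z * (1 - of_real a * \<epsilon>\<^sup>2))
         - of_real a * \<epsilon> * (\<epsilon>\<^sup>2 * p ?z) - 1 / \<epsilon> * q ?z))"
      unfolding PQ S by (simp add: algebra_simps)
    also have "\<dots> = - of_real a * \<epsilon> * of_real (F2 ?z) * (1 - of_real a * \<epsilon>\<^sup>2) - (\<epsilon> * (1 / \<epsilon>) - of_real a * \<epsilon>\<^sup>2) * q ?z"
      unfolding Wd by (simp add: algebra_simps power2_eq_square)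
    also have "\<dots> = v ?z * (1 - of_real a * \<epsilon>\<^sup>2)"
      using d(5) by (simp add: v_def algebra_simps)
    finally show ?thesis .
  qed
  hence "\<epsilon> * (of_real (ft ?z) + ?dW) = v ?z"
    using den by simp
  thus "((\<lambda>t. y (t *\<^sub>R \<omega>)) has_vector_derivative v (t *\<^sub>R \<omega>)) (at t)" using dy by simp
  have H: "y ?z * y ?z * k (y ?z) = \<epsilon>\<^sup>2 * H" by (simp add: y_def H_def nonlin_def power2_eq_square mult_ac)
  have "of_real a * y ?z = of_real a * \<epsilon> * (of_real (F1 ?z) + W \<epsilon> ?z)" by (simp add: y_def)
  have "v ?z / \<epsilon> = - of_real a * of_real (F2 ?z) - 1 / \<epsilon> * q ?z"
    using d(5) by (simp add: v_def diff_divide_distrib)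
  hence "- (of_real a * \<epsilon> * of_real (F1 ?z)) - (Q - 1 / \<epsilon> * q ?z) =
      of_real (ft ?z) - v ?z / \<epsilon> - (of_real a * y ?z + y ?z * y ?z * k (y ?z))"
    unfolding H PQ S \<open>of_real a * y ?z = _\<close> \<open>v ?z / \<epsilon> = _\<close> by (simp add: algebra_simps)
  thus "((\<lambda>t. v (t *\<^sub>R \<omega>)) has_vector_derivative
      of_real (ft (t *\<^sub>R \<omega>)) - v (t *\<^sub>R \<omega>) / \<epsilon> - (of_real a * y (t *\<^sub>R \<omega>) + y (t *\<^sub>R \<omega>) * y (t *\<^sub>R \<omega>) * k (y (t *\<^sub>R \<omega>)))) (at t)"
    using dv by simp
qed

lemma real_response:
  assumes dF1: "\<And>t. ((\<lambda>t. F1 (t *\<^sub>R \<omega>)) has_real_derivative ft (t *\<^sub>R \<omega>)) (at t)"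
    and dF2: "\<And>t. ((\<lambda>t. F2 (t *\<^sub>R \<omega>)) has_real_derivative F1 (t *\<^sub>R \<omega>)) (at t)"
    and g: "\<And>x. \<bar>x\<bar> < r \<Longrightarrow> complex_of_real (g (c0 + x) - g c0 - a * x) = of_real x * of_real x * k (of_real x)"
  shows "\<exists>xc X v K. (\<forall>\<psi>. (\<lambda>\<epsilon>. xc \<epsilon> \<psi>) holomorphic_on D) \<and>
     (\<forall>\<gamma>>1 / (2 * R). \<gamma> > 0 \<and> continuous_on UNIV (X \<gamma>) \<and> (\<forall>\<psi> i. X \<gamma> (\<psi> + axis i (2 * pi)) = X \<gamma> \<psi>) \<and>
        (\<forall>\<psi>. xc (of_real (1 / \<gamma>)) \<psi> = of_real (X \<gamma> \<psi>)) \<and>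
        (\<forall>\<psi>. \<bar>X \<gamma> \<psi> - c0\<bar> \<le> K / \<gamma>) \<and> (\<forall>t. \<bar>v \<gamma> t\<bar> \<le> K / \<gamma>) \<and>
        trajectory_on UNIV \<gamma> g (\<lambda>t. ft (t *\<^sub>R \<omega>) + g c0) (\<lambda>t. X \<gamma> (t *\<^sub>R \<omega>)) (v \<gamma>))"
proof -
  obtain W where W: "admissible W" "\<And>\<epsilon> \<psi>. \<epsilon> \<in> D \<Longrightarrow> step W \<epsilon> \<psi> = W \<epsilon> \<psi>" using corrector_exists by blast
  define xc where "xc \<epsilon> \<psi> = of_real c0 + \<epsilon> * (of_real (F1 \<psi>) + W \<epsilon> \<psi>)" for \<epsilon> \<psi>
  define X where "X \<gamma> \<psi> = Re (xc (of_real (1 / \<gamma>)) \<psi>)" for \<gamma> \<psi>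
  define v where "v \<gamma> t = Re (- (of_real a * of_real (1 / \<gamma>) * of_real (F2 (t *\<^sub>R \<omega>)))
      - resolvent (1 / of_real (1 / \<gamma>)) \<omega> (\<lambda>\<psi>. fast_src (of_real (1 / \<gamma>)) \<psi> (W (of_real (1 / \<gamma>)) \<psi>)) (t *\<^sub>R \<omega>))" for \<gamma> t
  define K where "K = V + \<bar>a\<bar> * B + M"
  have ph: "param_hull D W" and W1: "\<And>\<epsilon> \<psi>. \<epsilon> \<in> D \<Longrightarrow> norm (W \<epsilon> \<psi>) \<le> 1" using W(1) by (auto simp: admissible_def)
  have "(\<lambda>\<epsilon>. xc \<epsilon> \<psi>) holomorphic_on D" for \<psi>
    unfolding xc_def using ph by (intro holomorphic_intros) (simp add: param_hull_def)
  moreover have "\<gamma> > 0 \<and> continuous_on UNIV (X \<gamma>) \<and> (\<forall>\<psi> i. X \<gamma> (\<psi> + axis i (2 * pi)) = X \<gamma> \<psi>) \<and>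
        (\<forall>\<psi>. xc (of_real (1 / \<gamma>)) \<psi> = of_real (X \<gamma> \<psi>)) \<and>
        (\<forall>\<psi>. \<bar>X \<gamma> \<psi> - c0\<bar> \<le> K / \<gamma>) \<and> (\<forall>t. \<bar>v \<gamma> t\<bar> \<le> K / \<gamma>) \<and>
        trajectory_on UNIV \<gamma> g (\<lambda>t. ft (t *\<^sub>R \<omega>) + g c0) (\<lambda>t. X \<gamma> (t *\<^sub>R \<omega>)) (v \<gamma>)"
    if gam: "\<gamma> > 1 / (2 * R)" for \<gamma>
  proof -
    have pos: "\<gamma> > 0" using gam R(1) by (intro order_less_trans[OF _ gam]) simp
    define \<epsilon> where "\<epsilon> = complex_of_real (1 / \<gamma>)"
    have lt: "1 / \<gamma> < 2 * R" using gam pos R(1) by (simp add: field_simps)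
    have e: "\<epsilon> \<in> D"
      using lt pos by (simp add: \<epsilon>_def D_def dist_real_def dist_of_real del: of_real_divide) (simp add: abs_if)
    have er: "\<epsilon> \<in> D \<inter> \<real>" using e by (simp add: \<epsilon>_def)
    have ne: "norm \<epsilon> = 1 / \<gamma>" using pos unfolding \<epsilon>_def norm_of_real by simp
    have Wr: "W \<epsilon> \<psi> \<in> \<real>" for \<psi> using ph er by (auto simp: param_hull_def)
    have xr: "xc \<epsilon> \<psi> \<in> \<real>" for \<psi>
      unfolding xc_def using er by (intro Reals_add Reals_mult Wr) auto
    hence Xc: "xc \<epsilon> \<psi> = of_real (X \<gamma> \<psi>)" for \<psi>
      unfolding X_def \<epsilon>_def[symmetric] by (simp add: of_real_Re)
    have cW: "continuous_on UNIV (W \<epsilon>)" and pW: "\<And>\<psi> i. W \<epsilon> (\<psi> + axis i (2 * pi)) = W \<epsilon> \<psi>"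
      using ph e by (auto simp: param_hull_def)
    have 1: "continuous_on UNIV (X \<gamma>)"
      unfolding X_def xc_def \<epsilon>_def[symmetric] using F1(1)
      by (intro continuous_intros cW) (simp add: torus_fun_def)
    have 2: "X \<gamma> (\<psi> + axis i (2 * pi)) = X \<gamma> \<psi>" for \<psi> i
      unfolding X_def xc_def \<epsilon>_def[symmetric] using F1(1) pW by (simp add: torus_fun_def)
    define y where "y \<psi> = \<epsilon> * (of_real (F1 \<psi>) + W \<epsilon> \<psi>)" for \<psi>
    have yX: "y \<psi> = of_real (X \<gamma> \<psi> - c0)" for \<psi> using Xc[of \<psi>] by (simp add: xc_def y_def algebra_simps)
    have KV: "V \<le> K" "\<bar>a\<bar> * B + M \<le> K" using const_bounds B by (auto simp: K_def)
    have "norm (y \<psi>) \<le> 1 / \<gamma> * V" for \<psi>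
      unfolding y_def norm_mult ne using pos by (intro mult_left_mono v_bound W1 e) auto
    hence 3: "\<bar>X \<gamma> \<psi> - c0\<bar> \<le> K / \<gamma>" for \<psi>
      using yX[of \<psi>] KV pos order_trans[OF _ divide_right_mono[OF KV(1), of \<gamma>]] by (metis norm_of_real mult.left_neutral times_divide_eq_left less_imp_le)
    have small: "\<bar>X \<gamma> \<psi> - c0\<bar> < r" for \<psi>
    proof -
      have "norm (y \<psi>) \<le> r / 2" unfolding y_def by (intro ev_bound e W1)
      thus ?thesis using r unfolding yX norm_of_real by linarith
    qed
    note cr = complex_response[OF dF1 dF2 W e, folded y_def]
    let ?q = "resolvent (1 / \<epsilon>) \<omega> (\<lambda>\<psi>. fast_src \<epsilon> \<psi> (W \<epsilon> \<psi>))"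
    have v: "v \<gamma> t = Re (- (of_real a * \<epsilon> * of_real (F2 (t *\<^sub>R \<omega>))) - ?q (t *\<^sub>R \<omega>))" for t
      unfolding v_def \<epsilon>_def ..
    have 4: "\<bar>v \<gamma> t\<bar> \<le> K / \<gamma>" for t
    proof -
      have "Re (1 / \<epsilon>) = \<gamma>" by (simp add: \<epsilon>_def Re_divide power2_eq_square)
      hence q: "norm (?q (t *\<^sub>R \<omega>)) \<le> M / \<gamma>" using cr(3) by metis
      have "norm (of_real a * \<epsilon> * of_real (F2 (t *\<^sub>R \<omega>))) \<le> \<bar>a\<bar> * (1 / \<gamma>) * B"
        unfolding norm_mult ne using F2(2) pos by (intro mult_mono) auto
      moreover have "\<bar>v \<gamma> t\<bar> \<le> norm (- (of_real a * \<epsilon> * of_real (F2 (t *\<^sub>R \<omega>))) - ?q (t *\<^sub>R \<omega>))"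
        unfolding v by (rule abs_Re_le_cmod)
      moreover have "\<dots> \<le> norm (of_real a * \<epsilon> * of_real (F2 (t *\<^sub>R \<omega>))) + norm (?q (t *\<^sub>R \<omega>))"
        using norm_triangle_ineq4[of "- (of_real a * \<epsilon> * of_real (F2 (t *\<^sub>R \<omega>)))" "?q (t *\<^sub>R \<omega>)"]
        by (simp only: norm_minus_cancel)
      ultimately have "\<bar>v \<gamma> t\<bar> \<le> (\<bar>a\<bar> * B + M) / \<gamma>" using q by (simp add: add_divide_distrib)
      also have "\<dots> \<le> K / \<gamma>" using KV pos by (intro divide_right_mono) auto
      finally show ?thesis .
    qed
    have "((\<lambda>t. X \<gamma> (t *\<^sub>R \<omega>)) has_real_derivative v \<gamma> t) (at t)" for t
    proof -
      have "((\<lambda>t. Re (of_real c0 + y (t *\<^sub>R \<omega>))) has_vector_derivative Re (0 + (- (of_real a * \<epsilon> * of_real (F2 (t *\<^sub>R \<omega>))) - ?q (t *\<^sub>R \<omega>)))) (at t)"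
        by (intro bounded_linear.has_vector_derivative[OF bounded_linear_Re] has_vector_derivative_add has_vector_derivative_const cr(1))
      moreover have "Re (of_real c0 + y (t *\<^sub>R \<omega>)) = X \<gamma> (t *\<^sub>R \<omega>)" for t by (simp add: yX)
      ultimately show ?thesis unfolding has_real_derivative_iff_has_vector_derivative by (simp add: v)
    qed
    moreover have "(v \<gamma> has_real_derivative (ft (t *\<^sub>R \<omega>) + g c0 - \<gamma> * v \<gamma> t - g (X \<gamma> (t *\<^sub>R \<omega>)))) (at t)" for t
    proof -
      let ?v = "- (of_real a * \<epsilon> * of_real (F2 (t *\<^sub>R \<omega>))) - ?q (t *\<^sub>R \<omega>)" and ?y = "y (t *\<^sub>R \<omega>)"
      have "complex_of_real (g (X \<gamma> (t *\<^sub>R \<omega>)) - g c0 - a * (X \<gamma> (t *\<^sub>R \<omega>) - c0)) = ?y * ?y * k ?y"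
        using g[OF small, of "t *\<^sub>R \<omega>"] unfolding yX by simp
      hence "of_real a * ?y + ?y * ?y * k ?y = complex_of_real (g (X \<gamma> (t *\<^sub>R \<omega>)) - g c0)"
        unfolding yX by (metis (no_types, lifting) add.commute diff_add_cancel of_real_add of_real_mult)
      hence nl: "Re (of_real a * ?y + ?y * ?y * k ?y) = g (X \<gamma> (t *\<^sub>R \<omega>)) - g c0" by simp
      have vd: "Re (?v / \<epsilon>) = \<gamma> * v \<gamma> t" unfolding v
      proof -
        have "?v / \<epsilon> = of_real \<gamma> * ?v" by (simp add: \<epsilon>_def)
        thus "Re (?v / \<epsilon>) = \<gamma> * Re ?v" by simp
      qed
      have "(v \<gamma> has_vector_derivative Re (of_real (ft (t *\<^sub>R \<omega>)) - ?v / \<epsilon> - (of_real a * ?y + ?y * ?y * k ?y))) (at t)"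
        using bounded_linear.has_vector_derivative[OF bounded_linear_Re cr(2)] unfolding v[abs_def] .
      also have "Re (of_real (ft (t *\<^sub>R \<omega>)) - ?v / \<epsilon> - (of_real a * ?y + ?y * ?y * k ?y))
         = ft (t *\<^sub>R \<omega>) - Re (?v / \<epsilon>) - Re (of_real a * ?y + ?y * ?y * k ?y)" by (simp only: minus_complex.sel Re_complex_of_real)
      finally show ?thesis unfolding nl vd has_real_derivative_iff_has_vector_derivative by (simp add: algebra_simps)
    qed
    ultimately have "trajectory_on UNIV \<gamma> g (\<lambda>t. ft (t *\<^sub>R \<omega>) + g c0) (\<lambda>t. X \<gamma> (t *\<^sub>R \<omega>)) (v \<gamma>)"
      by (simp add: trajectory_on_def)
    thus ?thesis using pos 1 2 Xc 3 4 unfolding \<epsilon>_def by blast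
  qed
  ultimately show ?thesis by (intro exI[of _ xc] exI[of _ X] exI[of _ v] exI[of _ K]) blast
qed

end

section \<open>Uniqueness of bounded solutions for large damping\<close>

text \<open>The function \<open>exp (\<mu> t) (q t - E / \<mu>)\<close> is nonincreasing, and it tends to \<open>0\<close> at minus infinity because
  \<open>q\<close> is bounded; so it is never positive.\<close>

lemma bounded_solution_upper:
  fixes q e :: "real \<Rightarrow> real"
  assumes q: "\<And>t. (q has_real_derivative e t - \<mu> * q t) (at t)" and C: "\<And>t. \<bar>q t\<bar> \<le> C"
    and E: "\<And>t. e t \<le> E" and mu: "\<mu> > 0"
  shows "q t \<le> E / \<mu>"
proof -
  define u where "u \<tau> = exp (\<mu> * \<tau>) * (q \<tau> - E / \<mu>)" for \<tau>
  have du: "(u has_real_derivative exp (\<mu> * \<tau>) * (e \<tau> - E)) (at \<tau>)" for \<tau>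
    unfolding u_def using mu by (auto intro!: derivative_eq_intros q simp: algebra_simps)
  have mono: "u t \<le> u s" if "s \<le> t" for s
    using that
  proof (rule DERIV_nonpos_imp_nonincreasing)
    show "\<exists>y. (u has_real_derivative y) (at x) \<and> y \<le> 0" for x
      using du[of x] E[of x] by (intro exI[of _ "exp (\<mu> * x) * (e x - E)"]) (auto simp: mult_le_0_iff)
  qed
  have "u t \<le> 0"
  proof (rule tendsto_lowerbound)
    have "filterlim (\<lambda>s. \<mu> * s) at_bot at_bot"
      using mu by (subst filterlim_at_bot_mirror) (auto intro!: filterlim_tendsto_pos_mult_at_top[OF tendsto_const] filterlim_ident simp: filterlim_uminus_at_bot)
    hence "((\<lambda>s. exp (\<mu> * s)) \<longlongrightarrow> 0) at_bot" by (rule filterlim_compose[OF exp_at_bot])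
    from tendsto_mult_left[OF this, of "C + \<bar>E / \<mu>\<bar>"]
    show "((\<lambda>s. (C + \<bar>E / \<mu>\<bar>) * exp (\<mu> * s)) \<longlongrightarrow> 0) at_bot" by simp
    show "\<forall>\<^sub>F s in at_bot. u t \<le> (C + \<bar>E / \<mu>\<bar>) * exp (\<mu> * s)"
    proof (rule eventually_mono[OF eventually_le_at_bot[of t]])
      fix s assume "s \<le> t"
      have "q s - E / \<mu> \<le> C + \<bar>E / \<mu>\<bar>" using C[of s] by linarith
      hence "u s \<le> (C + \<bar>E / \<mu>\<bar>) * exp (\<mu> * s)" unfolding u_def by (simp add: mult.commute mult_right_mono)
      with mono[OF \<open>s \<le> t\<close>] show "u t \<le> (C + \<bar>E / \<mu>\<bar>) * exp (\<mu> * s)" by linarith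
    qed
  qed simp
  thus ?thesis by (simp add: u_def mult_le_0_iff)
qed

text \<open>Both signs of \<open>\<mu>\<close> occur, since the slow rate is \<open>a / \<gamma>\<close>; for negative \<open>\<mu>\<close> time is reversed.\<close>

lemma bounded_solution_bound:
  fixes q e :: "real \<Rightarrow> real"
  assumes q: "\<And>t. (q has_real_derivative e t - \<mu> * q t) (at t)" and C: "\<And>t. \<bar>q t\<bar> \<le> C"
    and E: "\<And>t. \<bar>e t\<bar> \<le> E" and mu: "\<mu> \<noteq> 0"
  shows "\<bar>q t\<bar> \<le> E / \<bar>\<mu>\<bar>"
proof -
  have pos: "\<bar>q t\<bar> \<le> E / \<mu>"
    if q: "\<And>t. (q has_real_derivative e t - \<mu> * q t) (at t)" and C: "\<And>t. \<bar>q t\<bar> \<le> C"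
    and E: "\<And>t. \<bar>e t\<bar> \<le> E" and mu: "\<mu> > 0" for q e :: "real \<Rightarrow> real" and \<mu> t
  proof -
    have "q t \<le> E / \<mu>" by (rule bounded_solution_upper[OF q C _ mu]) (use E abs_le_D1 in blast)
    moreover have "- q t \<le> E / \<mu>"
    proof (rule bounded_solution_upper[where q = "\<lambda>t. - q t" and e = "\<lambda>t. - e t" and C = C])
      show "((\<lambda>t. - q t) has_real_derivative - e t - \<mu> * - q t) (at t)" for t
        by (auto intro!: derivative_eq_intros q)
      show "- e t \<le> E" for t using E[of t] by linarith
    qed (use C mu in auto)
    ultimately show ?thesis by linarith
  qed
  show ?thesis
  proof (cases "\<mu> > 0")
    case True
    thus ?thesis using pos[OF q C E True] by simp
  next
    case False
    have "\<bar>q (- (- t))\<bar> \<le> E / (- \<mu>)"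
    proof (rule pos[where q = "\<lambda>t. q (- t)" and e = "\<lambda>t. - e (- t)"])
      show "((\<lambda>t. q (- t)) has_real_derivative - e (- t) - - \<mu> * q (- t)) (at t)" for t
        using DERIV_chain2[where f = q and g = uminus and x = t and s = UNIV, OF q[of "- t"] DERIV_minus[OF DERIV_ident]]
        by (simp add: algebra_simps)
    qed (use C E mu False in auto)
    thus ?thesis using False by simp
  qed
qed

text \<open>Some time in the preceding unit interval has a velocity of at most \<open>2 M\<close>, by the mean value theorem,
  and from there on \<open>v + \<gamma> z\<close> changes at a bounded rate.\<close>

lemma damped_velocity_bounded:
  fixes z v \<phi> :: "real \<Rightarrow> real"
  assumes z: "\<And>t. (z has_real_derivative v t) (at t)" and v: "\<And>t. (v has_real_derivative \<phi> t - \<gamma> * v t) (at t)"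
    and M: "\<And>t. \<bar>z t\<bar> \<le> M" and B: "\<And>t. \<bar>\<phi> t\<bar> \<le> B" and gam: "\<gamma> > 0"
  shows "\<bar>v t\<bar> \<le> 2 * M + B + 2 * \<gamma> * M"
proof -
  have "\<exists>s>t - 1. s < t \<and> z t - z (t - 1) = (t - (t - 1)) * v s"
    by (rule MVT2) (use z in auto)
  then obtain s where s: "t - 1 < s" "s < t" "z t - z (t - 1) = v s" by auto
  have vs: "\<bar>v s\<bar> \<le> 2 * M" using s(3) M[of t] M[of "t - 1"] by linarith
  define y where "y \<tau> = v \<tau> + \<gamma> * z \<tau>" for \<tau>
  have dy: "(y has_real_derivative \<phi> \<tau>) (at \<tau>)" for \<tau>
    unfolding y_def by (auto intro!: derivative_eq_intros v z)
  have "\<exists>w>s. w < t \<and> y t - y s = (t - s) * \<phi> w"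
    by (rule MVT2) (use s dy in auto)
  then obtain w where w: "y t - y s = (t - s) * \<phi> w" by auto
  have "\<bar>y t - y s\<bar> \<le> 1 * B" unfolding w abs_mult using s B[of w] by (intro mult_mono) auto
  moreover have "\<bar>\<gamma> * z t\<bar> \<le> \<gamma> * M" "\<bar>\<gamma> * z s\<bar> \<le> \<gamma> * M" using M gam by (auto simp: abs_mult)
  ultimately show ?thesis using vs unfolding y_def by linarith
qed

text \<open>The difference \<open>z\<close> is split into the fast variable \<open>v = z'\<close>, of rate \<open>\<gamma>\<close>, and the slow variable
  \<open>p = z + v / \<gamma>\<close>, of rate \<open>a / \<gamma>\<close>. If \<open>\<bar>z\<bar> \<le> Z\<close>, then \<open>bounded_solution_bound\<close> applied to \<open>v\<close> and then
  to \<open>p\<close> improves this to \<open>\<bar>z\<bar> \<le> 5/8 Z\<close>, for either sign of \<open>a\<close>; so the supremum of \<open>\<bar>z\<bar>\<close> is \<open>0\<close>.\<close>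

lemma bounded_trajectories_coincide:
  assumes x: "trajectory_on UNIV \<gamma> g h x u" and y: "trajectory_on UNIV \<gamma> g h y w"
    and near: "\<And>t. \<bar>x t - c0\<bar> \<le> \<rho>" "\<And>t. \<bar>y t - c0\<bar> \<le> \<rho>"
    and lin: "\<And>x y. \<bar>x - c0\<bar> \<le> \<rho> \<Longrightarrow> \<bar>y - c0\<bar> \<le> \<rho> \<Longrightarrow> \<bar>g x - g y - a * (x - y)\<bar> \<le> \<bar>a\<bar> / 8 * \<bar>x - y\<bar>"
    and a: "a \<noteq> 0" and gam: "\<gamma> > 0" "\<gamma>\<^sup>2 \<ge> 8 * \<bar>a\<bar>"
  shows "x = y"
proof -
  define z v \<phi> where "z t = x t - y t" and "v t = u t - w t" and "\<phi> t = - (g (x t) - g (y t))" for t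
  have dz: "(z has_real_derivative v t) (at t)" for t
    using x y unfolding z_def v_def trajectory_on_def by (auto intro!: derivative_intros)
  have dv: "(v has_real_derivative \<phi> t - \<gamma> * v t) (at t)" for t
    using x y unfolding v_def \<phi>_def trajectory_on_def
    by (auto intro!: derivative_eq_intros simp: algebra_simps)
  have improve: "\<bar>z t\<bar> \<le> 5 / 8 * Z" if Z: "\<And>t. \<bar>z t\<bar> \<le> Z" for Z t
  proof -
    have Z0: "Z \<ge> 0" using Z[of 0] by linarith
    define \<delta> where "\<delta> t = g (x t) - g (y t) - a * z t" for t
    have \<delta>: "\<bar>\<delta> t\<bar> \<le> \<bar>a\<bar> / 8 * Z" for t
    proof -
      have "\<bar>\<delta> t\<bar> \<le> \<bar>a\<bar> / 8 * \<bar>z t\<bar>" using lin[OF near, of t t] by (simp add: \<delta>_def z_def)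
      also have "\<dots> \<le> \<bar>a\<bar> / 8 * Z" using Z by (intro mult_left_mono) auto
      finally show ?thesis .
    qed
    have \<phi>: "\<bar>\<phi> t\<bar> \<le> 2 * \<bar>a\<bar> * Z" for t
    proof -
      have "\<phi> t = - \<delta> t - a * z t" by (simp add: \<phi>_def \<delta>_def)
      moreover have "\<bar>a * z t\<bar> \<le> \<bar>a\<bar> * Z" using Z by (simp add: abs_mult mult_left_mono)
      moreover have "0 \<le> \<bar>a\<bar> * Z" using Z0 by simp
      ultimately show ?thesis using \<delta>[of t] by linarith
    qed
    have vb: "\<bar>v t\<bar> \<le> 2 * \<bar>a\<bar> * Z / \<gamma>" for t
      using bounded_solution_bound[OF dv damped_velocity_bounded[OF dz dv Z \<phi> gam(1)] \<phi>, of t] gam by simp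
    define p where "p t = z t + v t / \<gamma>" for t
    have dp: "(p has_real_derivative (a * v t / \<gamma>\<^sup>2 - \<delta> t / \<gamma>) - a / \<gamma> * p t) (at t)" for t
      unfolding p_def using gam
      by (auto intro!: derivative_eq_intros dz dv simp: \<phi>_def \<delta>_def field_simps power2_eq_square)
    have vg: "\<bar>v t / \<gamma>\<bar> \<le> Z / 4" for t
    proof -
      have "\<bar>v t / \<gamma>\<bar> \<le> 2 * \<bar>a\<bar> * Z / \<gamma>\<^sup>2"
        using vb[of t] gam by (simp add: abs_divide divide_le_eq field_simps power2_eq_square)
      also have "\<dots> \<le> (\<gamma>\<^sup>2 / 4) * Z / \<gamma>\<^sup>2" using gam Z0 by (intro divide_right_mono mult_right_mono) auto
      also have "\<dots> = Z / 4" using gam by simp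
      finally show ?thesis .
    qed
    have pC: "\<bar>p t\<bar> \<le> Z + Z / 4" for t unfolding p_def using Z[of t] vg[of t] by linarith
    have "\<bar>a * v t / \<gamma>\<^sup>2 - \<delta> t / \<gamma>\<bar> \<le> 3 / 8 * \<bar>a\<bar> * Z / \<gamma>" for t
    proof -
      have "\<bar>a * v t / \<gamma>\<^sup>2\<bar> = \<bar>a\<bar> * \<bar>v t / \<gamma>\<bar> / \<gamma>" using gam by (simp add: abs_mult power2_eq_square)
      also have "\<dots> \<le> \<bar>a\<bar> * (Z / 4) / \<gamma>" using vg[of t] gam by (intro divide_right_mono mult_left_mono) auto
      finally have "\<bar>a * v t / \<gamma>\<^sup>2\<bar> \<le> 2 / 8 * \<bar>a\<bar> * Z / \<gamma>" by simp
      moreover have "\<bar>\<delta> t / \<gamma>\<bar> \<le> 1 / 8 * \<bar>a\<bar> * Z / \<gamma>" using divide_right_mono[OF \<delta>[of t], of \<gamma>] gam by (simp add: abs_divide)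
      ultimately have "\<bar>a * v t / \<gamma>\<^sup>2 - \<delta> t / \<gamma>\<bar> \<le> 2 / 8 * \<bar>a\<bar> * Z / \<gamma> + 1 / 8 * \<bar>a\<bar> * Z / \<gamma>" by linarith
      thus ?thesis by (simp add: mult_ac)
    qed
    from bounded_solution_bound[OF dp pC this, of t]
    have "\<bar>p t\<bar> \<le> 3 / 8 * Z" using a gam by (simp add: field_simps abs_mult)
    thus ?thesis using vg[of t] unfolding p_def by linarith
  qed
  have bdd: "bdd_above (range (\<lambda>t. \<bar>z t\<bar>))"
  proof (rule bdd_aboveI2)
    show "\<bar>z t\<bar> \<le> 2 * \<rho>" for t using near[of t] unfolding z_def by linarith
  qed
  define Z where "Z = (SUP t. \<bar>z t\<bar>)"
  have ZU: "\<bar>z t\<bar> \<le> Z" for t unfolding Z_def by (rule cSUP_upper[OF _ bdd]) simp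
  have "Z \<le> 5 / 8 * Z" unfolding Z_def by (rule cSUP_least) (use improve[OF ZU] in \<open>auto simp: Z_def\<close>)
  hence "Z \<le> 0" by simp
  hence "z t = 0" for t using ZU[of t] by linarith
  thus ?thesis by (auto simp: z_def)
qed

section \<open>The nonlinearity near the equilibrium\<close>

text \<open>The coefficients of the remainder \<open>k\<close> are those of \<open>g\<close> shifted by two, so its power series converges
  on the same, now complex, disk.\<close>

lemma analytic_quadratic_remainder:
  assumes "real_analytic_on g UNIV"
  shows "\<exists>r>0. \<exists>k. k holomorphic_on ball 0 r \<and> (\<forall>z\<in>ball 0 r \<inter> \<real>. k z \<in> \<real>) \<and>
    (\<forall>x. \<bar>x\<bar> < r \<longrightarrow> complex_of_real (g (c0 + x) - g c0 - deriv g c0 * x) = of_real x * of_real x * k (of_real x))"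
proof -
  obtain r b where r: "r > 0" and b: "\<And>y. \<bar>y - c0\<bar> < r \<Longrightarrow> (\<lambda>n. b n * (y - c0) ^ n) sums g y"
    using assms unfolding real_analytic_on_def by blast
  have b': "(\<lambda>n. b n * x ^ n) sums g (c0 + x)" if "\<bar>x\<bar> < r" for x using b[of "c0 + x"] that by simp
  have b0: "b 0 = g c0" using b'[of 0] r powser_sums_zero_iff[of b] by (auto simp: sums_unique2)
  have b1: "b 1 = deriv g c0"
  proof -
    have "((\<lambda>x. \<Sum>n. b n * x ^ n) has_real_derivative (\<Sum>n. diffs b n * 0 ^ n)) (at 0)"
      by (rule termdiffs_strong[of _ "r / 2"]) (use b'[of "r / 2"] r in \<open>auto simp: sums_iff\<close>)
    hence "((\<lambda>x. \<Sum>n. b n * x ^ n) has_real_derivative b 1) (at 0)"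
      by (simp add: diffs_def)
    hence "((\<lambda>x. g (c0 + x)) has_real_derivative b 1) (at 0)"
      by (rule has_field_derivative_transform_within_open[of _ _ _ "ball 0 r"])
         (use b' r in \<open>auto simp: sums_iff\<close>)
    hence "(g has_real_derivative b 1) (at c0)"
      using DERIV_shift[of g "b 1" 0 c0] by (simp add: add.commute)
    thus ?thesis by (simp add: DERIV_imp_deriv)
  qed
  define c where "c n = complex_of_real (b (n + 2))" for n
  define k where "k z = (\<Sum>n. c n * z ^ n)" for z
  have csum: "summable (\<lambda>n. c n * z ^ n)" if "norm z < r" for z
  proof -
    define x where "x = (norm z + r) / 2"
    have x: "norm z < x" "x < r" using that by (auto simp: x_def)
    have "\<bar>x\<bar> < r" using x norm_ge_zero[of z] by linarith
    hence "summable (\<lambda>n. b n * x ^ n)" using b'[of x] by (auto simp: sums_iff)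
    hence "summable (\<lambda>n. b (n + 2) * x ^ (n + 2))" by (rule summable_ignore_initial_segment)
    hence "summable (\<lambda>n. b (n + 2) * x ^ (n + 2) * (1 / x\<^sup>2))" by (rule summable_mult2)
    moreover have "b (n + 2) * x ^ (n + 2) * (1 / x\<^sup>2) = b (n + 2) * x ^ n" for n
      using order_le_less_trans[OF norm_ge_zero x(1)] by (simp add: power_add power2_eq_square)
    ultimately have "summable (\<lambda>n. b (n + 2) * x ^ n)" by (simp only:)
    hence "summable (\<lambda>n. complex_of_real (b (n + 2) * x ^ n))" by (rule summable_of_real)
    hence s: "summable (\<lambda>n. c n * of_real x ^ n)" by (simp add: c_def)
    show ?thesis by (rule powser_inside[OF s]) (use x norm_ge_zero[of z] in auto)
  qed
  have "k holomorphic_on ball 0 r"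
    by (rule power_series_holomorphic[of _ _ c]) (auto simp: k_def intro!: summable_sums csum)
  moreover have "k z \<in> \<real>" if "z \<in> ball 0 r \<inter> \<real>" for z
  proof -
    have lim: "(\<lambda>n. \<Sum>i<n. c i * z ^ i) \<longlonglongrightarrow> k z"
      using summable_LIMSEQ[OF csum] that by (simp add: k_def)
    have mem: "(\<Sum>i<n. c i * z ^ i) \<in> \<real>" for n
      using that by (auto intro!: sum_in_Reals Reals_mult Reals_power simp: c_def)
    show ?thesis by (rule closed_sequentially[OF closed_complex_Reals mem lim])
  qed
  moreover have "complex_of_real (g (c0 + x) - g c0 - deriv g c0 * x) = of_real x * of_real x * k (of_real x)" if "\<bar>x\<bar> < r" for x
  proof -
    have "(\<lambda>n. b (n + 2) * x ^ (n + 2)) sums (g (c0 + x) - (\<Sum>i<2. b i * x ^ i))"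
      by (rule sums_split_initial_segment[OF b'[OF that]])
    hence "(\<lambda>n. b (n + 2) * x ^ (n + 2)) sums (g (c0 + x) - g c0 - deriv g c0 * x)"
      using b0 b1 by (simp add: numeral_2_eq_2 algebra_simps)
    hence "(\<lambda>n. complex_of_real (b (n + 2) * x ^ (n + 2))) sums complex_of_real (g (c0 + x) - g c0 - deriv g c0 * x)"
      by (simp only: sums_of_real_iff)
    moreover have "(\<lambda>n. of_real x * of_real x * (c n * of_real x ^ n)) sums (of_real x * of_real x * k (of_real x))"
      unfolding k_def using that by (intro sums_mult summable_sums csum) simp
    moreover have "complex_of_real (b (n + 2) * x ^ (n + 2)) = of_real x * of_real x * (c n * of_real x ^ n)" for n
      by (simp add: c_def power_add power2_eq_square mult_ac)
    ultimately show ?thesis by (simp only: sums_unique2)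
  qed
  ultimately show ?thesis using r by blast
qed

lemma holomorphic_bounded_lipschitz:
  assumes "k holomorphic_on ball 0 r" "r > (0::real)"
  shows "\<exists>K\<ge>0. \<exists>L\<ge>0. (\<forall>z. norm z \<le> r / 2 \<longrightarrow> norm (k z) \<le> K) \<and>
     (\<forall>z z'. norm z \<le> r / 2 \<longrightarrow> norm z' \<le> r / 2 \<longrightarrow> norm (k z - k z') \<le> L * norm (z - z'))"
proof -
  have sub: "cball (0::complex) (r / 2) \<subseteq> ball 0 r" using assms(2) by auto
  have bd: "\<exists>K\<ge>0. \<forall>z\<in>cball 0 (r / 2). norm (h z) \<le> K" if "h holomorphic_on ball 0 r" for h :: "complex \<Rightarrow> complex"
  proof -
    have "continuous_on (cball 0 (r / 2)) h"
      using that sub holomorphic_on_imp_continuous_on continuous_on_subset by blast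
    hence "bounded (h ` cball 0 (r / 2))" by (intro compact_imp_bounded compact_continuous_image) auto
    then obtain K where "\<forall>z\<in>cball 0 (r / 2). norm (h z) \<le> K" unfolding bounded_iff by blast
    thus ?thesis by (intro exI[of _ "max K 0"]) auto
  qed
  obtain K where K: "K \<ge> 0" "\<And>z. z \<in> cball 0 (r / 2) \<Longrightarrow> norm (k z) \<le> K" using bd[OF assms(1)] by blast
  obtain L where L: "L \<ge> 0" "\<And>z. z \<in> cball 0 (r / 2) \<Longrightarrow> norm (deriv k z) \<le> L"
    using bd[OF holomorphic_deriv[OF assms(1) open_ball]] by blast
  have "norm (k z - k z') \<le> L * norm (z - z')" if "z \<in> cball 0 (r / 2)" "z' \<in> cball 0 (r / 2)" for z z'
  proof (rule field_differentiable_bound[of "cball 0 (r / 2)" k "deriv k"])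
    fix w :: complex assume "w \<in> cball 0 (r / 2)"
    thus "(k has_field_derivative deriv k w) (at w within cball 0 (r / 2))"
      using sub holomorphic_derivI[OF assms(1) open_ball] by (meson has_field_derivative_at_within subsetD)
  qed (use that L in auto)
  thus ?thesis using K L by (intro exI[of _ K] conjI exI[of _ L]) auto
qed

text \<open>The remainder \<open>y\<^sup>2 k(y)\<close> has a Lipschitz constant of order \<open>\<rho>\<close> on the disk of radius \<open>\<rho>\<close>. With an eighth of
  \<open>\<bar>a\<bar>\<close> as its bound, difference quotients of \<open>g\<close> near \<open>c0\<close> lie between \<open>7/8 a\<close> and \<open>9/8 a\<close>.\<close>

lemma nearly_linear_near:
  fixes g :: "real \<Rightarrow> real" and k :: "complex \<Rightarrow> complex"
  assumes a: "a \<noteq> 0" and r: "r > 0" and K: "K \<ge> 0" "L \<ge> 0"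
    and kb: "\<And>z. norm z \<le> r / 2 \<Longrightarrow> norm (k z) \<le> K"
    and kl: "\<And>z z'. norm z \<le> r / 2 \<Longrightarrow> norm z' \<le> r / 2 \<Longrightarrow> norm (k z - k z') \<le> L * norm (z - z')"
    and g: "\<And>x. \<bar>x\<bar> < r \<Longrightarrow> complex_of_real (g (c0 + x) - g c0 - a * x) = of_real x * of_real x * k (of_real x)"
  shows "\<exists>\<rho>>0. \<forall>x y. \<bar>x - c0\<bar> \<le> \<rho> \<longrightarrow> \<bar>y - c0\<bar> \<le> \<rho> \<longrightarrow> \<bar>g x - g y - a * (x - y)\<bar> \<le> \<bar>a\<bar> / 8 * \<bar>x - y\<bar>"
proof -
  define \<rho> where "\<rho> = min (r / 2) (min 1 (\<bar>a\<bar> / (8 * (2 * K + L + 1))))"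
  have rho: "\<rho> > 0" "\<rho> \<le> r / 2" "\<rho> \<le> 1"
    unfolding \<rho>_def using a r K
    by (simp_all only: min_less_iff_conj min.cobounded1 min.coboundedI2) (simp add: add_nonneg_pos)
  have "\<rho> \<le> \<bar>a\<bar> / (8 * (2 * K + L + 1))" unfolding \<rho>_def by (meson min.cobounded2 order_trans)
  hence "\<rho> * (8 * (2 * K + L + 1)) \<le> \<bar>a\<bar>" using K by (subst (asm) pos_le_divide_eq) auto
  hence "\<rho> * (2 * K + L + 1) \<le> \<bar>a\<bar> / 8" by (simp add: algebra_simps)
  moreover have "2 * \<rho> * K + \<rho> * \<rho> * L \<le> \<rho> * (2 * K + L + 1)"
  proof -
    have "\<rho> * \<rho> * L \<le> 1 * \<rho> * L" using rho K by (intro mult_right_mono) auto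
    thus ?thesis using rho(1) by (simp add: algebra_simps)
  qed
  ultimately have small: "2 * \<rho> * K + \<rho> * \<rho> * L \<le> \<bar>a\<bar> / 8" by linarith
  have "\<bar>g x - g y - a * (x - y)\<bar> \<le> \<bar>a\<bar> / 8 * \<bar>x - y\<bar>" if x: "\<bar>x - c0\<bar> \<le> \<rho>" and y: "\<bar>y - c0\<bar> \<le> \<rho>" for x y
  proof -
    define u w where "u = complex_of_real (x - c0)" and "w = complex_of_real (y - c0)"
    have n: "norm u \<le> \<rho>" "norm w \<le> \<rho>" unfolding u_def w_def norm_of_real using x y .
    hence n2: "norm u \<le> r / 2" "norm w \<le> r / 2" using rho by linarith+
    have "complex_of_real (g x - g c0 - a * (x - c0)) = u * u * k u" "complex_of_real (g y - g c0 - a * (y - c0)) = w * w * k w"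
      using g[of "x - c0"] g[of "y - c0"] x y rho r unfolding u_def w_def by simp_all
    hence "complex_of_real ((g x - g c0 - a * (x - c0)) - (g y - g c0 - a * (y - c0))) = u * u * k u - w * w * k w"
      by (subst of_real_diff, simp only:)
    moreover have "(g x - g c0 - a * (x - c0)) - (g y - g c0 - a * (y - c0)) = g x - g y - a * (x - y)" by (simp add: algebra_simps)
    moreover have "u * u * k u - w * w * k w = (u + w) * (u - w) * k u + w * w * (k u - k w)" by (simp add: algebra_simps)
    ultimately have "\<bar>g x - g y - a * (x - y)\<bar> = norm ((u + w) * (u - w) * k u + w * w * (k u - k w))"
      by (metis norm_of_real)
    also have "\<dots> \<le> norm (u + w) * norm (u - w) * norm (k u) + norm w * norm w * norm (k u - k w)"
      by (metis norm_triangle_ineq norm_mult)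
    also have "\<dots> \<le> (2 * \<rho>) * norm (u - w) * K + \<rho> * \<rho> * (L * norm (u - w))"
      using n norm_triangle_mono[OF n] kb[OF n2(1)] kl[OF n2] rho K by (intro add_mono mult_mono) auto
    also have "\<dots> = (2 * \<rho> * K + \<rho> * \<rho> * L) * norm (u - w)" by (simp add: algebra_simps)
    also have "norm (u - w) = \<bar>x - y\<bar>"
    proof -
      have "u - w = complex_of_real (x - y)" by (simp add: u_def w_def)
      thus ?thesis by (simp only: norm_of_real)
    qed
    also have "(2 * \<rho> * K + \<rho> * \<rho> * L) * \<bar>x - y\<bar> \<le> \<bar>a\<bar> / 8 * \<bar>x - y\<bar>" using small by (intro mult_right_mono) auto
    finally show ?thesis .
  qed
  thus ?thesis using rho(1) by blast
qed

section \<open>Forward solutions and attraction\<close>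

lemma integral_derivative_halfline:
  fixes \<phi> :: "real \<Rightarrow> 'a::banach"
  assumes "continuous_on {s..} \<phi>" "t \<ge> s"
  shows "((\<lambda>t. integral {s..t} \<phi>) has_vector_derivative \<phi> t) (at t within {s..})"
proof -
  have "((\<lambda>t. integral {s..t} \<phi>) has_vector_derivative \<phi> t) (at t within {s..t + 1})"
    by (rule integral_has_vector_derivative) (use assms in \<open>auto intro: continuous_on_subset\<close>)
  moreover have "at t within {s..t + 1} = at t within {s..}"
    by (rule at_within_nhd[of _ "{..<t + 1}"]) auto
  ultimately show ?thesis by simp
qed

text \<open>In terms of \<open>Z\<close>, where \<open>X t = p + exp (2 L (t - s)) Z t\<close>, the Picard operator is a contraction by \<open>1/2\<close>
  on the whole half-line, so no continuation argument is needed.\<close>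

lemma lipschitz_ode_solution_exists:
  fixes G :: "real \<Rightarrow> 'a::banach \<Rightarrow> 'a"
  assumes cont: "\<And>Z. continuous_on {s..} Z \<Longrightarrow> continuous_on {s..} (\<lambda>u. G u (Z u))"
    and lip: "\<And>u x y. norm (G u x - G u y) \<le> L * norm (x - y)" and L: "L > 0"
    and K: "\<And>u. u \<ge> s \<Longrightarrow> norm (G u p) \<le> K"
  shows "\<exists>X. X s = p \<and> (\<forall>t\<ge>s. (X has_vector_derivative G t (X t)) (at t within {s..}))"
proof -
  define E where "E t = exp (2 * L * (t - s))" for t
  have Epos: "E t > 0" for t by (simp add: E_def)
  define T where "T Z t = (1 / E t) *\<^sub>R integral {s..t} (\<lambda>u. G u (p + E u *\<^sub>R Z u))" for Z t
  have contE: "continuous_on A E" for A unfolding E_def by (intro continuous_intros)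
  have contG: "continuous_on {s..} (\<lambda>u. G u (p + E u *\<^sub>R Z u))" if "continuous_on {s..} Z" for Z
    by (intro cont continuous_intros contE that)
  have intG: "(\<lambda>u. G u (p + E u *\<^sub>R Z u)) integrable_on {s..t}" if "continuous_on {s..} Z" for Z t
    by (rule integrable_continuous_real) (use contG[OF that] in \<open>auto intro: continuous_on_subset\<close>)
  have "\<exists>Z\<in>{Z. continuous_on {s..} Z}. \<forall>t\<in>{s..}. T Z t = Z t"
  proof (rule uniform_contraction_fixpoint[where T = T and K = "K / (2 * L)"])
    show "(\<lambda>_. 0) \<in> {Z. continuous_on {s..} Z}" by simp
    show "T Z \<in> {Z. continuous_on {s..} Z}" if "Z \<in> {Z. continuous_on {s..} Z}" for Z
    proof -
      have "continuous_on {s..} (\<lambda>t. integral {s..t} (\<lambda>u. G u (p + E u *\<^sub>R Z u)))"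
        unfolding continuous_on_eq_continuous_within
        using integral_derivative_halfline[OF contG] that has_vector_derivative_continuous by blast
      thus ?thesis unfolding T_def using Epos by (auto intro!: continuous_intros contE simp: less_imp_neq[THEN not_sym])
    qed
    show "norm (T Z t - T Z' t) \<le> C / 2"
      if Z: "Z \<in> {Z. continuous_on {s..} Z}" "Z' \<in> {Z. continuous_on {s..} Z}" "C \<ge> 0"
        and d: "\<And>t. t \<in> {s..} \<Longrightarrow> norm (Z t - Z' t) \<le> C" and t: "t \<in> {s..}" for Z Z' C t
    proof -
      have i: "((\<lambda>u. L * (E u * C)) has_integral (C / 2 * E t - C / 2 * E s)) {s..t}"
        by (rule fundamental_theorem_of_calculus)
           (use t in \<open>auto intro!: derivative_eq_intros simp: E_def algebra_simps simp flip: has_real_derivative_iff_has_vector_derivative\<close>)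
      have "norm (integral {s..t} (\<lambda>u. G u (p + E u *\<^sub>R Z u)) - integral {s..t} (\<lambda>u. G u (p + E u *\<^sub>R Z' u)))
         = norm (integral {s..t} (\<lambda>u. G u (p + E u *\<^sub>R Z u) - G u (p + E u *\<^sub>R Z' u)))"
        using Z by (subst integral_diff) (auto intro: intG)
      also have "\<dots> \<le> integral {s..t} (\<lambda>u. L * (E u * C))"
      proof (rule Henstock_Kurzweil_Integration.integral_norm_bound_integral)
        show "(\<lambda>u. G u (p + E u *\<^sub>R Z u) - G u (p + E u *\<^sub>R Z' u)) integrable_on {s..t}"
          using Z by (intro integrable_diff intG) auto
        show "(\<lambda>u. L * (E u * C)) integrable_on {s..t}" using i by blast
        fix u assume u: "u \<in> {s..t}"
        have "norm (G u (p + E u *\<^sub>R Z u) - G u (p + E u *\<^sub>R Z' u)) \<le> L * norm (E u *\<^sub>R (Z u - Z' u))"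
          using lip[of u "p + E u *\<^sub>R Z u" "p + E u *\<^sub>R Z' u"] by (simp add: scaleR_diff_right)
        also have "\<dots> \<le> L * (E u * C)" using d[of u] u L Epos[of u] by (simp add: mult_left_mono)
        finally show "norm (G u (p + E u *\<^sub>R Z u) - G u (p + E u *\<^sub>R Z' u)) \<le> L * (E u * C)" .
      qed
      also have "\<dots> = C / 2 * E t - C / 2 * E s" using i by (rule integral_unique)
      also have "\<dots> \<le> C / 2 * E t" using Epos[of s] Z(3) by simp
      finally have "norm (integral {s..t} (\<lambda>u. G u (p + E u *\<^sub>R Z u)) - integral {s..t} (\<lambda>u. G u (p + E u *\<^sub>R Z' u))) / E t \<le> C / 2"
        using Epos[of t] by (simp add: divide_le_eq)
      thus ?thesis using Epos[of t]
        by (simp only: T_def scaleR_diff_right[symmetric] norm_scaleR norm_divide norm_one real_norm_def abs_of_pos mult_1 times_divide_eq_left abs_divide abs_one)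
    qed
    show "norm (T (\<lambda>_. 0) t - 0) \<le> K / (2 * L)" if "t \<in> {s..}" for t
    proof -
      have K0: "K \<ge> 0" using K[of s] norm_ge_zero[of "G s p"] by linarith
      have "norm (integral {s..t} (\<lambda>u. G u p)) \<le> K * (t - s)"
      proof -
        have "norm (integral {s..t} (\<lambda>u. G u p)) \<le> integral {s..t} (\<lambda>u. K)"
          by (rule Henstock_Kurzweil_Integration.integral_norm_bound_integral)
             (use intG[of "\<lambda>_. 0" t] K in auto)
        thus ?thesis using that by (simp add: mult.commute)
      qed
      also have "\<dots> \<le> K * (E t / (2 * L))"
      proof (intro mult_left_mono K0)
        have "2 * L * (t - s) \<le> E t" unfolding E_def using exp_ge_add_one_self[of "2 * L * (t - s)"] by linarith
        thus "t - s \<le> E t / (2 * L)" using L by (simp add: le_divide_eq mult.commute)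
      qed
      finally have "norm (integral {s..t} (\<lambda>u. G u p)) / E t \<le> K / (2 * L)"
        using Epos[of t] by (simp add: divide_le_eq)
      thus ?thesis using Epos[of t]
        by (simp only: T_def scaleR_zero_right add_0_right diff_0_right norm_scaleR real_norm_def abs_of_pos mult_1 times_divide_eq_left abs_divide abs_one)
    qed
    show "l \<in> {Z. continuous_on {s..} Z}"
      if "\<And>n. u n \<in> {Z. continuous_on {s..} Z}" "uniform_limit {s..} u l sequentially" for u l
      using uniform_limit_theorem[OF _ that(2)] that(1) by simp
  qed
  then obtain Z where Z: "continuous_on {s..} Z" "\<And>t. t \<ge> s \<Longrightarrow> T Z t = Z t" by auto
  define X where "X t = p + integral {s..t} (\<lambda>u. G u (p + E u *\<^sub>R Z u))" for t
  have XZ: "p + E t *\<^sub>R Z t = X t" if "t \<ge> s" for t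
    using Z(2)[OF that, symmetric] Epos[of t] by (simp add: T_def X_def)
  have "(X has_vector_derivative G t (X t)) (at t within {s..})" if "t \<ge> s" for t
  proof -
    have "(X has_vector_derivative (0 + G t (p + E t *\<^sub>R Z t))) (at t within {s..})"
      unfolding X_def by (intro has_vector_derivative_add has_vector_derivative_const integral_derivative_halfline contG Z that)
    thus ?thesis using XZ[OF that] by simp
  qed
  moreover have "X s = p" by (simp add: X_def)
  ultimately show ?thesis by blast
qed

text \<open>In the coordinates \<open>p = z + v / \<gamma>\<close> and \<open>u = v / \<gamma>\<close> the equation \<open>z'' + \<gamma> z' + b z = 0\<close> reads
  \<open>p' = - (b/\<gamma>) (p - u)\<close>, \<open>u' = - \<gamma> u - (b/\<gamma>) (p - u)\<close>. In the derivative of \<open>p\<^sup>2 + u\<^sup>2\<close> the mixed terms cancel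
  for every value of \<open>b\<close>, which makes its square root the right distance for slopes that vary in time.\<close>

definition phase_gap :: "real \<Rightarrow> real \<Rightarrow> real \<Rightarrow> real" where
  "phase_gap \<gamma> z v = norm (z + v / \<gamma>, v / \<gamma>)"

lemma phase_gap_sq: "(phase_gap \<gamma> z v)\<^sup>2 = (z + v / \<gamma>)\<^sup>2 + (v / \<gamma>)\<^sup>2"
  by (simp add: phase_gap_def norm_prod_def power_divide)

lemma phase_gap_triangle: "phase_gap \<gamma> (z - z') (v - v') \<le> phase_gap \<gamma> z v + phase_gap \<gamma> z' v'"
  using norm_triangle_ineq4[of "(z + v / \<gamma>, v / \<gamma>)" "(z' + v' / \<gamma>, v' / \<gamma>)"]
  by (simp add: phase_gap_def diff_divide_distrib algebra_simps)

lemma phase_gap_dominates: "\<bar>z\<bar> \<le> 2 * phase_gap \<gamma> z v" "\<bar>v / \<gamma>\<bar> \<le> phase_gap \<gamma> z v"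
proof -
  have 1: "\<bar>z + v / \<gamma>\<bar> \<le> phase_gap \<gamma> z v"
    using norm_fst_le[of "z + v / \<gamma>" "v / \<gamma>"] by (simp add: phase_gap_def)
  show 2: "\<bar>v / \<gamma>\<bar> \<le> phase_gap \<gamma> z v"
    using norm_snd_le[of "v / \<gamma>" "z + v / \<gamma>"] by (simp add: phase_gap_def)
  show "\<bar>z\<bar> \<le> 2 * phase_gap \<gamma> z v" using 1 2 by linarith
qed

text \<open>Here \<open>\<phi> = - b z\<close> with \<open>7/8 a \<le> b \<le> 9/8 a\<close>, and \<open>p\<^sup>2 + u\<^sup>2\<close> has the derivative
  \<open>- 2 (b/\<gamma>) p\<^sup>2 - 2 (\<gamma> - b/\<gamma>) u\<^sup>2 \<le> - (a/\<gamma>) (p\<^sup>2 + u\<^sup>2)\<close>.\<close>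

lemma weighted_gap_dissipates:
  fixes z v :: "real \<Rightarrow> real" and \<phi> :: real
  assumes z: "(z has_real_derivative v t) (at t within S)"
    and v: "(v has_real_derivative \<phi> - \<gamma> * v t) (at t within S)"
    and a: "a > 0" and gam: "\<gamma> > 0" "\<gamma>\<^sup>2 \<ge> 2 * a"
    and lin: "\<bar>\<phi> + a * z t\<bar> \<le> a / 8 * \<bar>z t\<bar>"
  shows "\<exists>D. ((\<lambda>t. exp (a / \<gamma> * (t - s)) * (phase_gap \<gamma> (z t) (v t))\<^sup>2) has_real_derivative D) (at t within S) \<and> D \<le> 0"
proof -
  define p u where "p = z t + v t / \<gamma>" and "u = v t / \<gamma>"
  have zt: "z t = p - u" by (simp add: p_def u_def)
  define e where "e = exp (a / \<gamma> * (t - s))"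
  define D where "D = e * (a / \<gamma> * (p\<^sup>2 + u\<^sup>2) + 2 * \<phi> / \<gamma> * (p + u) - 2 * \<gamma> * u\<^sup>2)"
  have g0: "\<gamma> \<noteq> 0" using gam(1) by simp
  have vt: "v t = \<gamma> * u" using g0 by (simp add: u_def)
  have "((\<lambda>t. exp (a / \<gamma> * (t - s)) * ((z t + v t / \<gamma>)\<^sup>2 + (v t / \<gamma>)\<^sup>2)) has_real_derivative D) (at t within S)"
  proof -
    have du: "((\<lambda>t. v t / \<gamma>) has_real_derivative \<phi> / \<gamma> - \<gamma> * u) (at t within S)"
      using DERIV_cdivide[OF v, of \<gamma>] g0 by (simp add: diff_divide_distrib vt)
    have dp: "((\<lambda>t. z t + v t / \<gamma>) has_real_derivative \<phi> / \<gamma>) (at t within S)"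
      using DERIV_add[OF z du] by (simp add: vt g0)
    have de: "((\<lambda>t. exp (a / \<gamma> * (t - s))) has_real_derivative e * (a / \<gamma>)) (at t within S)"
      unfolding e_def using g0 by (auto intro!: derivative_eq_intros)
    have "((\<lambda>t. exp (a / \<gamma> * (t - s)) * ((z t + v t / \<gamma>)\<^sup>2 + (v t / \<gamma>)\<^sup>2)) has_real_derivative
        e * (2 * p * (\<phi> / \<gamma>) + 2 * u * (\<phi> / \<gamma> - \<gamma> * u)) + e * (a / \<gamma>) * (p\<^sup>2 + u\<^sup>2)) (at t within S)"
      by (rule derivative_eq_intros dp du de refl)+ (simp add: e_def p_def u_def algebra_simps)
    also have "e * (2 * p * (\<phi> / \<gamma>) + 2 * u * (\<phi> / \<gamma> - \<gamma> * u)) + e * (a / \<gamma>) * (p\<^sup>2 + u\<^sup>2)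
      = e * (a / \<gamma> * (p\<^sup>2 + u\<^sup>2) + 2 * \<phi> / \<gamma> * (p + u) - 2 * \<gamma> * u\<^sup>2)"
      by (simp add: algebra_simps power2_eq_square add_divide_distrib)
    finally show ?thesis unfolding D_def .
  qed
  moreover have "D \<le> 0"
  proof -
    define b where "b = (if z t = 0 then a else - \<phi> / z t)"
    have phi: "\<phi> = - b * (p - u)" unfolding zt[symmetric] using lin by (auto simp: b_def)
    have b: "7 / 8 * a \<le> b" "b \<le> 9 / 8 * a"
    proof -
      have "\<bar>a - b\<bar> * \<bar>z t\<bar> \<le> a / 8 * \<bar>z t\<bar>"
        using lin unfolding phi zt[symmetric] by (simp add: abs_mult[symmetric] algebra_simps)
      hence "\<bar>a - b\<bar> \<le> a / 8" using a by (cases "z t = 0") (auto simp: b_def)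
      thus "7 / 8 * a \<le> b" "b \<le> 9 / 8 * a" by linarith+
    qed
    have "a / \<gamma> * (p\<^sup>2 + u\<^sup>2) + 2 * \<phi> / \<gamma> * (p + u) - 2 * \<gamma> * u\<^sup>2
        = - ((2 * b - a) / \<gamma>) * p\<^sup>2 - ((2 * \<gamma>\<^sup>2 - 2 * b - a) / \<gamma>) * u\<^sup>2"
      unfolding phi using gam by (simp add: field_simps power2_eq_square)
    moreover have "0 \<le> ((2 * b - a) / \<gamma>) * p\<^sup>2" using b a gam by (intro mult_nonneg_nonneg divide_nonneg_nonneg) auto
    moreover have "0 \<le> ((2 * \<gamma>\<^sup>2 - 2 * b - a) / \<gamma>) * u\<^sup>2"
      using b a gam by (intro mult_nonneg_nonneg divide_nonneg_nonneg) auto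
    ultimately have "a / \<gamma> * (p\<^sup>2 + u\<^sup>2) + 2 * \<phi> / \<gamma> * (p + u) - 2 * \<gamma> * u\<^sup>2 \<le> 0" by linarith
    thus ?thesis unfolding D_def by (intro mult_nonneg_nonpos) (auto simp: e_def)
  qed
  ultimately show ?thesis unfolding phase_gap_sq by blast
qed

text \<open>A first exit argument. Both points start within \<open>\<rho>/8\<close> of \<open>(c0, 0)\<close>, hence within \<open>\<rho>/4\<close> of each other.
  As long as the gap is below \<open>\<rho>/4\<close>, both positions lie within \<open>\<rho>\<close> of \<open>c0\<close>, where the gap decreases;
  thus it never reaches \<open>\<rho>/4\<close>.\<close>

lemma phase_gap_decay:
  fixes g :: "real \<Rightarrow> real"
  assumes a: "a > 0" and gam: "\<gamma> > 0" "\<gamma>\<^sup>2 \<ge> 2 * a"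
    and lin: "\<And>x y. \<bar>x - c0\<bar> \<le> \<rho> \<Longrightarrow> \<bar>y - c0\<bar> \<le> \<rho> \<Longrightarrow> \<bar>g x - g y - a * (x - y)\<bar> \<le> a / 8 * \<bar>x - y\<bar>"
    and x0: "trajectory_on UNIV \<gamma> g h x0 v0" "\<And>t. phase_gap \<gamma> (x0 t - c0) (v0 t) < \<rho> / 8"
    and x: "trajectory_on {s..} \<gamma> g h x v" and start: "phase_gap \<gamma> (x s - c0) (v s) < \<rho> / 8"
    and t: "t \<ge> s"
  shows "(phase_gap \<gamma> (x t - x0 t) (v t - v0 t))\<^sup>2 \<le> (\<rho> / 4)\<^sup>2 * exp (- (a / \<gamma>) * (t - s))"
    and "\<bar>x t - c0\<bar> \<le> \<rho>"
proof -
  define V where "V t = phase_gap \<gamma> (x t - x0 t) (v t - v0 t)" for t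
  define E where "E t = exp (a / \<gamma> * (t - s)) * (V t)\<^sup>2" for t
  have V0: "V t \<ge> 0" for t by (simp add: V_def phase_gap_def)
  have near0: "\<bar>x0 t - c0\<bar> < \<rho> / 4" for t
    using phase_gap_dominates(1)[of "x0 t - c0" \<gamma> "v0 t"] x0(2)[of t] by linarith
  have rho: "\<rho> > 0" using near0[of s] by linarith
  have nearx: "\<bar>x t - c0\<bar> \<le> \<rho>" if "V t < \<rho> / 4" for t
    using phase_gap_dominates(1)[of "x t - x0 t" \<gamma> "v t - v0 t"] that near0[of t] unfolding V_def by linarith
  have Vs: "V s < \<rho> / 4"
    using phase_gap_triangle[of \<gamma> "x s - c0" "x0 s - c0" "v s" "v0 s"] start x0(2)[of s] by (simp add: V_def)
  have dx: "(x has_real_derivative v t) (at t within {s..})"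
    "(v has_real_derivative h t - \<gamma> * v t - g (x t)) (at t within {s..})" if "t \<ge> s" for t
    using x that by (auto simp: trajectory_on_def)
  have dx0: "(x0 has_real_derivative v0 t) (at t within {s..})"
    "(v0 has_real_derivative h t - \<gamma> * v0 t - g (x0 t)) (at t within {s..})" for t
    using x0(1) by (auto simp: trajectory_on_def intro: has_field_derivative_at_within)
  have dE: "\<exists>D. (E has_real_derivative D) (at t within {s..}) \<and> D \<le> 0" if "t \<ge> s" "V t < \<rho> / 4" for t
    unfolding E_def V_def
  proof (rule weighted_gap_dissipates[where \<phi> = "- (g (x t) - g (x0 t))", OF _ _ a gam])
    show "((\<lambda>t. x t - x0 t) has_real_derivative v t - v0 t) (at t within {s..})"
      using dx dx0 that by (intro derivative_intros) auto
    show "((\<lambda>t. v t - v0 t) has_real_derivative - (g (x t) - g (x0 t)) - \<gamma> * (v t - v0 t)) (at t within {s..})"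
      using dx(2)[OF that(1)] dx0(2)[of t] by (auto intro!: derivative_eq_intros simp: algebra_simps)
    have "\<bar>g (x t) - g (x0 t) - a * (x t - x0 t)\<bar> \<le> a / 8 * \<bar>x t - x0 t\<bar>"
      using rho by (intro lin nearx that less_imp_le[OF order_less_trans[OF near0]]) auto
    thus "\<bar>- (g (x t) - g (x0 t)) + a * (x t - x0 t)\<bar> \<le> a / 8 * \<bar>x t - x0 t\<bar>" by linarith
  qed
  have contx: "continuous_on {s..} x" "continuous_on {s..} v" "continuous_on {s..} x0" "continuous_on {s..} v0"
    using dx dx0 by (auto intro!: DERIV_continuous_on)
  have contV: "continuous_on {s..} V"
    unfolding V_def phase_gap_def using gam by (intro continuous_intros contx) auto
  have contE: "continuous_on {s..} E" unfolding E_def by (intro continuous_intros contV)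
  have mono: "E T \<le> E s" if "T \<ge> s" "\<And>t. s < t \<Longrightarrow> t < T \<Longrightarrow> V t < \<rho> / 4" for T
  proof (rule DERIV_nonpos_imp_decreasing_open[OF that(1)])
    show "\<exists>y. (E has_real_derivative y) (at t) \<and> y \<le> 0" if "s < t" "t < T" for t
    proof -
      have "at t within {s..} = at t" using that by (intro at_within_interior) auto
      thus ?thesis using dE[of t] \<open>\<And>t. s < t \<Longrightarrow> t < T \<Longrightarrow> V t < \<rho> / 4\<close>[OF that] that by simp
    qed
    show "continuous_on {s..T} E" by (rule continuous_on_subset[OF contE]) auto
  qed
  have Es: "E s < (\<rho> / 4)\<^sup>2" unfolding E_def using Vs V0[of s] by (simp add: power_strict_mono)
  have inside: "V t < \<rho> / 4" if "t \<ge> s" for t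
  proof (rule ccontr)
    assume "\<not> V t < \<rho> / 4"
    define A where "A = {s..} \<inter> V -` {\<rho> / 4..}"
    have A: "closed A" "t \<in> A" "bdd_below A"
      using continuous_closed_preimage[OF contV] that \<open>\<not> V t < \<rho> / 4\<close> by (auto simp: A_def)
    define T where "T = Inf A"
    have TA: "T \<in> A" unfolding T_def using A by (intro closed_contains_Inf) auto
    hence T: "T \<ge> s" "V T \<ge> \<rho> / 4" by (auto simp: A_def)
    have "V t < \<rho> / 4" if "s < t" "t < T" for t
    proof (rule ccontr)
      assume "\<not> V t < \<rho> / 4"
      hence "t \<in> A" using that by (auto simp: A_def)
      hence "T \<le> t" unfolding T_def by (rule cInf_lower[OF _ A(3)])
      thus False using that(2) by simp
    qed
    from mono[OF T(1) this] have "E T < (\<rho> / 4)\<^sup>2" using Es by linarith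
    moreover have "E T \<ge> 1 * (\<rho> / 4)\<^sup>2"
      unfolding E_def using T rho a gam by (intro mult_mono power_mono) auto
    ultimately show False by simp
  qed
  show "\<bar>x t - c0\<bar> \<le> \<rho>" using nearx inside t by blast
  have "E t \<le> (\<rho> / 4)\<^sup>2" using mono[OF t inside] Es by simp
  thus "(phase_gap \<gamma> (x t - x0 t) (v t - v0 t))\<^sup>2 \<le> (\<rho> / 4)\<^sup>2 * exp (- (a / \<gamma>) * (t - s))"
    unfolding E_def V_def by (simp add: exp_minus field_simps)
qed

lemma phase_gap_decay_attracts:
  assumes a: "a > 0" and gam: "\<gamma> > 0"
    and decay: "\<And>t. t \<ge> s \<Longrightarrow> (phase_gap \<gamma> (x t - x0 t) (v t - v0 t))\<^sup>2 \<le> C * exp (- (a / \<gamma>) * (t - s))"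
  shows "attracted_to x v x0 v0"
proof -
  define V where "V t = phase_gap \<gamma> (x t - x0 t) (v t - v0 t)" for t
  have e: "((\<lambda>t. exp (- (a / \<gamma>) * (t - s))) \<longlongrightarrow> 0) at_top"
  proof (rule filterlim_compose[OF exp_at_bot])
    have "filterlim (\<lambda>t. a / \<gamma> * (- s + t)) at_top at_top"
      using a gam by (intro filterlim_tendsto_pos_mult_at_top[OF tendsto_const] filterlim_tendsto_add_at_top[OF tendsto_const] filterlim_ident) auto
    thus "filterlim (\<lambda>t. - (a / \<gamma>) * (t - s)) at_bot at_top"
      by (simp add: filterlim_uminus_at_bot algebra_simps)
  qed
  have "((\<lambda>t. (V t)\<^sup>2) \<longlongrightarrow> 0) at_top"
  proof (rule Lim_null_comparison)
    show "\<forall>\<^sub>F t in at_top. norm ((V t)\<^sup>2) \<le> C * exp (- (a / \<gamma>) * (t - s))"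
      using eventually_ge_at_top[of s] by (rule eventually_mono) (use decay in \<open>simp add: V_def\<close>)
    show "((\<lambda>t. C * exp (- (a / \<gamma>) * (t - s))) \<longlongrightarrow> 0) at_top"
      using tendsto_mult_left[OF e, of C] by simp
  qed
  from tendsto_real_sqrt[OF this] have V: "(V \<longlongrightarrow> 0) at_top"
    by (simp add: V_def[abs_def] phase_gap_def)
  have "((\<lambda>t. x t - x0 t) \<longlongrightarrow> 0) at_top"
    by (rule Lim_null_comparison[OF _ tendsto_mult_right_zero[OF V, of 2]])
       (simp add: V_def phase_gap_dominates)
  moreover have "((\<lambda>t. v t - v0 t) \<longlongrightarrow> 0) at_top"
  proof (rule Lim_null_comparison[OF _ tendsto_mult_right_zero[OF V, of \<gamma>]])
    show "\<forall>\<^sub>F t in at_top. norm (v t - v0 t) \<le> \<gamma> * V t"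
    proof (intro always_eventually allI)
      fix t
      show "norm (v t - v0 t) \<le> \<gamma> * V t"
        using phase_gap_dominates(2)[of "v t - v0 t" \<gamma> "x t - x0 t"] gam by (simp add: V_def abs_divide divide_le_eq mult.commute)
    qed
  qed
  ultimately show ?thesis unfolding attracted_to_def by (intro tendsto_Pair)
qed

text \<open>Composing \<open>g\<close> with the retraction of the line onto \<open>[c0 - \<rho>, c0 + \<rho>]\<close> makes it globally Lipschitz. The
  solution for the modified nonlinearity is confined to that interval by \<open>phase_gap_decay\<close>, so it
  solves the original equation.\<close>

lemma trajectory_exists_near:
  fixes g h :: "real \<Rightarrow> real"
  assumes a: "a > 0" and gam: "\<gamma> > 0" "\<gamma>\<^sup>2 \<ge> 2 * a"
    and lin: "\<And>x y. \<bar>x - c0\<bar> \<le> \<rho> \<Longrightarrow> \<bar>y - c0\<bar> \<le> \<rho> \<Longrightarrow> \<bar>g x - g y - a * (x - y)\<bar> \<le> a / 8 * \<bar>x - y\<bar>"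
    and x0: "trajectory_on UNIV \<gamma> g h x0 v0" "\<And>t. phase_gap \<gamma> (x0 t - c0) (v0 t) < \<rho> / 8"
    and h: "continuous_on UNIV h" "\<And>t. \<bar>h t\<bar> \<le> Hb"
    and start: "phase_gap \<gamma> (xs - c0) vs < \<rho> / 8"
  shows "\<exists>x v. trajectory_on {s..} \<gamma> g h x v \<and> (x s, v s) = (xs, vs)"
proof -
  have near0: "\<bar>x0 t - c0\<bar> < \<rho> / 4" for t
    using phase_gap_dominates(1)[of "x0 t - c0" \<gamma> "v0 t"] x0(2)[of t] by linarith
  have rho: "\<rho> > 0" using near0[of s] by linarith
  define cl where "cl x = max (c0 - \<rho>) (min (c0 + \<rho>) x)" for x
  define G where "G = g \<circ> cl"
  have cl_in: "\<bar>cl x - c0\<bar> \<le> \<rho>" for x using rho by (auto simp: cl_def max_def min_def)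
  have cl_id: "cl x = x" if "\<bar>x - c0\<bar> \<le> \<rho>" for x using that by (auto simp: cl_def)
  have cl_lip: "\<bar>cl x - cl y\<bar> \<le> \<bar>x - y\<bar>" for x y by (auto simp: cl_def max_def min_def)
  have Glip: "\<bar>G x - G y\<bar> \<le> 2 * a * \<bar>x - y\<bar>" for x y
  proof -
    have "\<bar>G x - G y - a * (cl x - cl y)\<bar> \<le> a / 8 * \<bar>cl x - cl y\<bar>"
      unfolding G_def o_def by (intro lin cl_in)
    moreover have "\<bar>a * (cl x - cl y)\<bar> = a * \<bar>cl x - cl y\<bar>" using a by (simp add: abs_mult)
    moreover have "a * \<bar>cl x - cl y\<bar> \<le> a * \<bar>x - y\<bar>" using a cl_lip by (intro mult_left_mono) auto
    moreover have "0 \<le> a * \<bar>x - y\<bar>" using a by simp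
    ultimately show ?thesis by linarith
  qed
  have "(2 * a)-lipschitz_on UNIV G" using Glip a by (intro lipschitz_onI) (auto simp: dist_real_def)
  hence contG: "continuous_on UNIV G" by (rule lipschitz_on_continuous_on)
  define N where "N t q = (snd q, h t - \<gamma> * snd q - G (fst q))" for t and q :: "real \<times> real"
  have "\<exists>X. X s = (xs, vs) \<and> (\<forall>t\<ge>s. (X has_vector_derivative N t (X t)) (at t within {s..}))"
  proof (rule lipschitz_ode_solution_exists[where L = "1 + \<gamma> + 2 * a" and K = "norm vs + (Hb + \<bar>\<gamma> * vs\<bar> + \<bar>G xs\<bar>)"])
    show "continuous_on {s..} (\<lambda>u. N u (Z u))" if "continuous_on {s..} Z" for Z
      unfolding N_def using that
      by (intro continuous_intros continuous_on_compose2[OF contG] continuous_on_subset[OF h(1)]) auto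
    show "norm (N u q - N u q') \<le> (1 + \<gamma> + 2 * a) * norm (q - q')" for u q q'
    proof -
      have f: "\<bar>fst q - fst q'\<bar> \<le> norm (q - q')" "\<bar>snd q - snd q'\<bar> \<le> norm (q - q')"
        using norm_fst_le[of "fst q - fst q'" "snd q - snd q'"] norm_snd_le[of "snd q - snd q'" "fst q - fst q'"]
        by (simp_all add: minus_prod_def)
      have "norm (N u q - N u q') \<le> norm (snd q - snd q') + norm (- \<gamma> * (snd q - snd q') - (G (fst q) - G (fst q')))"
        using norm_Pair_le[of "snd q - snd q'" "- \<gamma> * (snd q - snd q') - (G (fst q) - G (fst q'))"]
        by (simp add: N_def algebra_simps)
      also have "\<dots> \<le> \<bar>snd q - snd q'\<bar> + (\<gamma> * \<bar>snd q - snd q'\<bar> + 2 * a * \<bar>fst q - fst q'\<bar>)"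
      proof -
        have "\<bar>- \<gamma> * (snd q - snd q')\<bar> = \<gamma> * \<bar>snd q - snd q'\<bar>" using gam by (simp add: abs_mult)
        thus ?thesis using Glip[of "fst q" "fst q'"] unfolding real_norm_def by linarith
      qed
      also have "\<dots> \<le> norm (q - q') + (\<gamma> * norm (q - q') + 2 * a * norm (q - q'))"
        using f gam a by (intro add_mono mult_left_mono) auto
      finally show ?thesis by (simp add: algebra_simps)
    qed
    show "norm (N u (xs, vs)) \<le> norm vs + (Hb + \<bar>\<gamma> * vs\<bar> + \<bar>G xs\<bar>)" for u
    proof -
      have "norm (N u (xs, vs)) \<le> norm vs + norm (h u - \<gamma> * vs - G xs)"
        using norm_Pair_le[of vs "h u - \<gamma> * vs - G xs"] by (simp add: N_def)
      moreover have "norm (h u - \<gamma> * vs - G xs) \<le> Hb + \<bar>\<gamma> * vs\<bar> + \<bar>G xs\<bar>"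
        using h(2)[of u] unfolding real_norm_def by linarith
      ultimately show ?thesis by linarith
    qed
  qed (use a gam in auto)
  then obtain X where X: "X s = (xs, vs)" "\<And>t. t \<ge> s \<Longrightarrow> (X has_vector_derivative N t (X t)) (at t within {s..})" by blast
  have traj: "trajectory_on {s..} \<gamma> G h (\<lambda>t. fst (X t)) (\<lambda>t. snd (X t))"
    unfolding trajectory_on_def has_real_derivative_iff_has_vector_derivative
    using bounded_linear.has_vector_derivative[OF bounded_linear_fst X(2)]
      bounded_linear.has_vector_derivative[OF bounded_linear_snd X(2)] by (auto simp: N_def)
  have x0G: "trajectory_on UNIV \<gamma> G h x0 v0"
  proof -
    have "G (x0 t) = g (x0 t)" for t using near0[of t] rho by (simp add: G_def cl_id)
    thus ?thesis using x0(1) by (simp add: trajectory_on_def)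
  qed
  have "\<bar>fst (X t) - c0\<bar> \<le> \<rho>" if "t \<ge> s" for t
  proof (rule phase_gap_decay(2)[OF a gam _ x0G x0(2) traj _ that])
    show "\<bar>G x - G y - a * (x - y)\<bar> \<le> a / 8 * \<bar>x - y\<bar>" if "\<bar>x - c0\<bar> \<le> \<rho>" "\<bar>y - c0\<bar> \<le> \<rho>" for x y
      using lin[OF that] cl_id that by (simp add: G_def)
  qed (use start X(1) in auto)
  hence "G (fst (X t)) = g (fst (X t))" if "t \<ge> s" for t using that by (simp add: G_def cl_id)
  hence "trajectory_on {s..} \<gamma> g h (\<lambda>t. fst (X t)) (\<lambda>t. snd (X t))"
    using traj by (simp add: trajectory_on_def)
  thus ?thesis using X(1) by (intro exI[of _ "\<lambda>t. fst (X t)"] exI[of _ "\<lambda>t. snd (X t)"]) auto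
qed

lemma attracting_neighbourhood:
  fixes g h :: "real \<Rightarrow> real"
  assumes a: "a > 0" and gam: "\<gamma> > 0" "\<gamma>\<^sup>2 \<ge> 2 * a"
    and lin: "\<And>x y. \<bar>x - c0\<bar> \<le> \<rho> \<Longrightarrow> \<bar>y - c0\<bar> \<le> \<rho> \<Longrightarrow> \<bar>g x - g y - a * (x - y)\<bar> \<le> a / 8 * \<bar>x - y\<bar>"
    and x0: "trajectory_on UNIV \<gamma> g h x0 v0" "\<And>t. phase_gap \<gamma> (x0 t - c0) (v0 t) < \<rho> / 8"
    and h: "continuous_on UNIV h" "\<And>t. \<bar>h t\<bar> \<le> Hb"
  shows "attracts_all_from \<gamma> g h x0 v0 {q. phase_gap \<gamma> (fst q - c0) (snd q) < \<rho> / 8}"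
  unfolding attracts_all_from_def
proof (intro allI ballI conjI impI)
  fix s q assume q: "q \<in> {q. phase_gap \<gamma> (fst q - c0) (snd q) < \<rho> / 8}"
  show "\<exists>x v. trajectory_on {s..} \<gamma> g h x v \<and> (x s, v s) = q"
    using trajectory_exists_near[OF a gam lin x0 h, of "fst q" "snd q" s] q by simp
  fix x v assume "trajectory_on {s..} \<gamma> g h x v \<and> (x s, v s) = q"
  hence x: "trajectory_on {s..} \<gamma> g h x v" "phase_gap \<gamma> (x s - c0) (v s) < \<rho> / 8" using q by auto
  show "attracted_to x v x0 v0"
    by (rule phase_gap_decay_attracts[OF a gam(1) phase_gap_decay(1)[OF a gam lin x0 x]])
qed

section \<open>Analytic continuation and the response family\<close>

lemma tangent_disk_subset: "R \<le> R' \<Longrightarrow> ball (complex_of_real R) R \<subseteq> ball (complex_of_real R') R'"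
proof
  fix z assume R: "R \<le> R'" and z: "z \<in> ball (complex_of_real R) R"
  have "dist (complex_of_real R') z \<le> dist (complex_of_real R') (complex_of_real R) + dist (complex_of_real R) z"
    by (rule dist_triangle)
  also have "dist (complex_of_real R') (complex_of_real R) = R' - R"
    using R by (simp add: dist_of_real dist_real_def)
  finally show "z \<in> ball (complex_of_real R') R'" using z by simp
qed

lemma of_real_in_tangent_disk: "0 < e \<Longrightarrow> e < 2 * R \<Longrightarrow> complex_of_real e \<in> ball (complex_of_real R) R"
  by (simp add: dist_of_real dist_real_def abs_if)

text \<open>The smaller of the two tangent disks is contained in the other one and still contains \<open>1 / \<gamma>\<close> for every \<open>\<gamma> > \<gamma>0\<close>.
  Agreement for large \<open>\<gamma>\<close> is agreement on a real interval with an accumulation point inside this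
  disk.\<close>

lemma tangent_disk_identity:
  fixes x y :: "real \<Rightarrow> real"
  assumes gam0: "\<gamma>0 > 0" and R: "1 / \<gamma>0 \<le> 2 * R" "1 / \<gamma>0 \<le> 2 * R'"
    and xc: "xc holomorphic_on ball (complex_of_real R) R" "\<And>\<gamma>. \<gamma> > \<gamma>0 \<Longrightarrow> xc (of_real (1 / \<gamma>)) = of_real (x \<gamma>)"
    and yc: "yc holomorphic_on ball (complex_of_real R') R'" "\<And>\<gamma>. \<gamma> > \<gamma>0 \<Longrightarrow> yc (of_real (1 / \<gamma>)) = of_real (y \<gamma>)"
    and agree: "\<And>\<gamma>. \<gamma> > \<Gamma> \<Longrightarrow> x \<gamma> = y \<gamma>" and gam: "\<gamma> > \<gamma>0"
  shows "x \<gamma> = y \<gamma>"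
proof -
  define Q where "Q = min R R'"
  have Q: "1 / \<gamma>0 \<le> 2 * Q" using R by (auto simp: Q_def)
  let ?D = "ball (complex_of_real Q) Q"
  define m where "m = 1 / max \<Gamma> \<gamma>0"
  have m: "m > 0" "m \<le> 1 / \<gamma>0" using gam0 by (auto simp: m_def max_def intro!: divide_left_mono)
  define U where "U = complex_of_real ` {0<..<m}"
  have "xc (of_real (1 / \<gamma>)) - yc (of_real (1 / \<gamma>)) = 0"
  proof (rule analytic_continuation[where f = "\<lambda>z. xc z - yc z" and S = ?D and U = U and \<xi> = "complex_of_real (m / 2)"])
    show "(\<lambda>z. xc z - yc z) holomorphic_on ?D"
      using xc(1) yc(1) tangent_disk_subset[of Q R] tangent_disk_subset[of Q R']
      by (intro holomorphic_on_diff) (auto simp: Q_def intro: holomorphic_on_subset)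
    show "U \<subseteq> ?D" unfolding U_def using m Q by (auto intro!: of_real_in_tangent_disk simp del: mem_ball)
    show "complex_of_real (m / 2) \<in> ?D" using m Q by (intro of_real_in_tangent_disk) auto
    show "complex_of_real (1 / \<gamma>) \<in> ?D"
    proof (rule of_real_in_tangent_disk)
      show "1 / \<gamma> > 0" using gam gam0 by simp
      have "1 / \<gamma> < 1 / \<gamma>0" using gam gam0 by (simp add: frac_less2)
      thus "1 / \<gamma> < 2 * Q" using Q by linarith
    qed
    show "complex_of_real (m / 2) islimpt U"
      unfolding islimpt_approachable
    proof (intro allI impI)
      fix e :: real assume e: "e > 0"
      define d where "d = min (e / 2) (m / 4)"
      have d: "d > 0" "d < e" "d < m / 2" using e m by (auto simp: d_def min_def)
      have "complex_of_real (m / 2 + d) \<in> U" unfolding U_def using d m by (intro imageI) auto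
      moreover have "complex_of_real (m / 2 + d) \<noteq> complex_of_real (m / 2)" unfolding of_real_eq_iff using d by simp
      moreover have "dist (complex_of_real (m / 2 + d)) (complex_of_real (m / 2)) < e"
        unfolding dist_of_real dist_real_def using d by simp
      ultimately show "\<exists>x'\<in>U. x' \<noteq> complex_of_real (m / 2) \<and> dist x' (complex_of_real (m / 2)) < e" by blast
    qed
    fix z assume "z \<in> U"
    then obtain s where s: "0 < s" "s < m" "z = complex_of_real s" by (auto simp: U_def)
    have g: "1 / s > max \<Gamma> \<gamma>0"
      using s gam0 unfolding m_def by (simp add: less_divide_eq mult.commute)
    have "xc (of_real (1 / (1 / s))) = of_real (x (1 / s))" by (rule xc(2)) (use g in simp)
    moreover have "yc (of_real (1 / (1 / s))) = of_real (y (1 / s))" by (rule yc(2)) (use g in simp)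
    moreover have "x (1 / s) = y (1 / s)" by (rule agree) (use g in simp)
    ultimately show "xc z - yc z = 0" using s(3) by simp
  qed auto
  thus ?thesis using xc(2)[OF gam] yc(2)[OF gam] by simp
qed

lemma torus_fun_line:
  assumes "torus_fun f"
  shows "continuous_on UNIV (\<lambda>t. f (t *\<^sub>R \<omega>))" "\<exists>M. \<forall>t. \<bar>f (t *\<^sub>R \<omega>)\<bar> \<le> M"
  using assms unfolding torus_fun_def
  by (auto intro!: continuous_on_compose2[of UNIV f] continuous_intros)

theorem theorem4:
  fixes g :: "real \<Rightarrow> real" and f :: "real ^ 'd \<Rightarrow> real"
    and fhat :: "int ^ 'd \<Rightarrow> complex" and \<omega> :: "real ^ 'd"
    and C0 \<tau> c0 :: real
  assumes "real_analytic_on g UNIV"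
    and "analytic_fourier fhat f"
    and "C0 > 0" and "\<tau> > real CARD('d) - 1"
    and "diophantine C0 \<tau> \<omega>"
    and "complex_of_real (g c0) = fhat 0"
    and "deriv g c0 \<noteq> 0"
  shows "\<exists>\<gamma>0>0. \<exists>x0.
      response_family \<gamma>0 g f \<omega> c0 x0 \<and>
      (\<forall>y. response_family \<gamma>0 g f \<omega> c0 y \<longrightarrow> (\<forall>\<gamma>>\<gamma>0. y \<gamma> = x0 \<gamma>)) \<and>
      (deriv g c0 > 0 \<longrightarrow>
        (\<exists>\<gamma>1\<ge>\<gamma>0. \<forall>\<gamma>>\<gamma>1. \<exists>B.
          open B \<and> (c0, 0) \<in> B \<and> range (\<lambda>t. (x0 \<gamma> t, deriv (x0 \<gamma>) t)) \<subseteq> B \<and>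
          attracts_all_from \<gamma> g (\<lambda>t. f (t *\<^sub>R \<omega>)) (x0 \<gamma>) (deriv (x0 \<gamma>)) B))"
proof -
  define a where "a = deriv g c0"
  have a: "a \<noteq> 0" using assms(7) by (simp add: a_def)
  have "real CARD('d) \<ge> 1" by (simp add: Suc_leI)
  hence tau: "\<tau> \<ge> 0" using assms(4) by linarith
  obtain F1 F2 where tf: "torus_fun f" and F1: "torus_fun F1" and F2: "torus_fun F2"
    and dF1: "\<And>\<psi> t. ((\<lambda>t. F1 (\<psi> + t *\<^sub>R \<omega>)) has_real_derivative f (\<psi> + t *\<^sub>R \<omega>) - g c0) (at t)"
    and dF2: "\<And>\<psi> t. ((\<lambda>t. F2 (\<psi> + t *\<^sub>R \<omega>)) has_real_derivative F1 (\<psi> + t *\<^sub>R \<omega>)) (at t)"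
    using forcing_primitives[OF assms(2,3) tau assms(5,6)] by metis
  define ft where "ft \<psi> = f \<psi> - g c0" for \<psi>
  have "\<bar>ft \<psi>\<bar> \<le> Mf + \<bar>g c0\<bar>" if "\<And>\<psi>. \<bar>f \<psi>\<bar> \<le> Mf" for Mf \<psi> using that[of \<psi>] unfolding ft_def by linarith
  hence ft: "torus_fun ft" using tf unfolding torus_fun_def ft_def by (auto intro!: continuous_intros)
  obtain B1 B2 B3 where b: "\<And>\<psi>. \<bar>F1 \<psi>\<bar> \<le> B1" "\<And>\<psi>. \<bar>F2 \<psi>\<bar> \<le> B2" "\<And>\<psi>. \<bar>ft \<psi>\<bar> \<le> B3"
    using F1 F2 ft unfolding torus_fun_def by metis
  define B where "B = max 1 (max B1 (max B2 B3))"
  have B: "\<bar>F1 \<psi>\<bar> \<le> B" "\<bar>F2 \<psi>\<bar> \<le> B" "\<bar>ft \<psi>\<bar> \<le> B" "B \<ge> 1" for \<psi>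
    using b[of \<psi>] by (auto simp: B_def)
  obtain r k where r: "r > 0" and k: "k holomorphic_on ball 0 r" "\<And>z. z \<in> ball 0 r \<inter> \<real> \<Longrightarrow> k z \<in> \<real>"
    and gk: "\<And>x. \<bar>x\<bar> < r \<Longrightarrow> complex_of_real (g (c0 + x) - g c0 - a * x) = of_real x * of_real x * k (of_real x)"
    using analytic_quadratic_remainder[OF assms(1), of c0] unfolding a_def by metis
  obtain Kk Lk where K: "Kk \<ge> 0" "Lk \<ge> 0" "\<And>z. norm z \<le> r / 2 \<Longrightarrow> norm (k z) \<le> Kk"
    "\<And>z z'. norm z \<le> r / 2 \<Longrightarrow> norm z' \<le> r / 2 \<Longrightarrow> norm (k z - k z') \<le> Lk * norm (z - z')"
    using holomorphic_bounded_lipschitz[OF k(1) r] by metis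
  obtain \<rho> where rho: "\<rho> > 0"
    and lin: "\<And>x y. \<bar>x - c0\<bar> \<le> \<rho> \<Longrightarrow> \<bar>y - c0\<bar> \<le> \<rho> \<Longrightarrow> \<bar>g x - g y - a * (x - y)\<bar> \<le> \<bar>a\<bar> / 8 * \<bar>x - y\<bar>"
    using nearly_linear_near[OF a r K gk] by metis
  interpret strong_damping a r B Kk Lk F1 F2 ft k \<omega>
    by unfold_locales (fact a r B F1 F2 ft k K)+
  have dF: "((\<lambda>t. F1 (t *\<^sub>R \<omega>)) has_real_derivative ft (t *\<^sub>R \<omega>)) (at t)"
    "((\<lambda>t. F2 (t *\<^sub>R \<omega>)) has_real_derivative F1 (t *\<^sub>R \<omega>)) (at t)" for t
    using dF1[of 0 t] dF2[of 0 t] by (simp_all add: ft_def)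
  \<comment> \<open>for \<open>\<gamma> > 0\<close>, \<open>1 / \<gamma>\<close> lies in the disk of radius \<open>R\<close> exactly when \<open>\<gamma> > \<gamma>0\<close>\<close>
  define \<gamma>0 where "\<gamma>0 = 1 / (2 * R)"
  have gam0: "\<gamma>0 > 0" "1 / \<gamma>0 \<le> 2 * R" using R(1) by (auto simp: \<gamma>0_def)
  have ftf: "(\<lambda>t. ft (t *\<^sub>R \<omega>) + g c0) = (\<lambda>t. f (t *\<^sub>R \<omega>))" by (simp add: ft_def)
  obtain xc X v K where H: "(\<forall>\<psi>. (\<lambda>\<epsilon>. xc \<epsilon> \<psi>) holomorphic_on ball (complex_of_real R) R) \<and>
    (\<forall>\<gamma>>\<gamma>0. \<gamma> > 0 \<and> continuous_on UNIV (X \<gamma>) \<and> (\<forall>\<psi> i. X \<gamma> (\<psi> + axis i (2 * pi)) = X \<gamma> \<psi>) \<and>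
        (\<forall>\<psi>. xc (of_real (1 / \<gamma>)) \<psi> = of_real (X \<gamma> \<psi>)) \<and>
        (\<forall>\<psi>. \<bar>X \<gamma> \<psi> - c0\<bar> \<le> K / \<gamma>) \<and> (\<forall>t. \<bar>v \<gamma> t\<bar> \<le> K / \<gamma>) \<and>
        trajectory_on UNIV \<gamma> g (\<lambda>t. f (t *\<^sub>R \<omega>)) (\<lambda>t. X \<gamma> (t *\<^sub>R \<omega>)) (v \<gamma>))"
    by (rule exE[OF real_response[OF dF, of g c0, unfolded ftf D_def, folded \<gamma>0_def]], rule gk)
       (assumption, elim exE, rule that)
  note xc = conjunct1[OF H, rule_format]
  have Xh: "continuous_on UNIV (X \<gamma>)" "X \<gamma> (\<psi> + axis i (2 * pi)) = X \<gamma> \<psi>"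
    and Xc: "xc (of_real (1 / \<gamma>)) \<psi> = of_real (X \<gamma> \<psi>)"
    and XK: "\<bar>X \<gamma> \<psi> - c0\<bar> \<le> K / \<gamma>" and vK: "\<bar>v \<gamma> t\<bar> \<le> K / \<gamma>"
    and traj: "trajectory_on UNIV \<gamma> g (\<lambda>t. f (t *\<^sub>R \<omega>)) (\<lambda>t. X \<gamma> (t *\<^sub>R \<omega>)) (v \<gamma>)"
    if "\<gamma> > \<gamma>0" for \<gamma> \<psi> i t
    using conjunct2[OF H, rule_format, OF that] by blast+
  define x0 where "x0 \<gamma> t = X \<gamma> (t *\<^sub>R \<omega>)" for \<gamma> t
  have lim: "uniform_limit UNIV x0 (\<lambda>t. c0) at_top"
    unfolding uniform_limit_iff
  proof (intro allI impI)
    fix e :: real assume e: "e > 0"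
    have "((\<lambda>\<gamma>. K / \<gamma>) \<longlongrightarrow> 0) at_top" by (intro tendsto_divide_0[OF tendsto_const] filterlim_at_top_imp_at_infinity filterlim_ident)
    hence "\<forall>\<^sub>F \<gamma> in at_top. K / \<gamma> < e" using e by (rule order_tendstoD(2))
    thus "\<forall>\<^sub>F \<gamma> in at_top. \<forall>t\<in>UNIV. dist (x0 \<gamma> t) c0 < e"
      using eventually_gt_at_top[of \<gamma>0]
      by eventually_elim (auto simp: x0_def dist_real_def intro: le_less_trans[OF XK])
  qed
  have fam: "response_family \<gamma>0 g f \<omega> c0 x0"
    unfolding response_family_def
  proof (intro conjI allI impI)
    fix \<gamma> assume gam: "\<gamma> > \<gamma>0"
    show "quasiperiodic \<omega> (x0 \<gamma>)"
      unfolding quasiperiodic_def x0_def using Xh gam by (intro exI[of _ "X \<gamma>"]) auto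
    show "\<exists>v. trajectory_on UNIV \<gamma> g (\<lambda>t. f (t *\<^sub>R \<omega>)) (x0 \<gamma>) v"
      using traj[OF gam] unfolding x0_def[abs_def] by blast
  next
    show "extends_to_tangent_disk \<gamma>0 x0"
      unfolding extends_to_tangent_disk_def
    proof (intro exI conjI allI impI)
      show "0 < R" "1 / \<gamma>0 \<le> 2 * R" using R(1) gam0 by auto
      show "(\<lambda>\<epsilon>. xc \<epsilon> (t *\<^sub>R \<omega>)) analytic_on ball (complex_of_real R) R" for t
        using xc by (simp add: analytic_on_open)
      show "xc (complex_of_real (1 / \<gamma>)) (t *\<^sub>R \<omega>) = complex_of_real (x0 \<gamma> t)" if "\<gamma> > \<gamma>0" for \<gamma> t
        using Xc[OF that] by (simp add: x0_def)
    qed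
  qed (rule lim)
  have uniq: "y \<gamma> = x0 \<gamma>" if y: "response_family \<gamma>0 g f \<omega> c0 y" and gam: "\<gamma> > \<gamma>0" for y \<gamma>
  proof
    fix t
    have near: "\<forall>\<^sub>F \<gamma> in at_top. \<forall>t. \<bar>z \<gamma> t - c0\<bar> < \<rho>" if "uniform_limit UNIV z (\<lambda>t. c0) at_top" for z :: "real \<Rightarrow> real \<Rightarrow> real"
      using that rho unfolding uniform_limit_iff dist_real_def by auto
    have ylim: "uniform_limit UNIV y (\<lambda>t. c0) at_top" using y by (simp add: response_family_def)
    have "\<forall>\<^sub>F \<gamma> in at_top. x0 \<gamma> = y \<gamma>"
      using near[OF lim] near[OF ylim] eventually_gt_at_top[of \<gamma>0] eventually_ge_at_top[of "max 1 (8 * \<bar>a\<bar>)"]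
    proof eventually_elim
      case (elim \<gamma>)
      have big: "\<gamma> \<ge> 1" "\<gamma> \<ge> 8 * \<bar>a\<bar>" using elim(4) by auto
      have "8 * \<bar>a\<bar> \<le> \<gamma>\<^sup>2" using mult_mono[of 1 \<gamma> "8 * \<bar>a\<bar>" \<gamma>] big by (simp add: power2_eq_square)
      moreover obtain w where w: "trajectory_on UNIV \<gamma> g (\<lambda>t. f (t *\<^sub>R \<omega>)) (y \<gamma>) w"
        using y elim(3) unfolding response_family_def by blast
      moreover obtain u where u: "trajectory_on UNIV \<gamma> g (\<lambda>t. f (t *\<^sub>R \<omega>)) (x0 \<gamma>) u"
        using fam elim(3) unfolding response_family_def by blast
      ultimately show ?case
        by (intro bounded_trajectories_coincide[OF u w _ _ lin a])
           (use elim big in \<open>auto intro: less_imp_le\<close>)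
    qed
    then obtain \<Gamma> where \<Gamma>: "\<And>\<gamma>. \<gamma> \<ge> \<Gamma> \<Longrightarrow> x0 \<gamma> = y \<gamma>" unfolding eventually_at_top_linorder by blast
    obtain R' yc where R': "1 / \<gamma>0 \<le> 2 * R'" and yc: "\<And>t. (\<lambda>\<epsilon>. yc \<epsilon> t) analytic_on ball (complex_of_real R') R'"
      "\<And>\<gamma> t. \<gamma> > \<gamma>0 \<Longrightarrow> yc (complex_of_real (1 / \<gamma>)) t = complex_of_real (y \<gamma> t)"
      using y unfolding response_family_def extends_to_tangent_disk_def by metis
    have "x0 \<gamma> t = y \<gamma> t"
      by (rule tangent_disk_identity[where x = "\<lambda>\<gamma>. x0 \<gamma> t" and y = "\<lambda>\<gamma>. y \<gamma> t" and xc = "\<lambda>\<epsilon>. xc \<epsilon> (t *\<^sub>R \<omega>)"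
          and yc = "\<lambda>\<epsilon>. yc \<epsilon> t" and \<Gamma> = \<Gamma>, OF gam0 R' xc _ _ yc(2) _ gam])
         (use Xc yc(1) \<Gamma> in \<open>auto simp: x0_def intro: analytic_imp_holomorphic\<close>)
    thus "y \<gamma> t = x0 \<gamma> t" by simp
  qed
  let ?g1 = "max \<gamma>0 (max 1 (max (2 * a) (24 * K / \<rho>)))"
  have attr: "\<exists>\<gamma>1\<ge>\<gamma>0. \<forall>\<gamma>>\<gamma>1. \<exists>B. open B \<and> (c0, 0) \<in> B \<and> range (\<lambda>t. (x0 \<gamma> t, deriv (x0 \<gamma>) t)) \<subseteq> B \<and>
          attracts_all_from \<gamma> g (\<lambda>t. f (t *\<^sub>R \<omega>)) (x0 \<gamma>) (deriv (x0 \<gamma>)) B" if apos: "a > 0"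
    \<comment> \<open>the orbit has gap at most \<open>3 K / \<gamma>\<close> from \<open>(c0, 0)\<close>, which is below \<open>\<rho> / 8\<close> once \<open>\<gamma> > 24 K / \<rho>\<close>\<close>
  proof (intro exI[of _ "?g1"] conjI allI impI)
    show "?g1 \<ge> \<gamma>0" by simp
    fix \<gamma> assume "\<gamma> > ?g1"
    hence gam: "\<gamma> > \<gamma>0" "\<gamma> > 1" "\<gamma> > 2 * a" "\<gamma> > 24 * K / \<rho>" by auto
    have g2: "\<gamma>\<^sup>2 \<ge> 2 * a" using mult_mono[of 1 \<gamma> "2 * a" \<gamma>] gam apos by (simp add: power2_eq_square)
    have dv: "deriv (x0 \<gamma>) = v \<gamma>"
    proof
      fix t
      show "deriv (x0 \<gamma>) t = v \<gamma> t"
        using traj[OF gam(1)] by (intro DERIV_imp_deriv) (simp add: trajectory_on_def x0_def[abs_def])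
    qed
    have x0: "trajectory_on UNIV \<gamma> g (\<lambda>t. f (t *\<^sub>R \<omega>)) (x0 \<gamma>) (v \<gamma>)"
      using traj[OF gam(1)] by (simp add: x0_def[abs_def])
    have orbit: "phase_gap \<gamma> (x0 \<gamma> t - c0) (v \<gamma> t) < \<rho> / 8" for t
    proof -
      have "phase_gap \<gamma> (x0 \<gamma> t - c0) (v \<gamma> t) \<le> \<bar>x0 \<gamma> t - c0 + v \<gamma> t / \<gamma>\<bar> + \<bar>v \<gamma> t / \<gamma>\<bar>"
        unfolding phase_gap_def using norm_Pair_le[of "x0 \<gamma> t - c0 + v \<gamma> t / \<gamma>" "v \<gamma> t / \<gamma>"] by simp
      moreover have "\<bar>x0 \<gamma> t - c0\<bar> \<le> K / \<gamma>" using XK[OF gam(1)] by (simp add: x0_def)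
      moreover have "\<bar>v \<gamma> t / \<gamma>\<bar> \<le> \<bar>v \<gamma> t\<bar>" using gam by (simp add: abs_divide divide_le_eq mult_le_cancel_left1)
      moreover have "\<bar>v \<gamma> t\<bar> \<le> K / \<gamma>" by (rule vK[OF gam(1)])
      ultimately have "phase_gap \<gamma> (x0 \<gamma> t - c0) (v \<gamma> t) \<le> 3 * (K / \<gamma>)" by linarith
      also have "\<dots> < \<rho> / 8" using gam rho by (simp add: field_simps)
      finally show ?thesis .
    qed
    let ?B = "{q. phase_gap \<gamma> (fst q - c0) (snd q) < \<rho> / 8}"
    have "open ?B" unfolding phase_gap_def using gam
      by (intro open_Collect_less continuous_intros) auto
    moreover have "(c0, 0) \<in> ?B" using rho by (simp add: phase_gap_def)
    moreover have "range (\<lambda>t. (x0 \<gamma> t, deriv (x0 \<gamma>) t)) \<subseteq> ?B" unfolding dv using orbit by auto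
    moreover have "attracts_all_from \<gamma> g (\<lambda>t. f (t *\<^sub>R \<omega>)) (x0 \<gamma>) (deriv (x0 \<gamma>)) ?B"
    proof -
      obtain Hb where Hb: "\<And>t. \<bar>f (t *\<^sub>R \<omega>)\<bar> \<le> Hb" using torus_fun_line(2)[OF tf] by blast
      show ?thesis unfolding dv
        by (rule attracting_neighbourhood[OF apos _ g2 _ x0 orbit torus_fun_line(1)[OF tf] Hb])
           (use gam lin apos in auto)
    qed
    ultimately show "\<exists>B. open B \<and> (c0, 0) \<in> B \<and> range (\<lambda>t. (x0 \<gamma> t, deriv (x0 \<gamma>) t)) \<subseteq> B \<and>
          attracts_all_from \<gamma> g (\<lambda>t. f (t *\<^sub>R \<omega>)) (x0 \<gamma>) (deriv (x0 \<gamma>)) B" by blast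
  qed
  show ?thesis
    using gam0(1) fam uniq attr unfolding a_def[symmetric] by blast
qed

end
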